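(* DTP restricted to instances whose query is nonrecursive and connected is in PTIME in data complexity (i.e., when the query is fixed), with numbers encoded in unary.
   Context: Temporal Datalog. Constants are partitioned into objects and integer time points; variables into object variables and time variables. A time term is a time point, a time variable, or an expression $t+k$ with $t$ a time variable and $k\in\mathbb{Z}$. Each predicate is either extensional (EDB) or intensional (IDB) and has an arity $n\ge0$, each position being of object sort or time sort; a predicate is rigid if all its positions are of object sort, and temporal if its last position is of time sort and all others are of object sort. An atom $P(t_1,\dots,t_n)$ has terms of the required sorts. A rule is $\bigwedge_i\alpha_i\to\alpha$ with $\alpha$ and all $\alpha_i$ rigid or temporal atoms, $\alpha$ IDB whenever the body is nonempty, and every head variable occurring in the body. A program is a finite set of rules. A fact is a ground rigid or temporal atom without $+$ (identified with the rule $\top\to\alpha$); a dataset is a finite set of EDB facts. Rules are read as universally quantified first-order sentences with $+$ interpreted as integer addition; $\Pi\models\alpha$ denotes entailment. A query is $Q=\langle P_Q,\Pi_Q\rangle$ with $\Pi_Q$ a program and $P_Q$ an IDB predicate of $\Pi_Q$; it is temporal if $P_Q$ is temporal. For a temporal query $Q$, dataset $D$ and time point $\tau$, $Q(D,\tau)$ is the set of tuples of objects $\vec o$ with $\Pi_Q\cup D\models P_Q(\vec o,\tau)$. A $\tau_{in}$-history is a dataset consisting of rigid facts and temporal facts with time argument $\le\tau_{in}$; a $\tau_{in}$-update is a dataset consisting of temporal facts with time argument $>\tau_{in}$. Definitive Time Point (DTP): an instance is $\langle Q,D,\tau_{in},\tau_{out}\rangle$ with $Q$ a temporal query, $D$ a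 $\tau_{in}$-history and $\tau_{out}\le\tau_{in}$; DTP holds for it iff $Q(D,\tau_{out})=Q(D\cup U,\tau_{out})$ for every $\tau_{in}$-update $U$. Predicate $P$ depends on $P'$ in $\Pi$ if some rule of $\Pi$ has $P$ in the head and $P'$ in the body; $\Pi$ (or a query with program $\Pi$) is nonrecursive if the graph of this dependency relation is acyclic. A rule is connected if it contains at most one time variable and, if a time variable occurs in the body, it also occurs in the head; a query is connected if all its rules are. *)

theory Defs
  imports Main
begin

datatype sort = SObj | STime

text \<open>A predicate: a name, the list of sorts of its positions, and a flag telling
  whether it is intensional (IDB, True) or extensional (EDB, False).
  Objects are represented by natural numbers, time points by integers,
  object/time variables by natural numbers (two separate namespaces).\<close>
datatype pred = Pred (pname: nat) (psig: "sort list") (pidb: bool)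

datatype trm =
    OConst nat
  | OVar nat
  | TConst int
  | TVar nat
  | TPlus nat int

datatype atom = Atom (apred: pred) (aargs: "trm list")

datatype rule = Rule (rbody: "atom list") (rhead: atom)

definition rigid :: "pred \<Rightarrow> bool" where
  "rigid P \<longleftrightarrow> (\<forall>s\<in>set (psig P). s = SObj)"

definition temporal :: "pred \<Rightarrow> bool" where
  "temporal P \<longleftrightarrow> psig P \<noteq> [] \<and> last (psig P) = STime
      \<and> (\<forall>s\<in>set (butlast (psig P)). s = SObj)"

fun trm_sort :: "trm \<Rightarrow> sort" where
  "trm_sort (OConst _) = SObj"
| "trm_sort (OVar _) = SObj"
| "trm_sort (TConst _) = STime"
| "trm_sort (TVar _) = STime"
| "trm_sort (TPlus _ _) = STime"

definition wf_atom :: "atom \<Rightarrow> bool" where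
  "wf_atom a \<longleftrightarrow> (rigid (apred a) \<or> temporal (apred a))
      \<and> map trm_sort (aargs a) = psig (apred a)"

fun trm_ovars :: "trm \<Rightarrow> nat set" where
  "trm_ovars (OVar x) = {x}"
| "trm_ovars _ = {}"

fun trm_tvars :: "trm \<Rightarrow> nat set" where
  "trm_tvars (TVar x) = {x}"
| "trm_tvars (TPlus x _) = {x}"
| "trm_tvars _ = {}"

definition atom_ovars :: "atom \<Rightarrow> nat set" where
  "atom_ovars a = (\<Union>t\<in>set (aargs a). trm_ovars t)"

definition atom_tvars :: "atom \<Rightarrow> nat set" where
  "atom_tvars a = (\<Union>t\<in>set (aargs a). trm_tvars t)"

definition body_ovars :: "rule \<Rightarrow> nat set" where
  "body_ovars r = (\<Union>a\<in>set (rbody r). atom_ovars a)"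

definition body_tvars :: "rule \<Rightarrow> nat set" where
  "body_tvars r = (\<Union>a\<in>set (rbody r). atom_tvars a)"

definition wf_rule :: "rule \<Rightarrow> bool" where
  "wf_rule r \<longleftrightarrow> wf_atom (rhead r) \<and> (\<forall>a\<in>set (rbody r). wf_atom a)
      \<and> (rbody r \<noteq> [] \<longrightarrow> pidb (apred (rhead r)))
      \<and> atom_ovars (rhead r) \<subseteq> body_ovars r
      \<and> atom_tvars (rhead r) \<subseteq> body_tvars r"

type_synonym program = "rule set"

definition wf_program :: "program \<Rightarrow> bool" where
  "wf_program \<Pi> \<longleftrightarrow> finite \<Pi> \<and> (\<forall>r\<in>\<Pi>. wf_rule r)"

definition preds_of :: "program \<Rightarrow> pred set" where
  "preds_of \<Pi> = (\<Union>r\<in>\<Pi>. apred ` (insert (rhead r) (set (rbody r))))"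

datatype gval = GO nat | GT int

datatype gatom = GAtom (gpred: pred) (gargs: "gval list")

fun gval_sort :: "gval \<Rightarrow> sort" where
  "gval_sort (GO _) = SObj"
| "gval_sort (GT _) = STime"

text \<open>A fact: a ground (rigid or temporal) atom without \<open>+\<close>; it is represented
  directly by its ground values.\<close>
definition fact :: "gatom \<Rightarrow> bool" where
  "fact g \<longleftrightarrow> (rigid (gpred g) \<or> temporal (gpred g))
      \<and> map gval_sort (gargs g) = psig (gpred g)"

definition dataset :: "gatom set \<Rightarrow> bool" where
  "dataset D \<longleftrightarrow> finite D \<and> (\<forall>g\<in>D. fact g \<and> \<not> pidb (gpred g))"

fun eval_trm :: "(nat \<Rightarrow> nat) \<Rightarrow> (nat \<Rightarrow> int) \<Rightarrow> trm \<Rightarrow> gval" where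
  "eval_trm \<sigma> \<theta> (OConst c) = GO c"
| "eval_trm \<sigma> \<theta> (OVar x) = GO (\<sigma> x)"
| "eval_trm \<sigma> \<theta> (TConst i) = GT i"
| "eval_trm \<sigma> \<theta> (TVar x) = GT (\<theta> x)"
| "eval_trm \<sigma> \<theta> (TPlus x k) = GT (\<theta> x + k)"

definition eval_atom :: "(nat \<Rightarrow> nat) \<Rightarrow> (nat \<Rightarrow> int) \<Rightarrow> atom \<Rightarrow> gatom" where
  "eval_atom \<sigma> \<theta> a = GAtom (apred a) (map (eval_trm \<sigma> \<theta>) (aargs a))"

definition sat_rule :: "gatom set \<Rightarrow> rule \<Rightarrow> bool" where
  "sat_rule I r \<longleftrightarrow> (\<forall>\<sigma> \<theta>. (\<forall>a\<in>set (rbody r). eval_atom \<sigma> \<theta> a \<in> I)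
                          \<longrightarrow> eval_atom \<sigma> \<theta> (rhead r) \<in> I)"

definition entails :: "program \<Rightarrow> gatom set \<Rightarrow> gatom \<Rightarrow> bool" where
  "entails \<Pi> D \<alpha> \<longleftrightarrow> (\<forall>I. (\<forall>r\<in>\<Pi>. sat_rule I r) \<and> D \<subseteq> I \<longrightarrow> \<alpha> \<in> I)"

type_synonym query = "pred \<times> program"

definition is_query :: "query \<Rightarrow> bool" where
  "is_query Q \<longleftrightarrow> wf_program (snd Q) \<and> pidb (fst Q) \<and> fst Q \<in> preds_of (snd Q)"

definition temporal_query :: "query \<Rightarrow> bool" where
  "temporal_query Q \<longleftrightarrow> is_query Q \<and> temporal (fst Q)"

definition answers :: "query \<Rightarrow> gatom set \<Rightarrow> int \<Rightarrow> nat list set" where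
  "answers Q D \<tau> = {os. entails (snd Q) D (GAtom (fst Q) (map GO os @ [GT \<tau>]))}"

definition history :: "int \<Rightarrow> gatom set \<Rightarrow> bool" where
  "history \<tau>in D \<longleftrightarrow> dataset D \<and>
     (\<forall>g\<in>D. rigid (gpred g) \<or> (temporal (gpred g) \<and> (\<exists>t. last (gargs g) = GT t \<and> t \<le> \<tau>in)))"

definition update :: "int \<Rightarrow> gatom set \<Rightarrow> bool" where
  "update \<tau>in U \<longleftrightarrow> dataset U \<and>
     (\<forall>g\<in>U. temporal (gpred g) \<and> (\<exists>t. last (gargs g) = GT t \<and> t > \<tau>in))"

definition DTP :: "query \<Rightarrow> gatom set \<Rightarrow> int \<Rightarrow> int \<Rightarrow> bool" where
  "DTP Q D \<tau>in \<tau>out \<longleftrightarrow>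
     (\<forall>U. update \<tau>in U \<longrightarrow> answers Q D \<tau>out = answers Q (D \<union> U) \<tau>out)"

definition depends :: "program \<Rightarrow> (pred \<times> pred) set" where
  "depends \<Pi> = {(apred (rhead r), apred b) | r b. r \<in> \<Pi> \<and> b \<in> set (rbody r)}"

definition nonrecursive :: "program \<Rightarrow> bool" where
  "nonrecursive \<Pi> \<longleftrightarrow> acyclic (depends \<Pi>)"

definition connected_rule :: "rule \<Rightarrow> bool" where
  "connected_rule r \<longleftrightarrow>
     card (atom_tvars (rhead r) \<union> body_tvars r) \<le> 1 \<and>
     body_tvars r \<subseteq> atom_tvars (rhead r)"

definition connected_query :: "query \<Rightarrow> bool" where
  "connected_query Q \<longleftrightarrow> (\<forall>r\<in>snd Q. connected_rule r)"

datatype dir = DL | DR | DN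

text \<open>States are \<open>0..<tm_states\<close> (0 initial, 1 accepting, 2 rejecting), tape symbols
  are \<open>0..<tm_syms\<close> (0 is the blank).\<close>
record tm =
  tm_states :: nat
  tm_syms :: nat
  tm_delta :: "nat \<Rightarrow> nat \<Rightarrow> nat \<times> nat \<times> dir"

definition input_alphabet :: nat where "input_alphabet = 12"

definition wf_tm :: "tm \<Rightarrow> bool" where
  "wf_tm M \<longleftrightarrow> 3 \<le> tm_states M \<and> input_alphabet \<le> tm_syms M \<and>
     (\<forall>q a. q < tm_states M \<and> a < tm_syms M \<longrightarrow>
        (case tm_delta M q a of (q', b, d) \<Rightarrow> q' < tm_states M \<and> b < tm_syms M))"

text \<open>Configuration: state, reversed part left of the head, part from the head on.\<close>
type_synonym config = "nat \<times> nat list \<times> nat list"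

definition tm_step :: "tm \<Rightarrow> config \<Rightarrow> config" where
  "tm_step M c = (case c of (q, ls, rs) \<Rightarrow>
     if q = 1 \<or> q = 2 then c else
     (let a = (case rs of [] \<Rightarrow> 0 | x # _ \<Rightarrow> x) in
      case tm_delta M q a of (q', b, d) \<Rightarrow>
        (let rs' = b # tl rs in
         case d of
           DL \<Rightarrow> (case ls of [] \<Rightarrow> (q', [], 0 # rs') | x # ls' \<Rightarrow> (q', ls', x # rs'))
         | DR \<Rightarrow> (q', b # ls, tl rs')
         | DN \<Rightarrow> (q', ls, rs'))))"

definition tm_run :: "tm \<Rightarrow> nat \<Rightarrow> nat list \<Rightarrow> config" where
  "tm_run M n w = (tm_step M ^^ n) (0, [], w)"

text \<open>Symbols: 1,2 binary digits; 3 unary tick; 4 minus sign; 5 argument separator;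
  6 end of fact; 7 section separator; 8 object marker; 9 time marker;
  10,11 sort symbols.  Objects (abstract constants) are written in binary,
  time points (integers) in unary.\<close>
fun bin :: "nat \<Rightarrow> nat list" where
  "bin n = (if n = 0 then [] else bin (n div 2) @ [if n mod 2 = 0 then 1 else 2])"

definition unary_int :: "int \<Rightarrow> nat list" where
  "unary_int i = (if i < 0 then [4] else []) @ replicate (nat \<bar>i\<bar>) 3"

fun enc_sort :: "sort \<Rightarrow> nat" where
  "enc_sort SObj = 10"
| "enc_sort STime = 11"

fun enc_gval :: "gval \<Rightarrow> nat list" where
  "enc_gval (GO n) = 8 # bin n"
| "enc_gval (GT i) = 9 # unary_int i"

definition enc_pred :: "pred \<Rightarrow> nat list" where
  "enc_pred P = bin (pname P) @ [5] @ map enc_sort (psig P) @ [5] @ [if pidb P then 2 else 1]"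

definition enc_fact :: "gatom \<Rightarrow> nat list" where
  "enc_fact g = enc_pred (gpred g) @ concat (map (\<lambda>v. 5 # enc_gval v) (gargs g)) @ [6]"

definition enc_instance :: "gatom list \<Rightarrow> int \<Rightarrow> int \<Rightarrow> nat list" where
  "enc_instance xs \<tau>in \<tau>out =
     concat (map enc_fact xs) @ [7] @ unary_int \<tau>in @ [7] @ unary_int \<tau>out"

definition DTP_in_PTIME_data :: "query \<Rightarrow> bool" where
  "DTP_in_PTIME_data Q \<longleftrightarrow>
     (\<exists>M c k. wf_tm M \<and>
        (\<forall>D \<tau>in \<tau>out xs. history \<tau>in D \<and> \<tau>out \<le> \<tau>in \<and> distinct xs \<and> set xs = D \<longrightarrow>
           (let w = enc_instance xs \<tau>in \<tau>out;
                q = fst (tm_run M (c * length w ^ k + c) w)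
            in (q = 1 \<or> q = 2) \<and> (q = 1 \<longleftrightarrow> DTP Q D \<tau>in \<tau>out))))"

end

theory Submission
  imports Defs
begin

text \<open>A nonrecursive query has derivations of bounded size, and connectedness makes every time
  point in a derivation of a fact at \<open>\<tau>out\<close> either a constant of the query or \<open>\<tau>out + k\<close> with \<open>k\<close>
  bounded by the query. Since entailment is monotone and compact, DTP fails iff some tuple is an
  answer over the history together with all facts after \<open>\<tau>in\<close> but not over the history alone.
  Objects foreign to data and query can all be collapsed to one of them, so derivability becomes a
  first-order property of the input word, with quantifiers ranging over positions: an object is
  given by one of its occurrences, and equality of names as well as the comparison of unary time
  points reduces to addition of positions. First-order formulas with addition are decided
  by a machine with one head per variable, each head being a mark on the tape of a Turing
  machine that sweeps over its input once per step.\<close>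

text \<open>The query is fixed, so everything that depends on it alone may become a finite
  disjunction: rules, constants, time offsets. Only the formula must be uniform in the instance,
  which is what \<open>definable\<close> states. Two infinities stand in the way. Updates range over
  all finite sets of future facts; they are replaced by the single infinite set
  \<open>future\<close>, which need not be represented because membership in it depends only on
  predicate, sorts and last argument. Answer tuples and rule variables range over all objects;
  collapsing them works because \<open>future\<close> is closed under every renaming of objects,
  while a renaming that fixes the objects of the history fixes the history. The foreign object
  occurs in no fact derived from the history alone, as head variables occur in bodies, so the
  collapse cannot turn a non-answer over the history into an answer. Negation is free, since the
  machine decides each formula with a success and a failure exit; hence one formula can say
  "derivable with the future facts, but not without them".\<close>

lemma bij_betw_lessThan_card_prefix:
  assumes "finite S" "distinct xs" "set xs \<subseteq> S"
  shows "\<exists>f. bij_betw f S {..<card S} \<and> (\<forall>i<length xs. f (xs ! i) = i)"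
proof -
  obtain ys where ys: "set ys = S - set xs" "distinct ys"
    using assms(1) finite_distinct_list[of "S - set xs"] by auto
  define zs where "zs = xs @ ys"
  have zs: "set zs = S" "distinct zs"
    using ys assms by (auto simp: zs_def)
  have len: "length zs = card S"
    using zs distinct_card by metis
  define f where "f = the_inv_into {..<length zs} ((!) zs)"
  have bij: "bij_betw ((!) zs) {..<length zs} S"
    using bij_betw_nth[OF zs(2)] zs(1) by blast
  have "bij_betw f S {..<card S}"
    unfolding f_def using bij_betw_the_inv_into[OF bij] len by simp
  moreover have "f (xs ! i) = i" if "i < length xs" for i
  proof -
    have "xs ! i = zs ! i" "i < length zs"
      using that by (simp_all add: zs_def nth_append)
    then show ?thesis
      unfolding f_def using the_inv_into_f_f[of "(!) zs" "{..<length zs}" i] bij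
      by (simp add: bij_betw_def)
  qed
  ultimately show ?thesis by blast
qed

section \<open>Machines on a functional tape\<close>

fun shift_of :: "dir \<Rightarrow> int" where
  "shift_of DL = -1" | "shift_of DR = 1" | "shift_of DN = 0"

text \<open>On tapes that are functions on the integers a write is a function update and a move is
  an addition, which suits the simulations below. The model is faithful because
  \<open>tm_step\<close> is two-way infinite as well: it supplies a blank when the left list is
  exhausted.\<close>

definition fstep :: "('q \<Rightarrow> 'a \<Rightarrow> 'q \<times> 'a \<times> dir) \<Rightarrow> 'q set
    \<Rightarrow> 'q \<times> int \<times> (int \<Rightarrow> 'a) \<Rightarrow> 'q \<times> int \<times> (int \<Rightarrow> 'a)" where
  "fstep \<delta> H = (\<lambda>(q, p, T). if q \<in> H then (q, p, T)
     else (case \<delta> q (T p) of (q', b, d) \<Rightarrow> (q', p + shift_of d, T(p := b))))"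

definition tape_of :: "'a \<Rightarrow> 'a list \<Rightarrow> int \<Rightarrow> 'a" where
  "tape_of b w j = (if 0 \<le> j \<and> nat j < length w then w ! nat j else b)"

definition cell :: "nat list \<Rightarrow> nat \<Rightarrow> nat" where
  "cell xs j = (if j < length xs then xs ! j else 0)"

lemma cell_simps [simp]:
  "cell [] j = 0" "cell (x # xs) 0 = x" "cell (x # xs) (Suc j) = cell xs j"
  by (simp_all add: cell_def)

lemma cell_tl: "cell (tl xs) j = cell xs (Suc j)"
  by (cases xs) simp_all

lemma cell_0: "cell xs 0 = (case xs of [] \<Rightarrow> 0 | x # _ \<Rightarrow> x)"
  by (cases xs) simp_all

text \<open>Both lists are read through \<open>cell\<close>, which yields the blank beyond their
  ends, so lists that differ in trailing blanks describe the same tape. The left list starts with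
  the cell nearest to the head.\<close>

definition tape_rel :: "config \<Rightarrow> nat \<times> int \<times> (int \<Rightarrow> nat) \<Rightarrow> bool" where
  "tape_rel c = (\<lambda>(q, p, T). case c of (q', ls, rs) \<Rightarrow> q' = q \<and>
     (\<forall>j. T (p + int j) = cell rs j) \<and> (\<forall>j. T (p - 1 - int j) = cell ls j))"

lemma tape_rel_step:
  assumes "tape_rel c f"
  shows "tape_rel (tm_step M c) (fstep (tm_delta M) {1, 2} f)"
proof -
  obtain q ls rs where c: "c = (q, ls, rs)" by (cases c)
  obtain q0 p T where f: "f = (q0, p, T)" by (cases f)
  have q: "q0 = q" and R: "\<And>j. T (p + int j) = cell rs j"
    and L: "\<And>j. T (p - 1 - int j) = cell ls j"
    using assms by (auto simp: c f tape_rel_def)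
  show ?thesis
  proof (cases "q = 1 \<or> q = 2")
    case True
    then show ?thesis using assms by (auto simp: c f q tm_step_def fstep_def)
  next
    case False
    obtain q' b d where \<delta>: "tm_delta M q (cell rs 0) = (q', b, d)"
      by (cases "tm_delta M q (cell rs 0)")
    have Tp: "T p = cell rs 0" using R[of 0] by simp
    define T' where "T' = T(p := b)"
    have R': "T' (p + int j) = cell (b # tl rs) j" for j
      using R[of j] by (cases j) (auto simp: T'_def cell_tl)
    have L': "T' (p - 1 - int j) = cell ls j" for j
      using L[of j] by (simp add: T'_def)
    have fs: "fstep (tm_delta M) {1, 2} f = (q', p + shift_of d, T')"
      using False by (simp add: f q fstep_def Tp \<delta> T'_def)
    have ts: "tm_step M c = (case d of
           DL \<Rightarrow> (case ls of [] \<Rightarrow> (q', [], 0 # b # tl rs) | x # ls' \<Rightarrow> (q', ls', x # b # tl rs))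
         | DR \<Rightarrow> (q', b # ls, tl rs)
         | DN \<Rightarrow> (q', ls, b # tl rs))"
      using False \<delta> by (simp add: c tm_step_def Let_def cell_0)
    show ?thesis
    proof (cases d)
      case DN
      then show ?thesis using R' L' unfolding fs ts by (simp add: tape_rel_def)
    next
      case DR
      have 1: "T' (p + 1 + int j) = cell (tl rs) j" for j
        using R'[of "Suc j"] by (simp add: ac_simps)
      have 2: "T' (p + 1 - 1 - int j) = cell (b # ls) j" for j
      proof (cases j)
        case 0
        then show ?thesis using R'[of 0] by simp
      next
        case (Suc i)
        then show ?thesis using L'[of i] by (simp add: algebra_simps)
      qed
      show ?thesis using DR 1 2 unfolding fs ts by (simp add: tape_rel_def)
    next
      case DL
      have 1: "T' (p - 1 + int j) = cell (cell ls 0 # b # tl rs) j" for j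
      proof (cases j)
        case 0
        then show ?thesis using L'[of 0] by simp
      next
        case (Suc i)
        then show ?thesis using R'[of i] by (simp add: algebra_simps)
      qed
      have 2: "T' (p - 1 - 1 - int j) = cell (tl ls) j" for j
        using L'[of "Suc j"] by (simp add: cell_tl algebra_simps)
      show ?thesis using DL 1 2 unfolding fs ts by (cases ls) (simp_all add: tape_rel_def)
    qed
  qed
qed

lemma tape_rel_run:
  "tape_rel (tm_run M n w) ((fstep (tm_delta M) {1, 2} ^^ n) (0, 0, tape_of 0 w))"
proof (induction n)
  case 0
  then show ?case by (auto simp: tm_run_def tape_rel_def tape_of_def cell_def)
next
  case (Suc n)
  then show ?case using tape_rel_step by (simp add: tm_run_def)
qed

section \<open>Realising machines over arbitrary finite sets of states and symbols\<close>

locale abstract_tm =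
  fixes \<delta> :: "'q \<Rightarrow> 'a \<Rightarrow> 'q \<times> 'a \<times> dir"
    and S :: "'q set" and A :: "'a set" and s0 s1 s2 :: 'q and inp :: "nat \<Rightarrow> 'a"
  assumes finite_S: "finite S" and finite_A: "finite A"
    and states: "s0 \<in> S" "s1 \<in> S" "s2 \<in> S" and distinct_states: "distinct [s0, s1, s2]"
    and inj_inp: "inj_on inp {..<input_alphabet}" and inp_A: "inp ` {..<input_alphabet} \<subseteq> A"
    and closed: "\<And>q a q' b d. q \<in> S \<Longrightarrow> a \<in> A \<Longrightarrow> \<delta> q a = (q', b, d) \<Longrightarrow> q' \<in> S \<and> b \<in> A"
begin

text \<open>\<open>tm\<close> prescribes 0, 1, 2 as initial, accepting and rejecting state, and its
  input symbols are literal numbers with 0 as the blank. Bijections \<open>f\<close> and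
  \<open>g\<close> that take these prescribed values rename states and symbols; both machines then
  run in lockstep, and \<open>closed\<close> keeps the renamed transitions in range.\<close>

lemma realise:
  "\<exists>M. wf_tm M \<and> (\<forall>w n. set w \<subseteq> {..<input_alphabet} \<longrightarrow>
     (let q = fst ((fstep \<delta> {s1, s2} ^^ n) (s0, 0, tape_of (inp 0) (map inp w)));
          q' = fst (tm_run M n w)
      in (q' = 1 \<longleftrightarrow> q = s1) \<and> (q' = 2 \<longleftrightarrow> q = s2)))"
proof -
  obtain f where f: "bij_betw f S {..<card S}" and f': "\<forall>i<length [s0, s1, s2]. f ([s0, s1, s2] ! i) = i"
    using bij_betw_lessThan_card_prefix[OF finite_S distinct_states] states by auto
  have f012: "f s0 = 0" "f s1 = 1" "f s2 = 2"
    using f'[rule_format, of 0] f'[rule_format, of 1] f'[rule_format, of 2] by simp_all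
  have "distinct (map inp [0..<input_alphabet])" "set (map inp [0..<input_alphabet]) \<subseteq> A"
    using inj_inp inp_A by (auto simp: distinct_map atLeast0LessThan)
  from bij_betw_lessThan_card_prefix[OF finite_A this] obtain g
    where g: "bij_betw g A {..<card A}" and g': "\<And>i. i < input_alphabet \<Longrightarrow> g (inp i) = i"
    by auto
  define fi where "fi = the_inv_into S f"
  define gi where "gi = the_inv_into A g"
  have fi: "\<And>q. q \<in> S \<Longrightarrow> fi (f q) = q" "\<And>i. i < card S \<Longrightarrow> fi i \<in> S"
    using f by (auto simp: fi_def bij_betw_def the_inv_into_f_f intro!: the_inv_into_into)
  have gi: "\<And>q. q \<in> A \<Longrightarrow> gi (g q) = q" "\<And>i. i < card A \<Longrightarrow> gi i \<in> A"
    using g by (auto simp: gi_def bij_betw_def the_inv_into_f_f intro!: the_inv_into_into)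
  have f_less: "\<And>q. q \<in> S \<Longrightarrow> f q < card S" and g_less: "\<And>a. a \<in> A \<Longrightarrow> g a < card A"
    using f g by (auto simp: bij_betw_def)
  define M where "M = \<lparr>tm_states = card S, tm_syms = card A,
    tm_delta = (\<lambda>i j. case \<delta> (fi i) (gi j) of (q', b, d) \<Rightarrow> (f q', g b, d))\<rparr>"
  have "3 \<le> card S"
    using f_less[OF states(3)] f012 by simp
  moreover have "input_alphabet \<le> card A"
  proof -
    have "card (inp ` {..<input_alphabet}) \<le> card A"
      using inp_A finite_A by (rule card_mono[rotated])
    then show ?thesis by (simp add: card_image inj_inp)
  qed
  moreover have "f q' < card S \<and> g b < card A"
    if "i < card S" "j < card A" "\<delta> (fi i) (gi j) = (q', b, d)" for i j q' b d
    using closed[OF fi(2)[OF that(1)] gi(2)[OF that(2)] that(3)] by (simp add: f_less g_less)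
  ultimately have wf: "wf_tm M"
    by (auto simp: wf_tm_def M_def split: prod.splits)
  have run: "\<exists>q p T. (fstep \<delta> {s1, s2} ^^ n) (s0, 0, tape_of (inp 0) (map inp w)) = (q, p, T) \<and>
      (fstep (tm_delta M) {1, 2} ^^ n) (0, 0, tape_of 0 w) = (f q, p, g \<circ> T) \<and>
      q \<in> S \<and> range T \<subseteq> A"
    if w: "set w \<subseteq> {..<input_alphabet}" for w n
  proof (induction n)
    case 0
    have "0 < input_alphabet" by (simp add: input_alphabet_def)
    then have inp0: "inp 0 \<in> A" "g (inp 0) = 0" using inp_A g' by auto
    have inp: "inp (w ! i) \<in> A \<and> g (inp (w ! i)) = w ! i" if "i < length w" for i
      using w inp_A g' nth_mem[OF that] by auto
    have "range (tape_of (inp 0) (map inp w)) \<subseteq> A" "tape_of 0 w = g \<circ> tape_of (inp 0) (map inp w)"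
      using inp0 inp by (auto simp: tape_of_def fun_eq_iff)
    then show ?case using states f012 by simp
  next
    case (Suc n)
    then obtain q p T where IH:
      "(fstep \<delta> {s1, s2} ^^ n) (s0, 0, tape_of (inp 0) (map inp w)) = (q, p, T)"
      "(fstep (tm_delta M) {1, 2} ^^ n) (0, 0, tape_of 0 w) = (f q, p, g \<circ> T)"
      "q \<in> S" "range T \<subseteq> A" by blast
    have halt: "f q \<in> {1, 2} \<longleftrightarrow> q \<in> {s1, s2}"
      using f012 fi(1) IH(3) states by (metis insert_iff singletonD)
    obtain q' b d where \<delta>: "\<delta> q (T p) = (q', b, d)" by (cases "\<delta> q (T p)")
    have Tp: "T p \<in> A" using IH(4) by auto
    have c: "q' \<in> S" "b \<in> A" using closed[OF IH(3) Tp \<delta>] by auto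
    have d': "tm_delta M (f q) (g (T p)) = (f q', g b, d)"
      using \<delta> fi(1)[OF IH(3)] gi(1)[OF Tp] by (simp add: M_def)
    show ?case
    proof (cases "q \<in> {s1, s2}")
      case True
      then show ?thesis using IH halt by (auto simp: fstep_def)
    next
      case False
      have "range (T(p := b)) \<subseteq> A" using IH(4) c by auto
      moreover have "g \<circ> T(p := b) = (g \<circ> T)(p := g b)" by (auto simp: fun_eq_iff)
      moreover have "fstep \<delta> {s1, s2} (q, p, T) = (q', p + shift_of d, T(p := b))"
        using False \<delta> by (simp add: fstep_def)
      moreover have "fstep (tm_delta M) {1, 2} (f q, p, g \<circ> T) = (f q', p + shift_of d, (g \<circ> T)(p := g b))"
        using False halt d' by (simp add: fstep_def)
      ultimately show ?thesis
        unfolding funpow.simps o_apply IH(1,2) using c by metis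
    qed
  qed
  show ?thesis
  proof (intro exI[of _ M] conjI wf allI impI)
    fix w n assume w: "set w \<subseteq> {..<input_alphabet}"
    from run[OF w, of n] obtain q p T where r:
      "(fstep \<delta> {s1, s2} ^^ n) (s0, 0, tape_of (inp 0) (map inp w)) = (q, p, T)"
      "(fstep (tm_delta M) {1, 2} ^^ n) (0, 0, tape_of 0 w) = (f q, p, g \<circ> T)" "q \<in> S" by blast
    have "fst (tm_run M n w) = f q"
      using tape_rel_run[of M n w] r(2) by (auto simp: tape_rel_def)
    moreover have "f q = 1 \<longleftrightarrow> q = s1" "f q = 2 \<longleftrightarrow> q = s2"
      using f012 fi(1) r(3) states by metis+
    ultimately show "let q = fst ((fstep \<delta> {s1, s2} ^^ n) (s0, 0, tape_of (inp 0) (map inp w)));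
          q' = fst (tm_run M n w)
      in (q' = 1 \<longleftrightarrow> q = s1) \<and> (q' = 2 \<longleftrightarrow> q = s2)"
      using r(1) by (simp add: Let_def)
  qed
qed

end

section \<open>Multi-head machines\<close>

datatype op = Stay | Right | Reset

text \<open>Phases of the simulation of one step: \<open>Seek\<close> runs right to the head that
  the control state reads, \<open>Back\<close> returns to the left end, \<open>Place\<close> drops
  the lifted head on the present cell, and \<open>BackPlace\<close> carries it to the left end for a
  reset. \<open>Init\<close> marks all heads on the first cell.\<close>

datatype 'k mstate = Init | Seek 'k | Place 'k nat | Back 'k | BackPlace 'k nat

text \<open>A cell of the simulating tape carries an input symbol and the set of heads standing on it.
  Heads stay within the word and the blank following it, so the only cells with content
  \<open>(0, {})\<close> ever visited lie left of the word.\<close>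

locale multihead =
  fixes K :: nat and C :: "'k set" and k0 acc rej :: 'k
    and hd_of :: "'k \<Rightarrow> nat" and act :: "'k \<Rightarrow> nat \<Rightarrow> nat set \<Rightarrow> 'k \<times> op"
  assumes finite_C: "finite C" and ctl: "k0 \<in> C" "acc \<in> C" "rej \<in> C" "acc \<noteq> rej"
    and hd_less: "\<And>k. k \<in> C \<Longrightarrow> k \<noteq> acc \<Longrightarrow> k \<noteq> rej \<Longrightarrow> hd_of k < K"
    and act_C: "\<And>k a m. k \<in> C \<Longrightarrow> k \<noteq> acc \<Longrightarrow> k \<noteq> rej \<Longrightarrow> fst (act k a m) \<in> C"
begin

definition hmove :: "nat \<Rightarrow> op \<Rightarrow> nat \<Rightarrow> nat" where
  "hmove a d p = (case d of Stay \<Rightarrow> p | Right \<Rightarrow> if a = 0 then p else Suc p | Reset \<Rightarrow> 0)"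

text \<open>The action learns which heads share the cell of the active head, so equality of two head
  positions is a single test. Addition is built from it.\<close>

definition mstep :: "nat list \<Rightarrow> 'k \<times> (nat \<Rightarrow> nat) \<Rightarrow> 'k \<times> (nat \<Rightarrow> nat)" where
  "mstep w = (\<lambda>(k, h). if k = acc \<or> k = rej then (k, h) else
     (let i = hd_of k; a = cell w (h i) in
      case act k a {j. j < K \<and> h j = h i} of (k', d) \<Rightarrow> (k', h(i := hmove a d (h i)))))"

text \<open>A leftward run always starts one cell left of the cell just treated. All cells it
  crosses carry a nonzero input symbol, so it cannot stop early, even when lifting the last mark off
  the blank behind the word has left \<open>(0, {})\<close> there.\<close>

fun mdelta :: "'k mstate \<Rightarrow> nat \<times> nat set \<Rightarrow> 'k mstate \<times> (nat \<times> nat set) \<times> dir" where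
  "mdelta Init (a, m) = (Back k0, (a, {..<K}), DL)"
| "mdelta (Seek k) (a, m) = (if k = acc \<or> k = rej then (Seek k, (a, m), DN)
     else if hd_of k \<notin> m then (Seek k, (a, m), DR)
     else (case act k a m of (k', d) \<Rightarrow>
       (case d of Stay \<Rightarrow> (Back k', (a, m), DL)
        | Right \<Rightarrow> if a = 0 then (Back k', (a, m), DL)
            else (Place k' (hd_of k), (a, m - {hd_of k}), DR)
        | Reset \<Rightarrow> (BackPlace k' (hd_of k), (a, m - {hd_of k}), DL))))"
| "mdelta (Place k i) (a, m) = (Back k, (a, insert i m), DL)"
| "mdelta (Back k) (a, m) = (if (a, m) = (0, {}) then (Seek k, (a, m), DR) else (Back k, (a, m), DL))"
| "mdelta (BackPlace k i) (a, m) =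
     (if (a, m) = (0, {}) then (Place k i, (a, m), DR) else (BackPlace k i, (a, m), DL))"

abbreviation "step \<equiv> fstep mdelta {Seek acc, Seek rej}"

definition mtape :: "nat list \<Rightarrow> (nat \<Rightarrow> nat) \<Rightarrow> int \<Rightarrow> nat \<times> nat set" where
  "mtape w h j = (tape_of 0 w j, {i. i < K \<and> int (h i) = j})"

lemma mtape_nat: "mtape w h (int j) = (cell w j, {i. i < K \<and> h i = j})"
  by (simp add: mtape_def tape_of_def cell_def)

lemma mtape_neg: "p < 0 \<Longrightarrow> mtape w h p = (0, {})"
  by (auto simp: mtape_def tape_of_def)

lemma seek_run:
  assumes "k \<noteq> acc" "k \<noteq> rej" "hd_of k < K" "j \<le> h (hd_of k)"
  shows "(step ^^ j) (Seek k, 0, mtape w h) = (Seek k, int j, mtape w h)"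
  using assms(4)
proof (induction j)
  case (Suc j)
  have "step (Seek k, int j, mtape w h) = (Seek k, int (Suc j), mtape w h)"
    using assms Suc.prems by (simp add: fstep_def mtape_nat fun_upd_idem)
  then show ?case using Suc by simp
qed simp

lemma back_run:
  assumes "\<And>q. 0 \<le> q \<Longrightarrow> q < int p \<Longrightarrow> T q \<noteq> (0, {})" and "T (-1) = (0, {})"
  shows "(step ^^ (Suc p)) (Back k, int p - 1, T) = (Seek k, 0, T)"
  using assms(1)
proof (induction p)
  case 0
  then show ?case using assms(2) by (simp add: fstep_def fun_upd_idem)
next
  case (Suc p)
  have "T (int p) \<noteq> (0, {})" using Suc.prems by simp
  then have "step (Back k, int (Suc p) - 1, T) = (Back k, int p - 1, T)"
    by (cases "T (int p)") (auto simp: fstep_def fun_upd_idem)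
  then show ?case using Suc by (simp add: funpow_swap1)
qed

lemma backplace_run:
  assumes "\<And>q. 0 \<le> q \<Longrightarrow> q < int p \<Longrightarrow> T q \<noteq> (0, {})" and "T (-1) = (0, {})"
  shows "(step ^^ (Suc p)) (BackPlace k i, int p - 1, T) = (Place k i, 0, T)"
  using assms(1)
proof (induction p)
  case 0
  then show ?case using assms(2) by (simp add: fstep_def fun_upd_idem)
next
  case (Suc p)
  have "T (int p) \<noteq> (0, {})" using Suc.prems by simp
  then have "step (BackPlace k i, int (Suc p) - 1, T) = (BackPlace k i, int p - 1, T)"
    by (cases "T (int p)") (auto simp: fstep_def fun_upd_idem)
  then show ?case using Suc by (simp add: funpow_swap1)
qed

lemma funpow_trans: "(f ^^ a) x = y \<Longrightarrow> (f ^^ b) y = z \<Longrightarrow> (f ^^ (b + a)) x = z"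
  by (simp add: funpow_add)

lemma step_once: "step x = y \<Longrightarrow> (step ^^ 1) x = y"
  by (simp only: One_nat_def funpow.simps o_apply id_apply)

lemma nth_nonzero: "0 \<notin> set w \<Longrightarrow> i < length w \<Longrightarrow> w ! i \<noteq> (0::nat)"
  by (metis nth_mem)

lemma mtape_nonblank:
  assumes "0 \<notin> set w" "0 \<le> q" "q < int (length w)"
  shows "fst (mtape w h q) \<noteq> 0"
  using assms nth_nonzero[of w "nat q"] by (auto simp: mtape_def tape_of_def)

text \<open>The run to the active head and the run back each cross at most \<open>length w\<close>
  cells; turning around, lifting and dropping a mark cost a constant number of steps.\<close>

lemma step_simulation:
  assumes w: "0 \<notin> set w" and k: "k \<noteq> acc" "k \<noteq> rej" "hd_of k < K"
    and h: "\<And>i. i < K \<Longrightarrow> h i \<le> length w" and ms: "mstep w (k, h) = (k', h')"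
  shows "\<exists>t \<le> 2 * length w + 6. (step ^^ t) (Seek k, 0, mtape w h) = (Seek k', 0, mtape w h')"
proof -
  define i where "i = hd_of k"
  define p where "p = h i"
  define a where "a = cell w p"
  define m where "m = {j. j < K \<and> h j = p}"
  have p: "p \<le> length w" using h k(3) by (simp add: p_def i_def)
  have a0: "a = 0 \<longleftrightarrow> p = length w"
    using w p nth_nonzero[of w p] by (auto simp: a_def cell_def)
  obtain d where act: "act k a m = (k', d)" and h': "h' = h(i := hmove a d p)"
    using ms k by (auto simp: mstep_def Let_def i_def p_def a_def m_def split: prod.splits)
  have im: "i \<in> m" using k(3) by (simp add: m_def p_def i_def)
  have s1: "(step ^^ p) (Seek k, 0, mtape w h) = (Seek k, int p, mtape w h)"
    using seek_run[of k p h w] k by (simp add: p_def i_def)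
  have Tp: "mtape w h (int p) = (a, m)" by (simp add: mtape_nat a_def m_def)
  have blank: "mtape w h (-1) = (0, {})" for h by (simp add: mtape_neg)
  have nonblank: "mtape w h q \<noteq> (0, {})" if "0 \<le> q" "q < int p" for h q
    using mtape_nonblank[OF w that(1)] p that(2) by (metis fst_conv less_le_trans of_nat_le_iff)
  show ?thesis
  proof (cases "d = Stay \<or> d = Right \<and> a = 0")
    case True
    then have hh: "h' = h" by (auto simp: h' hmove_def p_def)
    have s2: "step (Seek k, int p, mtape w h) = (Back k', int p - 1, mtape w h)"
      using True im act k Tp by (auto simp: fstep_def i_def fun_upd_idem)
    have s3: "(step ^^ (Suc p)) (Back k', int p - 1, mtape w h) = (Seek k', 0, mtape w h)"
      using back_run nonblank blank by blast
    have "(step ^^ (Suc p + (1 + p))) (Seek k, 0, mtape w h) = (Seek k', 0, mtape w h')"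
      unfolding hh using funpow_trans[OF funpow_trans[OF s1 step_once[OF s2]] s3] .
    then show ?thesis using p by (intro exI[of _ "Suc p + (1 + p)"]) auto
  next
    case False
    \<comment> \<open>The tape while the mark of head \<open>i\<close> is lifted and its number is
      kept in the control state.\<close>
    define T where "T = (mtape w h)(int p := (a, m - {i}))"
    have Tneg: "T (-1) = (0, {})" by (simp add: T_def blank)
    have Tnb: "T q \<noteq> (0, {})" if "0 \<le> q" "q < int p" for q
      using nonblank[OF that] that by (simp add: T_def)
    \<comment> \<open>Dropping the mark at any \<open>p'\<close> gives the tape of the updated
      heads; both \<open>Right\<close> and \<open>Reset\<close> end in this way.\<close>
    have set_h: "T(int p' := (cell w p', insert i (snd (T (int p'))))) = mtape w (h(i := p'))" for p'
      using im k(3)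
      by (auto simp: fun_eq_iff T_def mtape_def tape_of_def cell_def m_def a_def i_def p_def)
    have place: "step (Place k' i, int q, T) = (Back k', int q - 1, mtape w (h(i := q)))" for q
    proof -
      have "T (int q) = (cell w q, snd (T (int q)))" by (simp add: T_def mtape_nat a_def)
      then have "mdelta (Place k' i) (T (int q)) = (Back k', (cell w q, insert i (snd (T (int q)))), DL)"
        by (metis mdelta.simps(3))
      then show ?thesis by (simp add: fstep_def set_h)
    qed
    show ?thesis
    proof (cases "d = Right")
      case True
      then have a: "a \<noteq> 0" "Suc p \<le> length w" using False a0 p by auto
      have hh: "h' = h(i := Suc p)" using True a by (simp add: h' hmove_def)
      have s2: "step (Seek k, int p, mtape w h) = (Place k' i, int (Suc p), T)"
        using True im act k Tp a by (auto simp: fstep_def i_def T_def)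
      have s3: "step (Place k' i, int (Suc p), T) = (Back k', int (Suc p) - 1, mtape w h')"
        unfolding hh by (rule place)
      have "mtape w h' q \<noteq> (0, {})" if "0 \<le> q" "q < int (Suc p)" for q
        using mtape_nonblank[OF w that(1), of h'] a(2) that(2)
        by (metis fst_conv less_le_trans of_nat_le_iff)
      then have s4: "(step ^^ (Suc (Suc p))) (Back k', int (Suc p) - 1, mtape w h')
          = (Seek k', 0, mtape w h')"
        using back_run blank by blast
      have "(step ^^ (Suc (Suc p) + (1 + (1 + p)))) (Seek k, 0, mtape w h)
          = (Seek k', 0, mtape w h')"
        using funpow_trans[OF funpow_trans[OF funpow_trans[OF s1 step_once[OF s2]] step_once[OF s3]] s4] .
      then show ?thesis using p by (intro exI[of _ "Suc (Suc p) + (1 + (1 + p))"]) auto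
    next
      case dR: False
      then have d: "d = Reset" using False by (cases d) auto
      have hh: "h' = h(i := 0)" using d by (simp add: h' hmove_def)
      have s2: "step (Seek k, int p, mtape w h) = (BackPlace k' i, int p - 1, T)"
        using d im act k Tp by (auto simp: fstep_def i_def T_def)
      have s3: "(step ^^ (Suc p)) (BackPlace k' i, int p - 1, T) = (Place k' i, 0, T)"
        using backplace_run Tnb Tneg by blast
      have s4: "step (Place k' i, 0, T) = (Back k', int 0 - 1, mtape w h')"
        unfolding hh using place[of 0] by simp
      have s5: "(step ^^ (Suc 0)) (Back k', int 0 - 1, mtape w h') = (Seek k', 0, mtape w h')"
        by (rule back_run) (auto simp: blank)
      have "(step ^^ (Suc 0 + (1 + (Suc p + (1 + p))))) (Seek k, 0, mtape w h)
          = (Seek k', 0, mtape w h')"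
        using funpow_trans[OF funpow_trans[OF funpow_trans[OF funpow_trans[OF s1 step_once[OF s2]] s3] step_once[OF s4]] s5] .
      then show ?thesis using p by (intro exI[of _ "Suc 0 + (1 + (Suc p + (1 + p)))"]) auto
    qed
  qed
qed

lemma mstep_bounded:
  assumes w: "0 \<notin> set w" and h: "\<And>i. i < K \<Longrightarrow> h i \<le> length w" and ms: "mstep w (k, h) = (k', h')"
    and i: "i < K"
  shows "h' i \<le> length w"
proof -
  have "hmove (cell w p) d p \<le> length w" if "p \<le> length w" for p d
    using that by (auto simp: hmove_def cell_def split: op.splits)
  then show ?thesis
    using ms h i by (auto simp: mstep_def Let_def split: prod.splits if_splits)
qed

text \<open>Steps of a halted \<open>mstep\<close> have no counterpart on the tape, hence an upper
  bound on \<open>t\<close> and not an equality.\<close>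

lemma run_simulation:
  assumes w: "0 \<notin> set w" and "k \<in> C" and "\<And>i. i < K \<Longrightarrow> h i \<le> length w"
    and "(mstep w ^^ n) (k, h) = (k', h')"
  shows "\<exists>t \<le> n * (2 * length w + 6). (step ^^ t) (Seek k, 0, mtape w h) = (Seek k', 0, mtape w h')"
  using assms(2-4)
proof (induction n arbitrary: k h)
  case (Suc n)
  obtain k1 h1 where ms: "mstep w (k, h) = (k1, h1)" by (cases "mstep w (k, h)")
  have rest: "(mstep w ^^ n) (k1, h1) = (k', h')"
    using Suc.prems(3) ms by (simp add: funpow_swap1)
  have k1: "k1 \<in> C"
    using ms Suc.prems(1) act_C[of k]
    by (auto simp: mstep_def Let_def split: prod.splits if_splits) (metis fst_conv)
  have h1: "\<And>i. i < K \<Longrightarrow> h1 i \<le> length w"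
    using mstep_bounded[OF w Suc.prems(2) ms] by blast
  obtain t1 where t1: "t1 \<le> n * (2 * length w + 6)"
    "(step ^^ t1) (Seek k1, 0, mtape w h1) = (Seek k', 0, mtape w h')"
    using Suc.IH[OF k1 h1 rest] by blast
  show ?case
  proof (cases "k = acc \<or> k = rej")
    case True
    then have "k1 = k" "h1 = h" using ms by (auto simp: mstep_def)
    then show ?thesis using t1 by (intro exI[of _ t1]) auto
  next
    case False
    then obtain t0 where t0: "t0 \<le> 2 * length w + 6"
      "(step ^^ t0) (Seek k, 0, mtape w h) = (Seek k1, 0, mtape w h1)"
      using step_simulation[OF w _ _ hd_less[OF Suc.prems(1)] Suc.prems(2) ms] by auto
    show ?thesis
      using funpow_trans[OF t0(2) t1(2)] t0(1) t1(1) by (intro exI[of _ "t1 + t0"]) auto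
  qed
qed auto

text \<open>A state holds a control state and at most one lifted head, a symbol holds an input
  symbol and a subset of the \<open>K\<close> heads; both sets are finite.\<close>

lemma abstract_tm:
  "abstract_tm mdelta
     (insert Init (Seek ` C \<union> Back ` C \<union> (\<lambda>(k, i). Place k i) ` (C \<times> {..<K})
        \<union> (\<lambda>(k, i). BackPlace k i) ` (C \<times> {..<K})))
     ({..<input_alphabet} \<times> Pow {..<K}) Init (Seek acc) (Seek rej) (\<lambda>a. (a, {}))"
  (is "abstract_tm _ ?S ?A _ _ _ _")
proof
  show "finite ?S" using finite_C by simp
  show "finite ?A" by simp
  show "Init \<in> ?S" "Seek acc \<in> ?S" "Seek rej \<in> ?S" using ctl by auto
  show "distinct [Init, Seek acc, Seek rej]" using ctl by auto
  show "inj_on (\<lambda>a. (a, {})) {..<input_alphabet}" by (auto simp: inj_on_def)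
  show "(\<lambda>a. (a, {})) ` {..<input_alphabet} \<subseteq> ?A" by auto
next
  fix q and c :: "nat \<times> nat set" and q' b d
  assume q: "q \<in> ?S" and c: "c \<in> ?A" and \<delta>: "mdelta q c = (q', b, d)"
  obtain a m where c': "c = (a, m)" by (cases c)
  show "q' \<in> ?S \<and> b \<in> ?A"
  proof (cases q)
    case (Seek k)
    then have k: "k \<in> C" using q by auto
    show ?thesis
    proof (cases "k = acc \<or> k = rej \<or> hd_of k \<notin> m")
      case True
      then show ?thesis using Seek \<delta> c c' q by (auto split: if_splits)
    next
      case False
      obtain k1 d1 where a1: "act k a m = (k1, d1)" by (cases "act k a m")
      then have "k1 \<in> C" "hd_of k < K" using act_C[of k a m] hd_less[of k] k False by auto
      then show ?thesis using Seek \<delta> c c' a1 False by (auto split: if_splits op.splits)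
    qed
  qed (use \<delta> c c' q ctl in \<open>auto split: if_splits\<close>)
qed

text \<open>The two extra steps mark the heads and turn around at the left end. Halting states are
  stationary, so the verdict is right at every later time \<open>t\<close> too, and a polynomial
  upper bound can be used as the running time.\<close>

theorem multihead_realisable:
  "\<exists>M. wf_tm M \<and> (\<forall>w n h v t. set w \<subseteq> {0<..<input_alphabet} \<longrightarrow>
      (mstep w ^^ n) (k0, \<lambda>_. 0) = (if v then acc else rej, h) \<longrightarrow>
      n * (2 * length w + 6) + 2 \<le> t \<longrightarrow>
      fst (tm_run M t w) = (if v then 1 else 2))"
proof -
  from abstract_tm.realise[OF abstract_tm] obtain M where M: "wf_tm M"
    "\<And>w n. set w \<subseteq> {..<input_alphabet} \<Longrightarrow>
     (let q = fst ((step ^^ n) (Init, 0, tape_of (0, {}) (map (\<lambda>a. (a, {})) w)));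
          q' = fst (tm_run M n w)
      in (q' = 1 \<longleftrightarrow> q = Seek acc) \<and> (q' = 2 \<longleftrightarrow> q = Seek rej))"
    by blast
  have "fst (tm_run M t w) = (if v then 1 else 2)"
    if w: "set w \<subseteq> {0<..<input_alphabet}"
      and run: "(mstep w ^^ n) (k0, \<lambda>_. 0) = (if v then acc else rej, h)"
      and t: "n * (2 * length w + 6) + 2 \<le> t" for w n h v t
  proof -
    define k where "k = (if v then acc else rej)"
    have w0: "0 \<notin> set w" using w by auto
    define T0 where "T0 = tape_of (0, {} :: nat set) (map (\<lambda>a. (a, {})) w)"
    have T0: "T0 = (\<lambda>j. (tape_of 0 w j, {}))" by (auto simp: T0_def tape_of_def)
    have "step (Init, 0, T0) = (Back k0, int 0 - 1, mtape w (\<lambda>_. 0))"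
      by (auto simp: fstep_def T0 mtape_def fun_eq_iff)
    moreover have "(step ^^ Suc 0) (Back k0, int 0 - 1, mtape w (\<lambda>_. 0))
        = (Seek k0, 0, mtape w (\<lambda>_. 0))"
      by (rule back_run) (auto simp: mtape_neg)
    ultimately have i: "(step ^^ 2) (Init, 0, T0) = (Seek k0, 0, mtape w (\<lambda>_. 0))"
      by (simp add: numeral_2_eq_2)
    obtain t1 where t1: "t1 \<le> n * (2 * length w + 6)"
      "(step ^^ t1) (Seek k0, 0, mtape w (\<lambda>_. 0)) = (Seek k, 0, mtape w h)"
      using run_simulation[OF w0 ctl(1) _ run] by (auto simp: k_def)
    have stay: "(step ^^ j) (Seek k, 0, mtape w h) = (Seek k, 0, mtape w h)" for j
      by (induction j) (auto simp: fstep_def k_def)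
    obtain j where j: "t = j + (t1 + 2)"
      using t t1(1) by (metis add.commute add_le_mono1 le_Suc_ex le_trans)
    have "(step ^^ t) (Init, 0, T0) = (Seek k, 0, mtape w h)"
      unfolding j by (rule funpow_trans[OF funpow_trans[OF i t1(2)] stay])
    moreover have "set w \<subseteq> {..<input_alphabet}" using w by auto
    ultimately show ?thesis
      using M(2)[of w t] ctl(4) by (auto simp: Let_def T0_def k_def split: if_splits)
  qed
  then show ?thesis using M(1) by blast
qed

end

section \<open>First-order formulas with addition over words\<close>

datatype fm = Sym nat nat | Add nat nat nat | Neg fm | Conj fm fm | Ex fm

text \<open>Variables are de Bruijn indices, index 0 being bound by the innermost \<open>Ex\<close>.
  Quantifiers include \<open>length w\<close>, the blank behind the word, because segments are
  described by their start and the position after their end.\<close>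

fun sat :: "nat list \<Rightarrow> (nat \<Rightarrow> nat) \<Rightarrow> fm \<Rightarrow> bool" where
  "sat w e (Sym a x) \<longleftrightarrow> cell w (e x) = a"
| "sat w e (Add x y z) \<longleftrightarrow> e x + e y = e z"
| "sat w e (Neg \<phi>) \<longleftrightarrow> \<not> sat w e \<phi>"
| "sat w e (Conj \<phi> \<psi>) \<longleftrightarrow> sat w e \<phi> \<and> sat w e \<psi>"
| "sat w e (Ex \<phi>) \<longleftrightarrow> (\<exists>v\<le>length w. sat w (case_nat v e) \<phi>)"

fun fvb :: "fm \<Rightarrow> nat" where
  "fvb (Sym a x) = Suc x"
| "fvb (Add x y z) = Suc (max x (max y z))"
| "fvb (Neg \<phi>) = fvb \<phi>"
| "fvb (Conj \<phi> \<psi>) = max (fvb \<phi>) (fvb \<psi>)"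
| "fvb (Ex \<phi>) = fvb \<phi> - 1"

lemma sat_cong:
  "fvb \<phi> \<le> d \<Longrightarrow> (\<And>i. i < d \<Longrightarrow> e i = e' i) \<Longrightarrow> sat w e \<phi> = sat w e' \<phi>"
proof (induction \<phi> arbitrary: e e' d)
  case (Ex \<phi>)
  have "sat w (case_nat v e) \<phi> = sat w (case_nat v e') \<phi>" for v
    by (rule Ex.IH[of "Suc d"]) (use Ex.prems in \<open>auto split: nat.split\<close>)
  then show ?case by simp
next
  case (Conj \<phi> \<psi>)
  then show ?case by (metis fvb.simps(4) max.bounded_iff sat.simps(4))
next
  case (Neg \<phi>)
  then show ?case by (metis fvb.simps(3) sat.simps(3))
qed auto

text \<open>Control states are formulas still to be evaluated together with a success and a
  failure continuation. The variable with index \<open>i\<close> at depth \<open>d\<close> is held by head \<open>d - Suc i\<close>;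
  heads \<open>d\<close> and \<open>d + 1\<close> serve as counters for addition.\<close>

datatype ctl = Acc | Rej | Ev nat fm ctl ctl | Next nat fm ctl ctl
  | AddAt nat nat nat nat nat ctl ctl

fun hd_of :: "ctl \<Rightarrow> nat" where
  "hd_of (Ev d (Sym a x) s f) = d - Suc x"
| "hd_of (Ev d (Ex \<phi>) s f) = d"
| "hd_of (Ev d (Add x y z) s f) = d"
| "hd_of (Next d \<phi> s f) = d"
| "hd_of (AddAt i d x y z s f) = (if i = 3 then d else Suc d)"
| "hd_of _ = 0"

text \<open>\<open>Neg\<close> swaps the continuations, \<open>Conj\<close> puts the second conjunct
  into the success continuation of the first, and \<open>Ex\<close> fails over to
  \<open>Next\<close>, which advances the candidate held by head \<open>d\<close>. For addition,
  \<open>AddAt\<close> 1 resets counter \<open>d + 1\<close>, 2 moves it to head \<open>x\<close>, 3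
  and 4 advance both counters in turn until counter \<open>d\<close> meets head \<open>y\<close>,
  and 5 compares counter \<open>d + 1\<close> with head \<open>z\<close>. In \<open>AddAt\<close>
  the arguments \<open>x\<close>, \<open>y\<close>, \<open>z\<close> are head numbers, no longer
  variable indices.\<close>

fun act :: "ctl \<Rightarrow> nat \<Rightarrow> nat set \<Rightarrow> ctl \<times> op" where
  "act (Ev d (Sym b x) s f) a m = (if a = b then s else f, Stay)"
| "act (Ev d (Neg \<phi>) s f) a m = (Ev d \<phi> f s, Stay)"
| "act (Ev d (Conj \<phi> \<psi>) s f) a m = (Ev d \<phi> (Ev d \<psi> s f) f, Stay)"
| "act (Ev d (Ex \<phi>) s f) a m = (Ev (Suc d) \<phi> s (Next d \<phi> s f), Reset)"
| "act (Next d \<phi> s f) a m =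
     (if a = 0 then (f, Stay) else (Ev (Suc d) \<phi> s (Next d \<phi> s f), Right))"
| "act (Ev d (Add x y z) s f) a m = (AddAt 1 d (d - Suc x) (d - Suc y) (d - Suc z) s f, Reset)"
| "act (AddAt i d x y z s f) a m =
     (if i = 1 then (AddAt 2 d x y z s f, Reset)
      else if i = 2 then (if x \<in> m then (AddAt 3 d x y z s f, Stay) else (AddAt 2 d x y z s f, Right))
      else if i = 3 then (if y \<in> m then (AddAt 5 d x y z s f, Stay) else (AddAt 4 d x y z s f, Right))
      else if i = 4 then (if a = 0 then (f, Stay) else (AddAt 3 d x y z s f, Right))
      else (if z \<in> m then s else f, Stay))"
| "act k a m = (k, Stay)"

fun width :: "nat \<Rightarrow> fm \<Rightarrow> nat" where
  "width d (Sym a x) = Suc d"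
| "width d (Add x y z) = Suc (Suc d)"
| "width d (Neg \<phi>) = width d \<phi>"
| "width d (Conj \<phi> \<psi>) = max (width d \<phi>) (width d \<psi>)"
| "width d (Ex \<phi>) = width (Suc d) \<phi>"

lemma width_gt: "d < width d \<phi>"
  by (induction d \<phi> rule: width.induct) auto

text \<open>The states met while evaluating the formula itself. The continuations are exits and are
  left out, so that the sets compose along the recursion.\<close>

fun reach :: "nat \<Rightarrow> fm \<Rightarrow> ctl \<Rightarrow> ctl \<Rightarrow> ctl set" where
  "reach d (Sym a x) s f = {Ev d (Sym a x) s f}"
| "reach d (Add x y z) s f = insert (Ev d (Add x y z) s f)
     ((\<lambda>i. AddAt i d (d - Suc x) (d - Suc y) (d - Suc z) s f) ` {1..5})"
| "reach d (Neg \<phi>) s f = insert (Ev d (Neg \<phi>) s f) (reach d \<phi> f s)"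
| "reach d (Conj \<phi> \<psi>) s f = insert (Ev d (Conj \<phi> \<psi>) s f)
     (reach d \<phi> (Ev d \<psi> s f) f \<union> reach d \<psi> s f)"
| "reach d (Ex \<phi>) s f = insert (Ev d (Ex \<phi>) s f) (insert (Next d \<phi> s f)
     (reach (Suc d) \<phi> s (Next d \<phi> s f)))"

lemma finite_reach: "finite (reach d \<phi> s f)"
  by (induction d \<phi> s f rule: reach.induct) auto

lemma Ev_in_reach: "Ev d \<phi> s f \<in> reach d \<phi> s f"
  by (cases \<phi>) auto

lemma act_reach: "k \<in> reach d \<phi> s f \<Longrightarrow> fst (act k a m) \<in> insert s (insert f (reach d \<phi> s f))"
proof (induction d \<phi> s f rule: reach.induct)
  case (2 d x y z s f)
  then consider "k = Ev d (Add x y z) s f"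
    | i where "k = AddAt i d (d - Suc x) (d - Suc y) (d - Suc z) s f" "i \<in> {1..5}"
    by auto
  then show ?case
  proof cases
    case (2 i)
    then have "i = 1 \<or> i = 2 \<or> i = 3 \<or> i = 4 \<or> i = 5" by auto
    then show ?thesis using 2(1) by (elim disjE) auto
  qed auto
next
  case (3 d \<phi> s f)
  then show ?case using Ev_in_reach by auto
next
  case (4 d \<phi> \<psi> s f)
  then show ?case using Ev_in_reach by auto
next
  case (5 d \<phi> s f)
  then show ?case using Ev_in_reach by (cases "a = 0") auto
qed auto

lemma hd_reach: "k \<in> reach d \<phi> s f \<Longrightarrow> hd_of k < width d \<phi>"
proof (induction d \<phi> s f rule: reach.induct)
  case (3 d \<phi> s f)
  then show ?case using width_gt[of d \<phi>] by auto
next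
  case (4 d \<phi> \<psi> s f)
  then show ?case using width_gt[of d \<phi>] by (auto simp: less_max_iff_disj)
next
  case (5 d \<phi> s f)
  then show ?case using width_gt[of "Suc d" \<phi>] by auto
qed auto

section \<open>Polynomial cost of evaluating a fixed formula\<close>

fun cost :: "nat \<Rightarrow> fm \<Rightarrow> nat" where
  "cost n (Sym a x) = 1"
| "cost n (Add x y z) = 3 * n + 6"
| "cost n (Neg \<phi>) = 1 + cost n \<phi>"
| "cost n (Conj \<phi> \<psi>) = 1 + cost n \<phi> + cost n \<psi>"
| "cost n (Ex \<phi>) = 1 + (n + 1) * (cost n \<phi> + 1)"

text \<open>With base \<open>n + 1\<close>, which is positive also for \<open>n = 0\<close>, raising
  the exponent never lowers the bound.\<close>

definition poly_bounded :: "(nat \<Rightarrow> nat) \<Rightarrow> bool" where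
  "poly_bounded f \<longleftrightarrow> (\<exists>c k. \<forall>n. f n \<le> c * (n + 1) ^ k)"

lemma poly_bounded_add:
  assumes "poly_bounded f" "poly_bounded g"
  shows "poly_bounded (\<lambda>n. f n + g n)"
proof -
  obtain c k c' k' where b: "\<And>n. f n \<le> c * (n + 1) ^ k" "\<And>n. g n \<le> c' * (n + 1) ^ k'"
    using assms by (auto simp: poly_bounded_def)
  have "f n + g n \<le> (c + c') * (n + 1) ^ (k + k')" for n
  proof -
    have "c * (n + 1) ^ k \<le> c * (n + 1) ^ (k + k')" "c' * (n + 1) ^ k' \<le> c' * (n + 1) ^ (k + k')"
      by (simp_all add: power_increasing)
    then show ?thesis using b(1,2)[of n] unfolding distrib_right by linarith
  qed
  then show ?thesis by (auto simp: poly_bounded_def)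
qed

lemma poly_bounded_mult:
  assumes "poly_bounded f" "poly_bounded g"
  shows "poly_bounded (\<lambda>n. f n * g n)"
proof -
  obtain c k c' k' where b: "\<And>n. f n \<le> c * (n + 1) ^ k" "\<And>n. g n \<le> c' * (n + 1) ^ k'"
    using assms by (auto simp: poly_bounded_def)
  have "f n * g n \<le> (c * c') * (n + 1) ^ (k + k')" for n
    using mult_mono[OF b(1)[of n] b(2)[of n]] by (simp add: power_add ac_simps)
  then show ?thesis by (auto simp: poly_bounded_def)
qed

lemma poly_bounded_const: "poly_bounded (\<lambda>n. c)"
  unfolding poly_bounded_def by (intro exI[of _ c] exI[of _ 0]) simp

lemma poly_bounded_id: "poly_bounded (\<lambda>n. n)"
  unfolding poly_bounded_def by (intro exI[of _ 1]) simp

lemma poly_bounded_cost: "poly_bounded (\<lambda>n. cost n \<phi>)"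
  by (induction \<phi>)
    (auto intro!: poly_bounded_add[OF poly_bounded_const]
       poly_bounded_add[OF _ poly_bounded_const, simplified]
       poly_bounded_mult poly_bounded_const poly_bounded_id
       poly_bounded_add simp del: One_nat_def mult_Suc mult_Suc_right add_Suc add_Suc_right)

text \<open>Produces the shape of time bound required by \<open>DTP_in_PTIME_data\<close>. For
  positive \<open>n\<close> the base \<open>n + 1\<close> is at most \<open>2 * n\<close>, whence
  the factor \<open>2 ^ k\<close>; the additive constant covers \<open>n = 0\<close>.\<close>

lemma poly_boundedD:
  assumes "poly_bounded f"
  shows "\<exists>c k. \<forall>n. f n \<le> c * n ^ k + c"
proof -
  obtain c k where b: "\<And>n. f n \<le> c * (n + 1) ^ k" using assms by (auto simp: poly_bounded_def)
  have "f n \<le> (c * 2 ^ k) * n ^ k + c * 2 ^ k" for n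
  proof (cases "n = 0")
    case True
    have "f 0 \<le> c" using b[of 0] by simp
    also have "\<dots> \<le> c * 2 ^ k" by simp
    finally show ?thesis using True by simp
  next
    case False
    then have "(n + 1) ^ k \<le> (2 * n) ^ k" by (intro power_mono) auto
    then have "c * (n + 1) ^ k \<le> c * (2 * n) ^ k" by (rule mult_le_mono2)
    also have "\<dots> = c * (2 ^ k * n ^ k)" by (simp add: power_mult_distrib)
    also have "\<dots> = (c * 2 ^ k) * n ^ k" by simp
    finally show ?thesis using b[of n] by linarith
  qed
  then show ?thesis by blast
qed

definition env :: "nat \<Rightarrow> (nat \<Rightarrow> nat) \<Rightarrow> nat \<Rightarrow> nat" where
  "env d h i = h (d - Suc i)"

section \<open>Correctness of the formula machine\<close>

locale formula_machine =
  fixes \<phi>0 :: fm and d0 :: nat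
  assumes fvb_d0: "fvb \<phi>0 \<le> d0"
begin

sublocale multihead "width d0 \<phi>0" "insert Acc (insert Rej (reach d0 \<phi>0 Acc Rej))"
  "Ev d0 \<phi>0 Acc Rej" Acc Rej hd_of act
proof
  fix k a m
  assume "k \<in> insert Acc (insert Rej (reach d0 \<phi>0 Acc Rej))" "k \<noteq> Acc" "k \<noteq> Rej"
  then have k: "k \<in> reach d0 \<phi>0 Acc Rej" by auto
  show "hd_of k < width d0 \<phi>0" using hd_reach[OF k] .
  show "fst (act k a m) \<in> insert Acc (insert Rej (reach d0 \<phi>0 Acc Rej))"
    using act_reach[OF k] .
qed (use finite_reach Ev_in_reach in auto)

abbreviation "K \<equiv> width d0 \<phi>0"

text \<open>Heads below \<open>d\<close> hold the variables in scope and must end where they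
  started. All other heads are scratch space, of which only the bound \<open>length w\<close> is
  kept for the next evaluation.\<close>

definition evals :: "nat list \<Rightarrow> nat \<Rightarrow> nat \<Rightarrow> ctl \<Rightarrow> (nat \<Rightarrow> nat) \<Rightarrow> ctl \<Rightarrow> bool" where
  "evals w t d k h k' \<longleftrightarrow> (\<exists>t'\<le>t. \<exists>h'. (mstep w ^^ t') (k, h) = (k', h') \<and>
     (\<forall>i<d. h' i = h i) \<and> (\<forall>i<K. h' i \<le> length w))"

lemma evals_step:
  assumes "mstep w (k, h) = (k1, h1)" "evals w t d k1 h1 k'" "\<And>i. i < d \<Longrightarrow> h1 i = h i"
  shows "evals w (Suc t) d k h k'"
proof -
  obtain t' h' where "t' \<le> t" "(mstep w ^^ t') (k1, h1) = (k', h')"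
    "\<forall>i<d. h' i = h1 i" "\<forall>i<K. h' i \<le> length w"
    using assms(2) by (auto simp: evals_def)
  then show ?thesis
    unfolding evals_def
    by (intro exI[of _ "Suc t'"]) (use assms(1,3) in \<open>auto simp: funpow_swap1\<close>)
qed

lemma evals_refl: "(\<And>i. i < K \<Longrightarrow> h i \<le> length w) \<Longrightarrow> evals w t d k h k"
  unfolding evals_def by (intro exI[of _ 0]) auto

lemma evals_trans:
  assumes "evals w t1 d k h k1"
    and "\<And>h1. (\<And>i. i < d \<Longrightarrow> h1 i = h i) \<Longrightarrow> (\<And>i. i < K \<Longrightarrow> h1 i \<le> length w) \<Longrightarrow> evals w t2 d k1 h1 k2"
  shows "evals w (t1 + t2) d k h k2"
proof -
  obtain t' h1 where 1: "t' \<le> t1" "(mstep w ^^ t') (k, h) = (k1, h1)"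
    "\<And>i. i < d \<Longrightarrow> h1 i = h i" "\<And>i. i < K \<Longrightarrow> h1 i \<le> length w"
    using assms(1) by (auto simp: evals_def)
  obtain t'' h2 where 2: "t'' \<le> t2" "(mstep w ^^ t'') (k1, h1) = (k2, h2)"
    "\<forall>i<d. h2 i = h1 i" "\<forall>i<K. h2 i \<le> length w"
    using assms(2)[OF 1(3,4)] by (auto simp: evals_def)
  show ?thesis
    unfolding evals_def
    by (intro exI[of _ "t'' + t'"]) (use 1 2 funpow_trans[OF 1(2) 2(2)] in auto)
qed

lemma evals_mono: "evals w t d k h k' \<Longrightarrow> t \<le> t' \<Longrightarrow> d' \<le> d \<Longrightarrow> evals w t' d' k h k'"
  unfolding evals_def by (meson le_trans less_le_trans)

lemma mstep_eq:
  assumes "k \<noteq> Acc" "k \<noteq> Rej"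
    and "act k (cell w (h (hd_of k))) {j. j < K \<and> h j = h (hd_of k)} = (k', d)"
  shows "mstep w (k, h) = (k', h(hd_of k := hmove (cell w (h (hd_of k))) d (h (hd_of k))))"
  using assms by (simp add: mstep_def Let_def)

lemma cell_zero_iff: "0 \<notin> set w \<Longrightarrow> i \<le> length w \<Longrightarrow> cell w i = 0 \<longleftrightarrow> i = length w"
  by (auto simp: cell_def nth_nonzero)

context
  fixes w :: "nat list" and d x y z :: nat and s f :: ctl
  assumes w: "0 \<notin> set w" and d: "Suc (Suc d) \<le> K" and xyz: "x < d" "y < d" "z < d"
begin

lemma add5:
  assumes "\<And>i. i < K \<Longrightarrow> h i \<le> length w"
  shows "evals w 1 d (AddAt 5 d x y z s f) h (if h (Suc d) = h z then s else f)"
proof -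
  have "mstep w (AddAt 5 d x y z s f, h) = (if h (Suc d) = h z then s else f, h)"
    using d xyz by (subst mstep_eq[OF _ _ act.simps(7)[THEN trans]]) (auto simp: hmove_def)
  then show ?thesis
    using evals_step[of w _ h _ h 0 d] evals_refl[of h w] assms by simp
qed

text \<open>Loop invariant: counter \<open>d + 1\<close> is ahead of counter \<open>d\<close> by
  exactly the position of head \<open>x\<close>, so it stands at the sum when counter
  \<open>d\<close> meets head \<open>y\<close>. A round takes two steps, one per counter.\<close>

lemma add3:
  assumes "\<And>i. i < K \<Longrightarrow> h i \<le> length w"
    and "h d \<le> h y" "h (Suc d) = h x + h d" "h y - h d = j"
  shows "evals w (2 * j + 2) d (AddAt 3 d x y z s f) h (if h x + h y = h z then s else f)"
  using assms
proof (induction j arbitrary: h)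
  case 0
  then have "mstep w (AddAt 3 d x y z s f, h) = (AddAt 5 d x y z s f, h)"
    using d xyz by (subst mstep_eq[OF _ _ act.simps(7)[THEN trans]]) (auto simp: hmove_def)
  then show ?case
    using evals_step[of w _ h _ h 1 d] add5[of h] 0 by (simp add: numeral_2_eq_2)
next
  case (Suc j)
  have lt: "h d < h y" using Suc.prems by simp
  define h1 where "h1 = h(d := Suc (h d))"
  have hy: "h y \<le> length w" using Suc.prems(1) d xyz by simp
  have "mstep w (AddAt 3 d x y z s f, h) = (AddAt 4 d x y z s f, h1)"
    using d xyz lt hy cell_zero_iff[OF w, of "h d"]
    by (subst mstep_eq[where k' = "AddAt 4 d x y z s f" and d = Right])
      (auto simp: hmove_def h1_def)
  moreover have "evals w (Suc (2 * j + 2)) d (AddAt 4 d x y z s f) h1 (if h x + h y = h z then s else f)"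
  proof (cases "h (Suc d) = length w")
    case True
    then have "mstep w (AddAt 4 d x y z s f, h1) = (f, h1)"
      by (subst mstep_eq[where k' = f and d = Stay]) (auto simp: hmove_def h1_def cell_def)
    \<comment> \<open>Counter \<open>d + 1\<close> is at the end although counter \<open>d\<close>
      has not accounted for all of \<open>h y\<close>: the sum exceeds \<open>length w\<close>,
      which no head position does.\<close>
    moreover have "h x + h y \<noteq> h z"
    proof -
      have "h z \<le> length w" using Suc.prems(1) d xyz by simp
      then show ?thesis using True Suc.prems(3) lt by simp
    qed
    moreover have "evals w (2 * j + 2) d f h1 f"
      using Suc.prems(1) lt hy by (intro evals_refl) (auto simp: h1_def)
    ultimately show ?thesis using evals_step[of w _ h1 f h1 _ d] by simp
  next
    case False
    define h2 where "h2 = h1(Suc d := Suc (h (Suc d)))"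
    have Sd: "h (Suc d) < length w" using False Suc.prems(1)[of "Suc d"] d by simp
    have "mstep w (AddAt 4 d x y z s f, h1) = (AddAt 3 d x y z s f, h2)"
      using Sd cell_zero_iff[OF w, of "h (Suc d)"]
      by (subst mstep_eq[where k' = "AddAt 3 d x y z s f" and d = Right])
        (auto simp: hmove_def h1_def h2_def)
    moreover have "evals w (2 * j + 2) d (AddAt 3 d x y z s f) h2
        (if h2 x + h2 y = h2 z then s else f)"
      by (rule Suc.IH) (use Suc.prems lt hy Sd d xyz in \<open>auto simp: h1_def h2_def\<close>)
    moreover have "h2 x = h x" "h2 y = h y" "h2 z = h z"
      using xyz by (auto simp: h1_def h2_def)
    ultimately show ?thesis using evals_step[of w _ h1 _ h2 _ d] by (simp add: h2_def)
  qed
  ultimately have "evals w (Suc (Suc (2 * j + 2))) d (AddAt 3 d x y z s f) h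
      (if h x + h y = h z then s else f)"
    by (rule evals_step) (simp add: h1_def)
  then show ?case by simp
qed

lemma add2:
  assumes "\<And>i. i < K \<Longrightarrow> h i \<le> length w"
    and "h d = 0" "h (Suc d) \<le> h x" "h x - h (Suc d) = j"
  shows "evals w (j + 1 + (2 * h y + 2)) d (AddAt 2 d x y z s f) h (if h x + h y = h z then s else f)"
  using assms
proof (induction j arbitrary: h)
  case 0
  then have "mstep w (AddAt 2 d x y z s f, h) = (AddAt 3 d x y z s f, h)"
    using d xyz by (subst mstep_eq[where k' = "AddAt 3 d x y z s f" and d = Stay]) (auto simp: hmove_def)
  then show ?case
    using evals_step[of w _ h _ h _ d] add3[of h "h y"] 0 by simp
next
  case (Suc j)
  define h1 where "h1 = h(Suc d := Suc (h (Suc d)))"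
  have hx: "h x \<le> length w" "h (Suc d) < h x" using Suc.prems d xyz by simp_all
  have "mstep w (AddAt 2 d x y z s f, h) = (AddAt 2 d x y z s f, h1)"
    using d xyz hx cell_zero_iff[OF w, of "h (Suc d)"]
    by (subst mstep_eq[where k' = "AddAt 2 d x y z s f" and d = Right])
      (auto simp: hmove_def h1_def)
  moreover have lt: "Suc (h (Suc d)) \<le> length w" using hx by linarith
  have "evals w (j + 1 + (2 * h1 y + 2)) d (AddAt 2 d x y z s f) h1
      (if h1 x + h1 y = h1 z then s else f)"
    by (rule Suc.IH) (use Suc.prems hx lt d xyz in \<open>auto simp: h1_def\<close>)
  moreover have "h1 x = h x" "h1 y = h y" "h1 z = h z"
    using xyz by (auto simp: h1_def)
  ultimately show ?case using evals_step[of w _ h _ h1 _ d] by (simp add: h1_def)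
qed

lemma add_evals:
  assumes h: "\<And>i. i < K \<Longrightarrow> h i \<le> length w" and k: "mstep w (k, h) = (AddAt 1 d x y z s f, h(d := 0))"
  shows "evals w (3 * length w + 6) d k h (if h x + h y = h z then s else f)"
proof -
  define h1 where "h1 = h(d := 0)"
  define h2 where "h2 = h1(Suc d := 0)"
  have "mstep w (AddAt 1 d x y z s f, h1) = (AddAt 2 d x y z s f, h2)"
    by (subst mstep_eq[where k' = "AddAt 2 d x y z s f" and d = Reset])
      (auto simp: hmove_def h2_def)
  moreover have "evals w (h2 x + 1 + (2 * h2 y + 2)) d (AddAt 2 d x y z s f) h2
      (if h2 x + h2 y = h2 z then s else f)"
    by (rule add2) (use h in \<open>auto simp: h1_def h2_def\<close>)
  moreover have eq: "h2 x = h x" "h2 y = h y" "h2 z = h z"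
    using xyz by (auto simp: h1_def h2_def)
  ultimately have "evals w (Suc (h x + 1 + (2 * h y + 2))) d (AddAt 1 d x y z s f) h1
      (if h x + h y = h z then s else f)"
    using evals_step[of w _ h1 _ h2 _ d] by (simp add: h2_def)
  then have "evals w (Suc (Suc (h x + 1 + (2 * h y + 2)))) d k h (if h x + h y = h z then s else f)"
    using k evals_step[of w k h _ h1 _ d] by (simp add: h1_def)
  moreover have "Suc (Suc (h x + 1 + (2 * h y + 2))) \<le> 3 * length w + 6"
    using h[of x] h[of y] d xyz by simp
  ultimately show ?thesis by (rule evals_mono) simp
qed

end

lemma env_Suc: "i < Suc d \<Longrightarrow> env (Suc d) h i = case_nat (h d) (env d h) i"
  by (auto simp: env_def split: nat.split)

lemma env_agree: "(\<And>i. i < d \<Longrightarrow> h1 i = h i) \<Longrightarrow> i < d \<Longrightarrow> env d h1 i = env d h i"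
  by (simp add: env_def)

text \<open>The continuations stay arbitrary in the induction because the parts of a formula are
  evaluated with other ones. \<open>width d \<phi> \<le> K\<close> provides heads for the nested
  quantifiers and for the two counters.\<close>

lemma eval_correct:
  assumes w: "0 \<notin> set w"
  shows "fvb \<phi> \<le> d \<Longrightarrow> width d \<phi> \<le> K \<Longrightarrow> (\<And>i. i < K \<Longrightarrow> h i \<le> length w) \<Longrightarrow>
    evals w (cost (length w) \<phi>) d (Ev d \<phi> s f) h (if sat w (env d h) \<phi> then s else f)"
proof (induction \<phi> arbitrary: d h s f)
  case (Sym a x)
  have "mstep w (Ev d (Sym a x) s f, h) = (if sat w (env d h) (Sym a x) then s else f, h)"
    by (subst mstep_eq[OF _ _ act.simps(1)]) (auto simp: hmove_def env_def)
  then show ?case using evals_step[of w _ h _ h 0 d] evals_refl[of h w] Sym.prems by simp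
next
  case (Add x y z)
  have "mstep w (Ev d (Add x y z) s f, h)
      = (AddAt 1 d (d - Suc x) (d - Suc y) (d - Suc z) s f, h(d := 0))"
    by (subst mstep_eq[OF _ _ act.simps(6)]) (auto simp: hmove_def)
  then have "evals w (3 * length w + 6) d (Ev d (Add x y z) s f) h
      (if h (d - Suc x) + h (d - Suc y) = h (d - Suc z) then s else f)"
    using Add.prems by (intro add_evals[OF w]) auto
  then show ?case by (simp add: env_def)
next
  case (Neg \<phi>)
  have "mstep w (Ev d (Neg \<phi>) s f, h) = (Ev d \<phi> f s, h)"
    by (subst mstep_eq[OF _ _ act.simps(2)]) (auto simp: hmove_def)
  then have "evals w (Suc (cost (length w) \<phi>)) d (Ev d (Neg \<phi>) s f) h
      (if sat w (env d h) \<phi> then f else s)"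
    using Neg evals_step[of w _ h "Ev d \<phi> f s" h] by auto
  then show ?case by (cases "sat w (env d h) \<phi>") auto
next
  case (Conj \<phi> \<psi>)
  have "mstep w (Ev d (Conj \<phi> \<psi>) s f, h) = (Ev d \<phi> (Ev d \<psi> s f) f, h)"
    by (subst mstep_eq[OF _ _ act.simps(3)]) (auto simp: hmove_def)
  moreover have 1: "evals w (cost (length w) \<phi>) d (Ev d \<phi> (Ev d \<psi> s f) f) h
      (if sat w (env d h) \<phi> then Ev d \<psi> s f else f)"
    by (rule Conj.IH) (use Conj.prems in auto)
  have "evals w (cost (length w) \<phi> + cost (length w) \<psi>) d (Ev d \<phi> (Ev d \<psi> s f) f) h
      (if sat w (env d h) (Conj \<phi> \<psi>) then s else f)"
  proof (rule evals_trans[OF 1])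
    fix h1 assume h1: "\<And>i. i < d \<Longrightarrow> h1 i = h i" "\<And>i. i < K \<Longrightarrow> h1 i \<le> length w"
    have "evals w (cost (length w) \<psi>) d (Ev d \<psi> s f) h1 (if sat w (env d h1) \<psi> then s else f)"
      by (rule Conj.IH) (use Conj.prems h1 in auto)
    moreover have "sat w (env d h1) \<psi> = sat w (env d h) \<psi>"
      using Conj.prems(1) env_agree[OF h1(1)] by (intro sat_cong[where d = d]) auto
    ultimately show "evals w (cost (length w) \<psi>) d (if sat w (env d h) \<phi> then Ev d \<psi> s f else f) h1
       (if sat w (env d h) (Conj \<phi> \<psi>) then s else f)"
      using evals_refl[OF h1(2)] by auto
  qed
  ultimately have "evals w (Suc (cost (length w) \<phi> + cost (length w) \<psi>)) d (Ev d (Conj \<phi> \<psi>) s f) h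
      (if sat w (env d h) (Conj \<phi> \<psi>) then s else f)"
    by (rule evals_step) auto
  then show ?case by simp
next
  case (Ex \<phi>)
  let ?n = "length w" and ?c = "cost (length w) \<phi>"
  have dK: "d < K" using Ex.prems(2) width_gt[of "Suc d" \<phi>] by simp
  \<comment> \<open>Used at depth \<open>Suc d\<close>, the induction hypothesis also preserves head
    \<open>d\<close>; the candidate value survives the evaluation and \<open>Next\<close> can
    advance it.\<close>
  have inner: "\<exists>t'\<le>?c. \<exists>h'. (mstep w ^^ t') (Ev (Suc d) \<phi> s (Next d \<phi> s f), h1)
      = (if sat w (env (Suc d) h1) \<phi> then s else Next d \<phi> s f, h') \<and>
      (\<forall>i<Suc d. h' i = h1 i) \<and> (\<forall>i<K. h' i \<le> length w)"
    if "\<And>i. i < K \<Longrightarrow> h1 i \<le> ?n" for h1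
    using Ex.IH[of "Suc d" h1 s "Next d \<phi> s f"] Ex.prems(1,2) that by (simp add: evals_def le_diff_conv)
  \<comment> \<open>Generalised to a search that starts with head \<open>d\<close> at any position
    and tries the values from there on, by induction on the distance to the end of the word. The
    call from \<open>Ex\<close> starts at 0.\<close>
  have loop: "evals w ((j + 1) * (?c + 1)) d (Ev (Suc d) \<phi> s (Next d \<phi> s f)) h1
      (if \<exists>v. h1 d \<le> v \<and> v \<le> ?n \<and> sat w (case_nat v (env d h1)) \<phi> then s else f)"
    if "\<And>i. i < K \<Longrightarrow> h1 i \<le> ?n" "?n - h1 d = j" for h1 j
    using that
  proof (induction j arbitrary: h1)
    case (0 h1)
    then have hd: "h1 d = ?n" using dK by (simp add: le_antisym)
    have sat_eq: "sat w (env (Suc d) h1) \<phi> = sat w (case_nat (h1 d) (env d h1)) \<phi>"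
      using Ex.prems(1) env_Suc by (intro sat_cong[where d = "Suc d"]) auto
    have "evals w (?c + 1) d (Ev (Suc d) \<phi> s (Next d \<phi> s f)) h1
        (if sat w (env (Suc d) h1) \<phi> then s else f)"
    proof -
      obtain t' h' where t': "t' \<le> ?c" "(mstep w ^^ t') (Ev (Suc d) \<phi> s (Next d \<phi> s f), h1)
         = ((if sat w (env (Suc d) h1) \<phi> then s else Next d \<phi> s f), h')"
         "\<forall>i<Suc d. h' i = h1 i" "\<forall>i<K. h' i \<le> length w"
        using inner[of h1, OF 0(1)] by auto
      show ?thesis
      proof (cases "sat w (env (Suc d) h1) \<phi>")
        case True
        then show ?thesis using t' unfolding evals_def by (intro exI[of _ t']) auto
      next
        case False
        have "mstep w (Next d \<phi> s f, h') = (f, h')"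
          using t'(3) hd by (subst mstep_eq[where k' = f and d = Stay]) (auto simp: hmove_def cell_def)
        then show ?thesis using False t' unfolding evals_def by (intro exI[of _ "Suc t'"]) auto
      qed
    qed
    moreover have "(\<exists>v. h1 d \<le> v \<and> v \<le> ?n \<and> sat w (case_nat v (env d h1)) \<phi>)
        \<longleftrightarrow> sat w (env (Suc d) h1) \<phi>"
      unfolding sat_eq using hd le_antisym by auto
    ultimately show ?case by simp
  next
    case (Suc j h1)
    then have hd: "h1 d < ?n" by simp
    have sat_eq: "sat w (env (Suc d) h1) \<phi> = sat w (case_nat (h1 d) (env d h1)) \<phi>"
      using Ex.prems(1) env_Suc by (intro sat_cong[where d = "Suc d"]) auto
    obtain t' h' where t': "t' \<le> ?c" "(mstep w ^^ t') (Ev (Suc d) \<phi> s (Next d \<phi> s f), h1)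
         = ((if sat w (env (Suc d) h1) \<phi> then s else Next d \<phi> s f), h')"
         "\<forall>i<Suc d. h' i = h1 i" "\<forall>i<K. h' i \<le> length w"
      using inner[of h1, OF Suc.prems(1)] by auto
    show ?case
    proof (cases "sat w (env (Suc d) h1) \<phi>")
      case True
      then have "evals w ?c d (Ev (Suc d) \<phi> s (Next d \<phi> s f)) h1 s"
        using t' unfolding evals_def by (intro exI[of _ t']) auto
      then have "evals w ((Suc j + 1) * (?c + 1)) d (Ev (Suc d) \<phi> s (Next d \<phi> s f)) h1 s"
        by (rule evals_mono) auto
      moreover have "\<exists>v. h1 d \<le> v \<and> v \<le> ?n \<and> sat w (case_nat v (env d h1)) \<phi>"
        using True hd unfolding sat_eq by (intro exI[of _ "h1 d"]) auto
      ultimately show ?thesis by simp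
    next
      case False
      define h2 where "h2 = h'(d := Suc (h1 d))"
      have m: "mstep w (Next d \<phi> s f, h') = (Ev (Suc d) \<phi> s (Next d \<phi> s f), h2)"
        using t'(3) hd cell_zero_iff[OF w, of "h1 d"]
        by (subst mstep_eq[where k' = "Ev (Suc d) \<phi> s (Next d \<phi> s f)" and d = Right])
          (auto simp: hmove_def h2_def)
      have s1: "(mstep w ^^ (Suc t')) (Ev (Suc d) \<phi> s (Next d \<phi> s f), h1)
          = (Ev (Suc d) \<phi> s (Next d \<phi> s f), h2)"
        using t'(2) m False by simp
      have IH: "evals w ((j + 1) * (?c + 1)) d (Ev (Suc d) \<phi> s (Next d \<phi> s f)) h2
          (if \<exists>v. h2 d \<le> v \<and> v \<le> ?n \<and> sat w (case_nat v (env d h2)) \<phi> then s else f)"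
        by (rule Suc.IH) (use t'(4) hd Suc.prems in \<open>auto simp: h2_def\<close>)
      have agree: "\<And>i. i < d \<Longrightarrow> h2 i = h1 i" using t'(3) by (auto simp: h2_def)
      have "sat w (case_nat v (env d h2)) \<phi> = sat w (case_nat v (env d h1)) \<phi>" for v
        using Ex.prems(1) env_agree[OF agree]
        by (intro sat_cong[where d = "Suc d"]) (auto split: nat.split)
      moreover have "h1 d \<le> v \<longleftrightarrow> v = h1 d \<or> h2 d \<le> v" for v by (auto simp: h2_def)
      ultimately have ex: "(\<exists>v. h2 d \<le> v \<and> v \<le> ?n \<and> sat w (case_nat v (env d h2)) \<phi>) \<longleftrightarrow>
          (\<exists>v. h1 d \<le> v \<and> v \<le> ?n \<and> sat w (case_nat v (env d h1)) \<phi>)"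
        using False unfolding sat_eq by metis
      have "evals w (?c + 1 + (j + 1) * (?c + 1)) d (Ev (Suc d) \<phi> s (Next d \<phi> s f)) h1
          (if \<exists>v. h1 d \<le> v \<and> v \<le> ?n \<and> sat w (case_nat v (env d h1)) \<phi> then s else f)"
      proof -
        obtain t2 h3 where "t2 \<le> (j + 1) * (?c + 1)" "(mstep w ^^ t2) (Ev (Suc d) \<phi> s (Next d \<phi> s f), h2)
          = (if \<exists>v. h1 d \<le> v \<and> v \<le> ?n \<and> sat w (case_nat v (env d h1)) \<phi> then s else f, h3)"
          "\<forall>i<d. h3 i = h2 i" "\<forall>i<K. h3 i \<le> length w"
          using IH unfolding ex evals_def by blast
        then show ?thesis
          using funpow_trans[OF s1] t'(1) agree unfolding evals_def
          by (intro exI[of _ "t2 + Suc t'"]) auto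
      qed
      moreover have "(Suc j + 1) * (?c + 1) = ?c + 1 + (j + 1) * (?c + 1)" by simp
      ultimately show ?thesis by (simp only:)
    qed
  qed
  have "mstep w (Ev d (Ex \<phi>) s f, h) = (Ev (Suc d) \<phi> s (Next d \<phi> s f), h(d := 0))"
    by (subst mstep_eq[OF _ _ act.simps(4)]) (auto simp: hmove_def)
  moreover have "evals w ((?n + 1) * (?c + 1)) d (Ev (Suc d) \<phi> s (Next d \<phi> s f)) (h(d := 0))
      (if \<exists>v. v \<le> ?n \<and> sat w (case_nat v (env d (h(d := 0)))) \<phi> then s else f)"
    using loop[of "h(d := 0)" ?n] Ex.prems(3) by simp
  moreover have "sat w (case_nat v (env d (h(d := 0)))) \<phi> = sat w (case_nat v (env d h)) \<phi>" for v
    using Ex.prems(1) env_agree[of d "h(d := 0)" h]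
    by (intro sat_cong[where d = "Suc d"]) (auto split: nat.split)
  ultimately have "evals w (Suc ((?n + 1) * (?c + 1))) d (Ev d (Ex \<phi>) s f) h
      (if sat w (env d h) (Ex \<phi>) then s else f)"
    using evals_step[of w _ h _ "h(d := 0)" _ d] by simp
  then show ?case by simp
qed

end

theorem sat_polynomial_time:
  "\<exists>M c k. wf_tm M \<and> (\<forall>w. set w \<subseteq> {0<..<input_alphabet} \<longrightarrow>
     fst (tm_run M (c * length w ^ k + c) w) = (if sat w (\<lambda>_. 0) \<phi> then 1 else 2))"
proof -
  interpret formula_machine \<phi> "fvb \<phi>" by unfold_locales simp
  \<comment> \<open>Steps of the multi-head machine times the tape steps for each of them, plus the
    start-up.\<close>
  have "poly_bounded (\<lambda>n. cost n \<phi> * (2 * n + 6) + 2)"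
    by (intro poly_bounded_add poly_bounded_mult poly_bounded_cost poly_bounded_const poly_bounded_id)
  then obtain c k where ck: "\<And>n. cost n \<phi> * (2 * n + 6) + 2 \<le> c * n ^ k + c"
    using poly_boundedD by blast
  obtain M where M: "wf_tm M" "\<And>w n h v t. set w \<subseteq> {0<..<input_alphabet} \<Longrightarrow>
      (mstep w ^^ n) (Ev (fvb \<phi>) \<phi> Acc Rej, \<lambda>_. 0) = (if v then Acc else Rej, h) \<Longrightarrow>
      n * (2 * length w + 6) + 2 \<le> t \<Longrightarrow> fst (tm_run M t w) = (if v then 1 else 2)"
    using multihead_realisable by blast
  have "fst (tm_run M (c * length w ^ k + c) w) = (if sat w (\<lambda>_. 0) \<phi> then 1 else 2)"
    if w: "set w \<subseteq> {0<..<input_alphabet}" for w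
  proof -
    have "0 \<notin> set w" using w by auto
    moreover have "env (fvb \<phi>) (\<lambda>_. 0) = (\<lambda>_. 0)" by (simp add: env_def fun_eq_iff)
    ultimately obtain n h where n: "n \<le> cost (length w) \<phi>"
      "(mstep w ^^ n) (Ev (fvb \<phi>) \<phi> Acc Rej, \<lambda>_. 0) = (if sat w (\<lambda>_. 0) \<phi> then Acc else Rej, h)"
      using eval_correct[of w \<phi> "fvb \<phi>" "\<lambda>_. 0" Acc Rej] by (auto simp: evals_def)
    have "n * (2 * length w + 6) + 2 \<le> c * length w ^ k + c"
      using ck[of "length w"] mult_le_mono1[OF n(1), of "2 * length w + 6"] by linarith
    then show ?thesis using M(2)[OF w n(2)] by blast
  qed
  then show ?thesis using M(1) by blast
qed

section \<open>Parsing encoded instances\<close>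

declare bin.simps [simp del]

lemma bin_0 [simp]: "bin 0 = []"
  by (simp add: bin.simps)

lemma set_bin: "set (bin n) \<subseteq> {1, 2}"
proof (induction n rule: bin.induct)
  case (1 n)
  then show ?case by (subst bin.simps) auto
qed

text \<open>Horner evaluation is a left inverse of \<open>bin\<close>, with digit 1 standing for bit
  0 and digit 2 for bit 1; this gives injectivity.\<close>

lemma fold_bin: "foldl (\<lambda>a d. 2 * a + (if d = 1 then 0 else 1)) 0 (bin n) = n"
proof (induction n rule: bin.induct)
  case (1 n)
  show ?case
  proof (cases "n = 0")
    case False
    then show ?thesis using 1 by (subst bin.simps) (auto, presburger+)
  qed simp
qed

lemma bin_inject [simp]: "bin m = bin n \<longleftrightarrow> m = n"
  by (metis fold_bin)

lemma unary_int_inject [simp]: "unary_int i = unary_int j \<longleftrightarrow> i = j"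
proof -
  have "(if cell (unary_int i) 0 = 4 then 1 - int (length (unary_int i)) else int (length (unary_int i))) = i"
    for i by (auto simp: unary_int_def cell_def)
  then show ?thesis by metis
qed

lemma set_unary_int: "set (unary_int i) \<subseteq> {3, 4}"
  by (auto simp: unary_int_def)

lemma enc_gval_inject: "enc_gval v = enc_gval v' \<longleftrightarrow> v = v'"
  by (cases v; cases v') auto

lemma set_enc_gval: "set (enc_gval v) \<subseteq> {1, 2, 3, 4, 8, 9}"
  using set_bin set_unary_int by (cases v) fastforce+

lemma set_enc_sort: "set (map enc_sort ss) \<subseteq> {10, 11}"
proof -
  have "enc_sort s \<in> {10, 11}" for s by (cases s) auto
  then show ?thesis by auto
qed

lemma set_enc_pred: "set (enc_pred P) \<subseteq> {1, 2, 5, 10, 11}"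
  using set_bin[of "pname P"] set_enc_sort[of "psig P"] by (auto simp: enc_pred_def)

definition enc_args :: "gval list \<Rightarrow> nat list" where
  "enc_args vs = concat (map (\<lambda>v. 5 # enc_gval v) vs)"

lemma enc_args_simps [simp]:
  "enc_args [] = []" "enc_args (v # vs) = 5 # enc_gval v @ enc_args vs"
  by (simp_all add: enc_args_def)

lemma enc_fact_eq: "enc_fact g = enc_pred (gpred g) @ enc_args (gargs g) @ [6]"
  by (simp add: enc_fact_def enc_args_def)

lemma set_enc_args: "set (enc_args vs) \<subseteq> {1, 2, 3, 4, 5, 8, 9}"
proof (induction vs)
  case (Cons v vs)
  then show ?case using set_enc_gval[of v] by auto
qed simp

lemma append_Cons_unique:
  "x \<notin> set u \<Longrightarrow> x \<notin> set u' \<Longrightarrow> u @ x # v = u' @ x # v' \<Longrightarrow> u = u' \<and> v = v'"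
proof (induction u arbitrary: u')
  case Nil
  then show ?case by (cases u') auto
next
  case (Cons a u)
  then show ?case by (cases u') auto
qed

lemma append_Cons_skip: "x \<notin> set p \<Longrightarrow> p @ r = u @ x # v \<Longrightarrow> \<exists>u'. u = p @ u' \<and> r = u' @ x # v"
proof (induction p arbitrary: u)
  case (Cons a p)
  then show ?case by (cases u) auto
qed simp

lemma enc_args_append: "\<exists>y r. enc_args vs @ [6] = y # r \<and> y \<in> {5, 6}"
  by (cases vs) auto

text \<open>The code of a value contains neither 5 nor 6, and what follows it starts with one of
  them, so cutting at the first such symbol isolates the first value.\<close>

lemma enc_args_inject: "enc_args vs @ [6] = enc_args vs' @ [6] \<Longrightarrow> vs = vs'"
proof (induction vs arbitrary: vs')
  case Nil
  then show ?case by (cases vs') auto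
next
  case (Cons v vs)
  then obtain v' vs'' where vs': "vs' = v' # vs''" by (cases vs') auto
  let ?P = "\<lambda>x. x \<noteq> 5 \<and> x \<noteq> (6::nat)"
  have tw: "takeWhile ?P (enc_gval v @ enc_args vs @ [6]) = enc_gval v" for v vs
    using set_enc_gval[of v] enc_args_append[of vs]
    by (subst takeWhile_append2) fastforce+
  have eq: "enc_gval v @ enc_args vs @ [6] = enc_gval v' @ enc_args vs'' @ [6]"
    using Cons.prems vs' by simp
  then have "enc_gval v = enc_gval v'" using tw by metis
  then show ?case using Cons.IH[of vs''] eq vs' by (simp add: enc_gval_inject)
qed

lemma enc_sort_inject: "enc_sort s = enc_sort s' \<longleftrightarrow> s = s'"
  by (cases s; cases s') auto

lemma enc_fact_inject: "enc_fact g = enc_fact g' \<Longrightarrow> g = g'"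
proof -
  assume e: "enc_fact g = enc_fact g'"
  have 5: "5 \<notin> set (bin n)" "5 \<notin> set (map enc_sort ss)" for n ss
    using set_bin[of n] set_enc_sort[of ss] by auto
  define rest where "rest g = (if pidb (gpred g) then 2 else 1) # enc_args (gargs g) @ [6]" for g
  have enc: "enc_fact g = bin (pname (gpred g)) @ 5 # (map enc_sort (psig (gpred g)) @ 5 # rest g)" for g
    by (simp add: enc_fact_eq enc_pred_def rest_def)
  from append_Cons_unique[OF 5(1) 5(1) e[unfolded enc]]
  have n: "pname (gpred g) = pname (gpred g')"
    and e2: "map enc_sort (psig (gpred g)) @ 5 # rest g = map enc_sort (psig (gpred g')) @ 5 # rest g'"
    by auto
  from append_Cons_unique[OF 5(2) 5(2) e2]
  have s: "map enc_sort (psig (gpred g)) = map enc_sort (psig (gpred g'))" and r: "rest g = rest g'" by auto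
  have "inj enc_sort" by (auto simp: inj_def enc_sort_inject)
  then have "psig (gpred g) = psig (gpred g')" using s by (simp add: inj_map_eq_map)
  moreover have "pidb (gpred g) = pidb (gpred g')" "gargs g = gargs g'"
    using r enc_args_inject by (auto simp: rest_def split: if_splits)
  ultimately show "g = g'" using n by (simp add: gatom.expand pred.expand)
qed

definition enc_facts :: "gatom list \<Rightarrow> nat list" where
  "enc_facts xs = concat (map enc_fact xs)"

lemma enc_facts_simps [simp]: "enc_facts [] = []" "enc_facts (x # xs) = enc_fact x @ enc_facts xs"
  by (simp_all add: enc_facts_def)

lemma enc_fact_split: "\<exists>u. enc_fact g = u @ [6] \<and> set u \<subseteq> {1, 2, 3, 4, 5, 8, 9, 10, 11}"
  using set_enc_pred[of "gpred g"] set_enc_args[of "gargs g"]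
  by (intro exI[of _ "enc_pred (gpred g) @ enc_args (gargs g)"]) (auto simp: enc_fact_eq)

lemma set_enc_facts: "set (enc_facts xs) \<subseteq> {1, 2, 3, 4, 5, 6, 8, 9, 10, 11}"
proof (induction xs)
  case (Cons x xs)
  then show ?case using enc_fact_split[of x] by fastforce
qed simp

section \<open>Segments of a word and lookup of facts\<close>

definition seg :: "nat list \<Rightarrow> nat \<Rightarrow> nat list \<Rightarrow> nat \<Rightarrow> bool" where
  "seg w s a m \<longleftrightarrow> (\<exists>u v. w = u @ a @ v \<and> length u = s \<and> m = s + length a)"

lemma segD: "seg w s a m \<Longrightarrow> m = s + length a \<and> m \<le> length w"
  by (auto simp: seg_def)

lemma seg_iff: "seg w s a m \<longleftrightarrow> s \<le> m \<and> m \<le> length w \<and> take (m - s) (drop s w) = a"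
proof
  assume r: "s \<le> m \<and> m \<le> length w \<and> take (m - s) (drop s w) = a"
  then have "w = take s w @ a @ drop (m - s) (drop s w)"
    by (metis append_take_drop_id)
  then show "seg w s a m"
    unfolding seg_def using r by (intro exI[of _ "take s w"] exI[of _ "drop (m - s) (drop s w)"]) auto
qed (auto simp: seg_def)

lemma seg_unique: "seg w s a m \<Longrightarrow> seg w s b m \<Longrightarrow> a = b"
  by (simp add: seg_iff)

lemma seg_cell: "seg w s a m \<Longrightarrow> i < length a \<Longrightarrow> cell w (s + i) = a ! i"
  by (auto simp: seg_def cell_def nth_append)

text \<open>The splitting position lies within the word in any case; the explicit bound gives the
  right-hand side the form of a quantifier of \<open>sat\<close>.\<close>

lemma seg_append: "seg w s (a @ b) m \<longleftrightarrow> (\<exists>k\<le>length w. seg w s a k \<and> seg w k b m)"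
proof
  assume "seg w s (a @ b) m"
  then obtain u v where "w = u @ a @ b @ v" "length u = s" "m = s + length a + length b"
    by (auto simp: seg_def)
  then show "\<exists>k\<le>length w. seg w s a k \<and> seg w k b m"
    unfolding seg_def
    by (intro exI[of _ "s + length a"] conjI exI[of _ u] exI[of _ "b @ v"] exI[of _ "u @ a"] exI[of _ v]) auto
next
  assume "\<exists>k\<le>length w. seg w s a k \<and> seg w k b m"
  then obtain k where k: "s \<le> k" "k \<le> m" "m \<le> length w"
    "take (k - s) (drop s w) = a" "take (m - k) (drop k w) = b"
    by (auto simp: seg_iff)
  have "take (m - s) (drop s w) = take ((k - s) + (m - k)) (drop s w)" using k by simp
  also have "\<dots> = take (k - s) (drop s w) @ take (m - k) (drop (k - s + s) w)"
    by (simp only: take_add drop_drop)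
  also have "\<dots> = a @ b" using k by simp
  finally show "seg w s (a @ b) m" using k by (simp add: seg_iff)
qed

lemma seg_Nil: "seg w s [] m \<longleftrightarrow> s = m \<and> m \<le> length w"
  by (auto simp: seg_iff)

lemma seg_single: "seg w s [a] m \<longleftrightarrow> m = Suc s \<and> m \<le> length w \<and> cell w s = a"
proof
  assume "m = Suc s \<and> m \<le> length w \<and> cell w s = a"
  then show "seg w s [a] m"
    by (cases "drop s w") (auto simp: seg_iff cell_def Suc_le_eq dest: nth_via_drop)
qed (use segD seg_cell[of w s "[a]" m 0] in force)

lemma seg_Cons: "seg w s (a # b) m \<longleftrightarrow> (\<exists>k\<le>length w. k = Suc s \<and> cell w s = a \<and> seg w k b m)"
  using seg_append[of w s "[a]" b m] by (auto simp: seg_single)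

text \<open>The code of a fact contains 6 only as its last symbol, so the facts start at 0 or right
  behind a 6. Demanding such a start excludes hits inside a longer code, for instance one whose
  predicate name merely ends with the digits searched for.\<close>

lemma fact_lookup:
  assumes "6 \<notin> set r"
  shows "g \<in> set xs \<longleftrightarrow> (\<exists>s m. (s = 0 \<or> cell (enc_facts xs @ r) (s - 1) = 6) \<and>
     seg (enc_facts xs @ r) s (enc_fact g) m)"
proof (induction xs)
  case Nil
  have "\<not> seg r s (enc_fact g) m" for s m
    using assms enc_fact_split[of g] by (auto simp: seg_def)
  then show ?case by simp
next
  case (Cons f fs)
  obtain u where u: "enc_fact f = u @ [6]" "6 \<notin> set u"
    using enc_fact_split[of f] by fastforce
  obtain u' where u': "enc_fact g = u' @ [6]" "6 \<notin> set u'"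
    using enc_fact_split[of g] by fastforce
  let ?w = "enc_facts fs @ r"
  have w: "enc_facts (f # fs) @ r = u @ 6 # ?w" by (simp add: u)
  have c: "cell (u @ 6 # ?w) i = (if i < length u then u ! i else if i = length u then 6
      else cell ?w (i - Suc (length u)))" for i
    by (auto simp: cell_def nth_append)
  show ?case
  proof
    assume g: "g \<in> set (f # fs)"
    show "\<exists>s m. (s = 0 \<or> cell (enc_facts (f # fs) @ r) (s - 1) = 6) \<and>
       seg (enc_facts (f # fs) @ r) s (enc_fact g) m"
    proof (cases "g = f")
      case True
      then show ?thesis
        by (intro exI[of _ 0] exI[of _ "length (enc_fact g)"]) (auto simp: seg_def)
    next
      case False
      then obtain s m where sm: "s = 0 \<or> cell ?w (s - 1) = 6" "seg ?w s (enc_fact g) m"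
        using g Cons.IH by auto
      obtain p q where "?w = p @ enc_fact g @ q" "length p = s" "m = s + length (enc_fact g)"
        using sm(2) by (auto simp: seg_def)
      then have "seg (u @ 6 # ?w) (Suc (length u) + s) (enc_fact g) (Suc (length u) + m)"
        unfolding seg_def by (intro exI[of _ "u @ 6 # p"] exI[of _ q]) auto
      moreover have "cell (u @ 6 # ?w) (Suc (length u) + s - 1) = 6"
        using sm(1) by (auto simp: c)
      ultimately show ?thesis unfolding w by blast
    qed
  next
    assume "\<exists>s m. (s = 0 \<or> cell (enc_facts (f # fs) @ r) (s - 1) = 6) \<and>
       seg (enc_facts (f # fs) @ r) s (enc_fact g) m"
    then obtain s m where s: "s = 0 \<or> cell (u @ 6 # ?w) (s - 1) = 6"
      and m: "seg (u @ 6 # ?w) s (enc_fact g) m" unfolding w by blast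
    obtain p q where pq: "u @ 6 # ?w = p @ enc_fact g @ q" "length p = s" "m = s + length (enc_fact g)"
      using m by (auto simp: seg_def)
    show "g \<in> set (f # fs)"
    proof (cases "s = 0")
      case True
      then have "u @ 6 # ?w = u' @ 6 # q" using pq u' by simp
      then have "u = u'" using append_Cons_unique u(2) u'(2) by metis
      then show ?thesis using u u' enc_fact_inject by simp
    next
      case False
      then have c6: "cell (u @ 6 # ?w) (s - 1) = 6" using s by simp
      \<comment> \<open>Position \<open>s - 1\<close> holds a 6 and \<open>u\<close> contains none,
        so the occurrence starts behind the first fact and can be shifted into the remaining
        word.\<close>
      have s': "s \<ge> Suc (length u)"
      proof (rule ccontr)
        assume "\<not> ?thesis"
        then have "s - 1 < length u" using False by simp
        then show False using c6 u(2) nth_mem[of "s - 1" u] by (auto simp: c)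
      qed
      then obtain s0 where s0: "s = Suc (length u) + s0" using le_Suc_ex by blast
      have tk: "take (Suc (length u)) (u @ 6 # ?w) = take (Suc (length u)) p"
        "drop (Suc (length u)) (u @ 6 # ?w) = drop (Suc (length u)) p @ enc_fact g @ q"
        using pq s' by simp_all
      have "?w = drop (Suc (length u)) p @ enc_fact g @ q" using tk(2) by simp
      then have "seg ?w s0 (enc_fact g) (s0 + length (enc_fact g))"
        unfolding seg_def using pq(2) s0 by (intro exI[of _ "drop (Suc (length u)) p"] exI[of _ q]) auto
      moreover have "s0 = 0 \<or> cell ?w (s0 - 1) = 6"
        using c6 s0 by (cases s0) (auto simp: c)
      ultimately show ?thesis using Cons.IH by auto
    qed
  qed
qed

lemma enc_args_object:
  "enc_args vs @ [6] = u @ 8 # v \<Longrightarrow> \<exists>c y v'. GO c \<in> set vs \<and> v = bin c @ y # v' \<and> y \<in> {5, 6}"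
proof (induction vs arbitrary: u)
  case Nil
  then show ?case by (cases u) auto
next
  case (Cons a vs)
  show ?case
  proof (cases a)
    case (GO c)
    then have "[5] @ (8 # bin c @ enc_args vs @ [6]) = u @ 8 # v" using Cons.prems by simp
    then obtain u' where u': "8 # bin c @ enc_args vs @ [6] = u' @ 8 # v"
      using append_Cons_skip[of "8::nat" "[5]"] by fastforce
    show ?thesis
    proof (cases u')
      case Nil
      then show ?thesis using u' enc_args_append[of vs] GO by auto
    next
      case (Cons b u'')
      then have "bin c @ (enc_args vs @ [6]) = u'' @ 8 # v" using u' by simp
      moreover have "8 \<notin> set (bin c)" using set_bin[of c] by auto
      ultimately obtain u3 where "enc_args vs @ [6] = u3 @ 8 # v"
        using append_Cons_skip by metis
      then show ?thesis using Cons.IH by auto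
    qed
  next
    case (GT i)
    then have "(5 # 9 # unary_int i) @ (enc_args vs @ [6]) = u @ 8 # v" using Cons.prems by simp
    moreover have "8 \<notin> set (5 # 9 # unary_int i)" using set_unary_int[of i] by auto
    ultimately obtain u3 where "enc_args vs @ [6] = u3 @ 8 # v"
      using append_Cons_skip by metis
    then show ?thesis using Cons.IH by auto
  qed
qed

text \<open>Symbol 8 serves only as the object marker, so what follows an 8 is the name of an
  argument of a listed fact, ended by 5 or 6. The hypothesis on \<open>r\<close> confines the
  occurrence to the section of facts.\<close>

lemma enc_facts_object:
  "8 \<notin> set r \<Longrightarrow> enc_facts xs @ r = u @ 8 # v \<Longrightarrow>
    \<exists>g\<in>set xs. \<exists>c y v'. GO c \<in> set (gargs g) \<and> v = bin c @ y # v' \<and> y \<in> {5, 6}"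
proof (induction xs arbitrary: u)
  case Nil
  then have "8 \<in> set r" by auto
  then show ?case using Nil by simp
next
  case (Cons f fs)
  have "enc_pred (gpred f) @ (enc_args (gargs f) @ [6] @ enc_facts fs @ r) = u @ 8 # v"
    using Cons.prems by (simp add: enc_fact_eq)
  moreover have "8 \<notin> set (enc_pred (gpred f))" using set_enc_pred[of "gpred f"] by auto
  ultimately obtain u1 where u1: "(enc_args (gargs f) @ [6]) @ (enc_facts fs @ r) = u1 @ 8 # v"
    using append_Cons_skip by (metis append.assoc)
  show ?case
  proof (cases "length u1 < length (enc_args (gargs f) @ [6])")
    case True
    then obtain us where us: "enc_args (gargs f) @ [6] = u1 @ us" "us @ enc_facts fs @ r = 8 # v" "us \<noteq> []"
    proof -
      have "take (length u1) (enc_args (gargs f) @ [6]) = u1"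
        using arg_cong[OF u1, of "take (length u1)"] True by simp
      moreover have "drop (length u1) (enc_args (gargs f) @ [6]) @ enc_facts fs @ r = 8 # v"
        using arg_cong[OF u1, of "drop (length u1)"] True by simp
      ultimately show ?thesis
        using True that[of "drop (length u1) (enc_args (gargs f) @ [6])"]
        by (metis append_take_drop_id drop_eq_Nil not_le)
    qed
    then obtain us' where "us = 8 # us'" "v = us' @ enc_facts fs @ r" by (cases us) auto
    then show ?thesis using enc_args_object[of "gargs f" u1 us'] us(1) by fastforce
  next
    case False
    then obtain u2 where "enc_facts fs @ r = u2 @ 8 # v"
      using u1 by (auto simp: append_eq_append_conv2 Cons_eq_append_conv)
    then show ?thesis using Cons by auto
  qed
qed

lemma object_in_enc_facts:
  assumes "g \<in> set xs" "GO c \<in> set (gargs g)"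
  shows "\<exists>u y v. enc_facts xs @ r = u @ 8 # bin c @ y # v \<and> y \<in> {5, 6}"
proof -
  obtain xs1 xs2 where xs: "xs = xs1 @ g # xs2" using assms(1) by (meson split_list)
  obtain as bs where as: "gargs g = as @ GO c # bs" using assms(2) by (meson split_list)
  obtain y t where y: "enc_args bs @ [6] = y # t" "y \<in> {5, 6}" using enc_args_append by blast
  have "enc_facts xs @ r = (enc_facts xs1 @ enc_pred (gpred g) @ enc_args as @ [5]) @ 8 # bin c @
      (enc_args bs @ [6]) @ enc_facts xs2 @ r"
    by (simp add: xs enc_facts_def enc_fact_eq as enc_args_def)
  then show ?thesis using y by (metis append_Cons)
qed

section \<open>Object names as blocks of digits\<close>

definition digit :: "nat \<Rightarrow> bool" where "digit a \<longleftrightarrow> a = 1 \<or> a = 2"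

text \<open>Behind an object marker this block is the whole name, since names consist of digits and
  are followed by 5 or 6.\<close>

definition token :: "nat list \<Rightarrow> nat \<Rightarrow> nat list" where
  "token w p = takeWhile digit (drop (Suc p) w)"

lemma token_eq: "y \<in> {5, 6} \<Longrightarrow> token (u @ 8 # bin c @ y # v) (length u) = bin c"
  using set_bin[of c] by (auto simp: token_def digit_def takeWhile_append2 takeWhile_append)

text \<open>Describes the end of the token by conditions on single positions, as a formula can. The
  end of the word counts as a non-digit because \<open>cell\<close> reads 0 there.\<close>

lemma seg_token:
  assumes "p < length w"
  shows "seg w (Suc p) (token w p) q \<longleftrightarrow> p < q \<and> q \<le> length w \<and>
    \<not> digit (cell w q) \<and> (\<forall>r\<le>length w. p < r \<and> r < q \<longrightarrow> digit (cell w r))"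
proof
  assume s: "seg w (Suc p) (token w p) q"
  have q: "q = Suc p + length (token w p)" "q \<le> length w" using segD[OF s] by auto
  have "digit (cell w r)" if "p < r" "r < q" for r
  proof -
    have "cell w (Suc p + (r - Suc p)) = token w p ! (r - Suc p)"
      by (rule seg_cell[OF s]) (use that q in auto)
    moreover have "digit (token w p ! (r - Suc p))"
      using that q set_takeWhileD nth_mem[of "r - Suc p" "token w p"] unfolding token_def by fastforce
    ultimately show ?thesis using that by simp
  qed
  moreover have "\<not> digit (cell w q)"
  proof (cases "q < length w")
    case True
    then have "length (takeWhile digit (drop (Suc p) w)) < length (drop (Suc p) w)"
      using q by (simp add: token_def)
    then have "\<not> digit (drop (Suc p) w ! length (takeWhile digit (drop (Suc p) w)))"
      by (rule nth_length_takeWhile)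
    then show ?thesis using True q by (simp add: token_def cell_def)
  qed (simp add: cell_def digit_def)
  ultimately show "p < q \<and> q \<le> length w \<and>
    \<not> digit (cell w q) \<and> (\<forall>r\<le>length w. p < r \<and> r < q \<longrightarrow> digit (cell w r))" using q by auto
next
  assume r: "p < q \<and> q \<le> length w \<and>
    \<not> digit (cell w q) \<and> (\<forall>r\<le>length w. p < r \<and> r < q \<longrightarrow> digit (cell w r))"
  define a where "a = take (q - Suc p) (drop (Suc p) w)"
  have s: "seg w (Suc p) a q" using r by (simp add: seg_iff a_def)
  have "digit x" if x: "x \<in> set a" for x
  proof -
    obtain i where i: "i < length a" "x = a ! i" using x by (metis in_set_conv_nth)
    have "cell w (Suc p + i) = a ! i" by (rule seg_cell[OF s i(1)])
    moreover have "p < Suc p + i" "Suc p + i < q" using i(1) segD[OF s] by auto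
    ultimately show ?thesis using r i(2) by (metis le_trans less_imp_le_nat)
  qed
  moreover have "drop (Suc p) w = a @ drop q w"
  proof -
    have "drop (q - Suc p) (drop (Suc p) w) = drop q w" using r by simp
    then show ?thesis unfolding a_def by (metis append_take_drop_id)
  qed
  moreover have "takeWhile digit (drop q w) = []"
    using r by (cases "q < length w") (auto simp: Cons_nth_drop_Suc[symmetric] cell_def)
  ultimately have "token w p = a" by (simp add: token_def takeWhile_append2)
  then show "seg w (Suc p) (token w p) q" using s by simp
qed

lemma seg_token_ex: "p < length w \<Longrightarrow> \<exists>q\<le>length w. seg w (Suc p) (token w p) q"
proof -
  assume p: "p < length w"
  have "length (token w p) \<le> length (drop (Suc p) w)"
    unfolding token_def by (rule length_takeWhile_le)
  moreover have "take (length (token w p)) (drop (Suc p) w) = token w p"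
    unfolding token_def by (metis takeWhile_eq_take)
  ultimately show ?thesis
    using p by (intro exI[of _ "Suc p + length (token w p)"]) (auto simp: seg_iff)
qed

section \<open>Definable relations on instances\<close>

datatype inst = Inst (facts: "gatom list") (tin: int) (tout: int)

definition word :: "inst \<Rightarrow> nat list" where
  "word I = enc_instance (facts I) (tin I) (tout I)"

definition valid :: "inst \<Rightarrow> bool" where
  "valid I \<longleftrightarrow> (\<forall>g\<in>set (facts I). fact g \<and> \<not> pidb (gpred g)) \<and> tout I \<le> tin I"

definition bounded :: "inst \<Rightarrow> (nat \<Rightarrow> nat) \<Rightarrow> bool" where
  "bounded I e \<longleftrightarrow> (\<forall>i. e i \<le> length (word I))"

text \<open>Relations may depend on the instance itself, not only on its encoding.\<close>

definition definable :: "(inst \<Rightarrow> (nat \<Rightarrow> nat) \<Rightarrow> bool) \<Rightarrow> bool" where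
  "definable R \<longleftrightarrow> (\<exists>\<phi>. \<forall>I e. valid I \<longrightarrow> bounded I e \<longrightarrow> sat (word I) e \<phi> = R I e)"

lemma word_eq: "word I = enc_facts (facts I) @ 7 # unary_int (tin I) @ 7 # unary_int (tout I)"
  by (simp add: word_def enc_instance_def enc_facts_def)

lemma set_word: "set (word I) \<subseteq> {0<..<input_alphabet}"
  using set_enc_facts[of "facts I"] set_unary_int[of "tin I"] set_unary_int[of "tout I"]
  by (fastforce simp: word_eq input_alphabet_def)

lemma cell_word_zero: "i \<le> length (word I) \<Longrightarrow> cell (word I) i = 0 \<longleftrightarrow> i = length (word I)"
  using subsetD[OF set_word[of I] nth_mem[of i "word I"]] by (auto simp: cell_def)

lemma cell_word_less: "cell (word I) i < input_alphabet"
  using subsetD[OF set_word[of I] nth_mem[of i "word I"]] by (auto simp: cell_def input_alphabet_def)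

lemma bounded_Suc: "bounded I e \<Longrightarrow> v \<le> length (word I) \<Longrightarrow> bounded I (case_nat v e)"
  by (auto simp: bounded_def split: nat.split)

lemma boundedD [simp]: "bounded I e \<Longrightarrow> e i \<le> length (word I)"
  by (simp add: bounded_def)

lemma definable_cong:
  assumes "definable R" "\<And>I e. valid I \<Longrightarrow> bounded I e \<Longrightarrow> R' I e = R I e"
  shows "definable R'"
  using assms unfolding definable_def by metis

lemma definable_not: "definable R \<Longrightarrow> definable (\<lambda>I e. \<not> R I e)"
  unfolding definable_def by (metis sat.simps(3))

lemma definable_conj: "definable R \<Longrightarrow> definable R' \<Longrightarrow> definable (\<lambda>I e. R I e \<and> R' I e)"
  unfolding definable_def by (metis sat.simps(4))

lemma definable_disj: "definable R \<Longrightarrow> definable R' \<Longrightarrow> definable (\<lambda>I e. R I e \<or> R' I e)"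
  by (rule definable_cong[OF definable_not[OF definable_conj[OF definable_not definable_not]]]) auto

lemma definable_imp: "definable R \<Longrightarrow> definable R' \<Longrightarrow> definable (\<lambda>I e. R I e \<longrightarrow> R' I e)"
  by (rule definable_cong[OF definable_disj[OF definable_not]]) auto

lemma definable_iff: "definable R \<Longrightarrow> definable R' \<Longrightarrow> definable (\<lambda>I e. R I e \<longleftrightarrow> R' I e)"
  by (rule definable_cong[OF definable_conj[OF definable_imp definable_imp], of R R' R' R]) auto

text \<open>In the premise the environment is shifted so that index 0 carries the quantified value.
  In this form \<open>intro\<close> strips bounded quantifiers from a relation by higher-order
  unification.\<close>

lemma definable_ex:
  assumes "definable (\<lambda>I e. R I (\<lambda>i. e (Suc i)) (e 0))"
  shows "definable (\<lambda>I e. \<exists>v\<le>length (word I). R I e v)"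
proof -
  obtain \<phi> where \<phi>: "\<And>I e. valid I \<Longrightarrow> bounded I e \<Longrightarrow> sat (word I) e \<phi> = R I (\<lambda>i. e (Suc i)) (e 0)"
    using assms by (auto simp: definable_def)
  show ?thesis
    unfolding definable_def
    by (intro exI[of _ "Ex \<phi>"]) (auto simp: \<phi> bounded_Suc)
qed

lemma definable_all:
  assumes "definable (\<lambda>I e. R I (\<lambda>i. e (Suc i)) (e 0))"
  shows "definable (\<lambda>I e. \<forall>v\<le>length (word I). R I e v)"
  by (rule definable_cong[OF definable_not[OF definable_ex[where R = "\<lambda>I e v. \<not> R I e v"]]]) (use definable_not[OF assms] in auto)

lemma definable_sym: "definable (\<lambda>I e. cell (word I) (e x) = a)"
  unfolding definable_def by (intro exI[of _ "Sym a x"]) auto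

lemma definable_add: "definable (\<lambda>I e. e x + e y = e z)"
  unfolding definable_def by (intro exI[of _ "Add x y z"]) auto

text \<open>\<open>fm\<close> has no truth constants; excluded middle and contradiction for a symbol
  test stand in for them.\<close>

lemma definable_const: "definable (\<lambda>I e. b)"
proof (cases b)
  case True
  show ?thesis
    by (rule definable_cong[OF definable_disj[OF definable_sym definable_not[OF definable_sym[of 0 0]], of 0 0]]) (use True in auto)
next
  case False
  show ?thesis
    by (rule definable_cong[OF definable_conj[OF definable_sym definable_not[OF definable_sym[of 0 0]], of 0 0]]) (use False in auto)
qed

text \<open>The index set is fixed independently of the instance and unfolds into a finite
  disjunction, in contrast to quantification over positions.\<close>

lemma definable_bex: "finite A \<Longrightarrow> (\<And>a. a \<in> A \<Longrightarrow> definable (R a)) \<Longrightarrow> definable (\<lambda>I e. \<exists>a\<in>A. R a I e)"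
proof (induction A rule: finite_induct)
  case empty
  then show ?case using definable_const[of False] by simp
next
  case (insert x F)
  then show ?case using definable_disj[of "R x" "\<lambda>I e. \<exists>a\<in>F. R a I e"] by simp
qed

lemma definable_ball: "finite A \<Longrightarrow> (\<And>a. a \<in> A \<Longrightarrow> definable (R a)) \<Longrightarrow> definable (\<lambda>I e. \<forall>a\<in>A. R a I e)"
  by (rule definable_cong[OF definable_not[OF definable_bex[where R = "\<lambda>a I e. \<not> R a I e"]]]) (auto intro: definable_not)

lemmas definable_logic = definable_not definable_conj definable_disj definable_imp definable_iff definable_ex definable_all definable_sym definable_add definable_const

lemma definable_less: "definable (\<lambda>I e. e x < e y)"
proof (rule definable_cong)
  \<comment> \<open>The second conjunct expresses that the difference \<open>v\<close> is
    nonzero.\<close>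
  show "definable (\<lambda>I e. \<exists>v\<le>length (word I). e x + v = e y \<and> \<not> e y + v = e y)"
    by (intro definable_logic)
next
  fix I :: inst and e assume "bounded I e"
  then have "e y \<le> length (word I)" by simp
  then show "(e x < e y) \<longleftrightarrow> (\<exists>v\<le>length (word I). e x + v = e y \<and> \<not> e y + v = e y)"
    by (auto intro!: exI[of _ "e y - e x"])
qed

lemma definable_eq: "definable (\<lambda>I e. e x = e y)"
  by (rule definable_cong[OF definable_conj[OF definable_not[OF definable_less[of x y]] definable_not[OF definable_less[of y x]]]]) auto

lemma definable_zero: "definable (\<lambda>I e. e x = 0)"
  by (rule definable_cong[OF definable_add[of x x x]]) auto

lemma definable_Suc: "definable (\<lambda>I e. e y = Suc (e x))"
proof (rule definable_cong)
  show "definable (\<lambda>I e. e x < e y \<and> \<not> (\<exists>v\<le>length (word I). e x < v \<and> v < e y))"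
    by (intro definable_logic definable_less)
next
  fix I :: inst and e assume "bounded I e"
  then have "e y \<le> length (word I)" by simp
  then show "(e y = Suc (e x)) \<longleftrightarrow> e x < e y \<and> \<not> (\<exists>v\<le>length (word I). e x < v \<and> v < e y)"
    by (metis Suc_leI le_trans less_eq_Suc_le not_less_eq order_le_less less_irrefl lessI)
qed

lemma definable_len: "definable (\<lambda>I e. e x = length (word I))"
  by (rule definable_cong[OF definable_sym[of x 0]]) (use cell_word_zero in auto)

lemma definable_same_cell: "definable (\<lambda>I e. cell (word I) (e x) = cell (word I) (e y))"
proof (rule definable_cong)
  show "definable (\<lambda>I e. \<exists>a\<in>{..<input_alphabet}. cell (word I) (e x) = a \<and> cell (word I) (e y) = a)"
    by (intro definable_bex definable_logic) simp
qed (use cell_word_less in auto)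

lemma definable_digit: "definable (\<lambda>I e. digit (cell (word I) (e x)))"
  unfolding digit_def by (intro definable_logic)

lemmas definable_basic = definable_logic definable_less definable_eq definable_zero definable_Suc definable_len definable_same_cell definable_digit

lemma definable_seg_const: "definable (\<lambda>I e. seg (word I) (e x) cs (e y))"
proof (induction cs arbitrary: x y)
  case Nil
  show ?case by (rule definable_cong[OF definable_eq[of x y]]) (simp add: seg_Nil)
next
  case (Cons a cs)
  show ?case unfolding seg_Cons by (intro definable_basic Cons)
qed

text \<open>Two segments carry the same word iff they have a common length \<open>l\<close> and
  agree cell by cell. Corresponding cells are reached as \<open>s + i\<close> and
  \<open>s' + i\<close>, which only addition makes expressible.\<close>

lemma seg_copy:
  "(\<exists>a. seg w s a m \<and> seg w s' a m') \<longleftrightarrow> m \<le> length w \<and> m' \<le> length w \<and>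
    (\<exists>l\<le>length w. s + l = m \<and> s' + l = m' \<and> (\<forall>i\<le>length w. i < l \<longrightarrow>
      (\<exists>p\<le>length w. \<exists>q\<le>length w. s + i = p \<and> s' + i = q \<and> cell w p = cell w q)))"
  (is "?L \<longleftrightarrow> ?R")
proof
  assume ?L
  then obtain a where a: "seg w s a m" "seg w s' a m'" by blast
  then show ?R
    using segD[OF a(1)] segD[OF a(2)] seg_cell[OF a(1)] seg_cell[OF a(2)]
    by (intro conjI exI[of _ "length a"]) auto
next
  assume r: ?R
  then obtain l where l: "s + l = m" "s' + l = m'" "m \<le> length w" "m' \<le> length w"
    "\<And>i. i < l \<Longrightarrow> cell w (s + i) = cell w (s' + i)" by auto
  have "take l (drop s w) = take l (drop s' w)"
  proof (rule nth_equalityI)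
    fix i assume "i < length (take l (drop s w))"
    then show "take l (drop s w) ! i = take l (drop s' w) ! i"
      using l by (auto simp: cell_def)
  qed (use l in auto)
  then show ?L using l by (intro exI[of _ "take l (drop s w)"]) (auto simp: seg_iff)
qed

lemma definable_copy: "definable (\<lambda>I e. \<exists>a. seg (word I) (e x) a (e y) \<and> seg (word I) (e x') a (e y'))"
proof (rule definable_cong)
  show "definable (\<lambda>I e. \<exists>l\<le>length (word I). e x + l = e y \<and> e x' + l = e y' \<and>
     (\<forall>i\<le>length (word I). i < l \<longrightarrow> (\<exists>p\<le>length (word I). \<exists>q\<le>length (word I).
       e x + i = p \<and> e x' + i = q \<and> cell (word I) p = cell (word I) q)))"
    by (intro definable_basic)
qed (auto simp: seg_copy)

text \<open>The guard 8 places \<open>e i\<close> inside the word, so the end of its token is a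
  position within range; the token at its own place is then compared with the given segment as a
  copy.\<close>

lemma definable_token:
  "definable (\<lambda>I e. cell (word I) (e i) = 8 \<and> seg (word I) (e x) (token (word I) (e i)) (e y))"
proof (rule definable_cong)
  show "definable (\<lambda>I e. cell (word I) (e i) = 8 \<and>
      (\<exists>s\<le>length (word I). \<exists>q\<le>length (word I). s = Suc (e i) \<and>
        (e i < q \<and> \<not> digit (cell (word I) q) \<and>
         (\<forall>r\<le>length (word I). e i < r \<and> r < q \<longrightarrow> digit (cell (word I) r))) \<and>
        (\<exists>a. seg (word I) (e x) a (e y) \<and> seg (word I) s a q)))"
    by (intro definable_basic definable_copy)
next
  fix I :: inst and e assume b: "bounded I e"
  let ?w = "word I"
  show "cell ?w (e i) = 8 \<and> seg ?w (e x) (token ?w (e i)) (e y) \<longleftrightarrow>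
      (cell ?w (e i) = 8 \<and>
      (\<exists>s\<le>length (word I). \<exists>q\<le>length (word I). s = Suc (e i) \<and>
        (e i < q \<and> \<not> digit (cell (word I) q) \<and>
         (\<forall>r\<le>length (word I). e i < r \<and> r < q \<longrightarrow> digit (cell (word I) r))) \<and>
        (\<exists>a. seg (word I) (e x) a (e y) \<and> seg (word I) s a q)))" (is "?L \<longleftrightarrow> ?R")
  proof (cases "cell ?w (e i) = 8")
    case True
    then have lt: "e i < length ?w" by (auto simp: cell_def split: if_splits)
    obtain q where q: "q \<le> length ?w" and sq: "seg ?w (Suc (e i)) (token ?w (e i)) q"
      using seg_token_ex[OF lt] by blast
    show ?thesis
    proof
      assume ?L
      then show ?R
        using lt q sq seg_token[OF lt, of q]
        by (intro conjI exI[of _ "Suc (e i)"] exI[of _ q] exI[of _ "token ?w (e i)"]) auto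
    next
      assume ?R
      then obtain q' a where q': "seg ?w (Suc (e i)) (token ?w (e i)) q'"
        "seg ?w (e x) a (e y)" "seg ?w (Suc (e i)) a q'"
        using seg_token[OF lt] by metis
      then have "a = token ?w (e i)" using seg_unique by metis
      then show ?L using True q' by simp
    qed
  qed simp
qed

section \<open>Time points\<close>

text \<open>\<open>apos\<close> and \<open>tpos\<close> are the positions of the two separators 7,
  in front of the codes of \<open>tin\<close> and \<open>tout\<close>.\<close>

definition apos :: "inst \<Rightarrow> nat" where "apos I = length (enc_facts (facts I))"
definition tpos :: "inst \<Rightarrow> nat" where
  "tpos I = Suc (length (enc_facts (facts I)) + length (unary_int (tin I)))"

lemma seg_tin: "seg (word I) (Suc (apos I)) (unary_int (tin I)) (tpos I)"
  unfolding seg_def word_eq apos_def tpos_def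
  by (intro exI[of _ "enc_facts (facts I) @ [7]"] exI[of _ "7 # unary_int (tout I)"]) auto

lemma seg_tout: "seg (word I) (Suc (tpos I)) (unary_int (tout I)) (length (word I))"
  unfolding seg_def word_eq tpos_def
  by (intro exI[of _ "enc_facts (facts I) @ 7 # unary_int (tin I) @ [7]"] exI[of _ "[]"]) auto

lemma cell_word_7: "cell (word I) p = 7 \<longleftrightarrow> p = apos I \<or> p = tpos I"
proof -
  have 7: "7 \<notin> set (enc_facts xs)" "7 \<notin> set (unary_int i)" for xs i
    using set_enc_facts[of xs] set_unary_int[of i] by auto
  have n7: "i < length xs \<Longrightarrow> 7 \<notin> set xs \<Longrightarrow> xs ! i \<noteq> 7" for xs :: "nat list" and i
    by (metis nth_mem)
  show ?thesis
    using n7[OF _ 7(1)[of "facts I"]] n7[OF _ 7(2)[of "tin I"]] n7[OF _ 7(2)[of "tout I"]]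
    by (auto simp: cell_def word_eq apos_def tpos_def nth_append nth_Cons split: nat.split if_splits)
qed

lemma positions: "apos I < tpos I" "tpos I < length (word I)"
  by (simp_all add: apos_def tpos_def word_eq)

lemma definable_tpos: "definable (\<lambda>I e. e x = tpos I)"
proof (rule definable_cong)
  show "definable (\<lambda>I e. cell (word I) (e x) = 7 \<and> (\<exists>y\<le>length (word I). y < e x \<and> cell (word I) y = 7))"
    by (intro definable_basic)
next
  fix I e
  show "(e x = tpos I) \<longleftrightarrow>
     cell (word I) (e x) = 7 \<and> (\<exists>y\<le>length (word I). y < e x \<and> cell (word I) y = 7)"
    using positions[of I] by (auto simp: cell_word_7 intro!: exI[of _ "apos I"])
qed

lemma definable_apos: "definable (\<lambda>I e. e x = apos I)"
proof (rule definable_cong[OF definable_conj[OF definable_sym[of x 7] definable_not[OF definable_tpos[of x]]]])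
  fix I e
  show "(e x = apos I) \<longleftrightarrow> cell (word I) (e x) = 7 \<and> e x \<noteq> tpos I"
    using positions(1)[of I] by (auto simp: cell_word_7)
qed

text \<open>The occurrence of \<open>\<tau>out\<close> at the end of the input serves as the yardstick against which
  the time points occurring in facts are measured.\<close>

lemma definable_copy_tout:
  "definable (\<lambda>I e. \<exists>a. seg (word I) (e x) a (e y) \<and> seg (word I) (Suc (tpos I)) a (e z))"
proof (rule definable_cong)
  show "definable (\<lambda>I e. \<exists>t\<le>length (word I). \<exists>s\<le>length (word I). t = tpos I \<and> s = Suc t \<and>
      (\<exists>a. seg (word I) (e x) a (e y) \<and> seg (word I) s a (e z)))"
    by (intro definable_basic definable_tpos definable_copy)
next
  fix I e
  show "(\<exists>a. seg (word I) (e x) a (e y) \<and> seg (word I) (Suc (tpos I)) a (e z)) \<longleftrightarrow>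
    (\<exists>t\<le>length (word I). \<exists>s\<le>length (word I). t = tpos I \<and> s = Suc t \<and>
      (\<exists>a. seg (word I) (e x) a (e y) \<and> seg (word I) s a (e z)))"
    using positions[of I] by auto
qed

lemma definable_seg_tout: "definable (\<lambda>I e. seg (word I) (e x) (unary_int (tout I)) (e y))"
proof (rule definable_cong)
  show "definable (\<lambda>I e. \<exists>z\<le>length (word I). z = length (word I) \<and>
      (\<exists>a. seg (word I) (e x) a (e y) \<and> seg (word I) (Suc (tpos I)) a z))"
    by (intro definable_basic definable_copy_tout)
next
  fix I e
  show "seg (word I) (e x) (unary_int (tout I)) (e y) \<longleftrightarrow>
     (\<exists>z\<le>length (word I). z = length (word I) \<and>
      (\<exists>a. seg (word I) (e x) a (e y) \<and> seg (word I) (Suc (tpos I)) a z))"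
    using seg_tout[of I] seg_unique by auto metis
qed

lemma definable_tout_eq: "definable (\<lambda>I e. tout I = c)"
proof (rule definable_cong)
  show "definable (\<lambda>I e. \<exists>t\<le>length (word I). \<exists>s\<le>length (word I). \<exists>m\<le>length (word I).
      t = tpos I \<and> s = Suc t \<and> m = length (word I) \<and> seg (word I) s (unary_int c) m)"
    by (intro definable_basic definable_tpos definable_seg_const)
next
  fix I and e :: "nat \<Rightarrow> nat"
  show "(tout I = c) \<longleftrightarrow> (\<exists>t\<le>length (word I). \<exists>s\<le>length (word I). \<exists>m\<le>length (word I).
      t = tpos I \<and> s = Suc t \<and> m = length (word I) \<and> seg (word I) s (unary_int c) m)"
    using seg_tout[of I] seg_unique positions[of I] by (auto simp: Suc_le_eq) (metis unary_int_inject)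
qed

lemma definable_tin_eq: "definable (\<lambda>I e. tin I = c)"
proof (rule definable_cong)
  show "definable (\<lambda>I e. \<exists>t\<le>length (word I). \<exists>s\<le>length (word I). \<exists>m\<le>length (word I).
      t = apos I \<and> s = Suc t \<and> m = tpos I \<and> seg (word I) s (unary_int c) m)"
    by (intro definable_basic definable_tpos definable_apos definable_seg_const)
next
  fix I and e :: "nat \<Rightarrow> nat"
  show "(tin I = c) \<longleftrightarrow> (\<exists>t\<le>length (word I). \<exists>s\<le>length (word I). \<exists>m\<le>length (word I).
      t = apos I \<and> s = Suc t \<and> m = tpos I \<and> seg (word I) s (unary_int c) m)"
    using seg_tin[of I] seg_unique positions[of I] by (auto simp: Suc_le_eq) (metis unary_int_inject)
qed

text \<open>The code of 0 is empty, and then the cell at \<open>s\<close> belongs to what follows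
  the segment; the second hypothesis ensures that this is no minus sign.\<close>

lemma seg_neg:
  assumes "seg w s (unary_int i) m" "i < 0 \<or> cell w m \<noteq> 4"
  shows "i < 0 \<longleftrightarrow> cell w s = 4"
proof (cases "i = 0")
  case True
  then show ?thesis using assms by (simp add: unary_int_def seg_Nil)
next
  case False
  then have "cell w (s + 0) = unary_int i ! 0"
    by (intro seg_cell[OF assms(1)]) (auto simp: unary_int_def)
  then show ?thesis using False by (auto simp: unary_int_def)
qed

lemma definable_tout_neg: "definable (\<lambda>I e. tout I < 0)"
proof (rule definable_cong)
  show "definable (\<lambda>I e. \<exists>t\<le>length (word I). \<exists>s\<le>length (word I).
      t = tpos I \<and> s = Suc t \<and> cell (word I) s = 4)"
    by (intro definable_basic definable_tpos)
next
  fix I and e :: "nat \<Rightarrow> nat"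
  show "(tout I < 0) \<longleftrightarrow> (\<exists>t\<le>length (word I). \<exists>s\<le>length (word I).
      t = tpos I \<and> s = Suc t \<and> cell (word I) s = 4)"
    using seg_neg[OF seg_tout[of I]] positions[of I] by (auto simp: Suc_le_eq cell_def)
qed

lemma definable_tin_neg: "definable (\<lambda>I e. tin I < 0)"
proof (rule definable_cong)
  show "definable (\<lambda>I e. \<exists>t\<le>length (word I). \<exists>s\<le>length (word I).
      t = apos I \<and> s = Suc t \<and> cell (word I) s = 4)"
    by (intro definable_basic definable_apos)
next
  fix I and e :: "nat \<Rightarrow> nat"
  have "cell (word I) (tpos I) \<noteq> 4" using cell_word_7[of I "tpos I"] by auto
  then show "(tin I < 0) \<longleftrightarrow> (\<exists>t\<le>length (word I). \<exists>s\<le>length (word I).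
      t = apos I \<and> s = Suc t \<and> cell (word I) s = 4)"
    using seg_neg[OF seg_tin[of I]] positions[of I] by (auto simp: Suc_le_eq)
qed

text \<open>Under \<open>\<bar>i\<bar> > \<bar>k\<bar>\<close> the sum \<open>i + k\<close> is
  nonzero and has the sign of \<open>i\<close>, so the shift only appends or removes ticks.
  Strictness matters: if the sum were 0, a negative \<open>i\<close> would lose its sign
  symbol.\<close>

lemma unary_int_shift:
  assumes "\<bar>i\<bar> > \<bar>k\<bar>"
  shows "(i < 0 \<longleftrightarrow> k < 0) \<Longrightarrow> unary_int (i + k) = unary_int i @ replicate (nat \<bar>k\<bar>) 3"
    and "(i < 0 \<longleftrightarrow> k \<ge> 0) \<Longrightarrow> unary_int i = unary_int (i + k) @ replicate (nat \<bar>k\<bar>) 3"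
proof -
  have r: "replicate (nat a) (3::nat) @ replicate (nat b) 3 = replicate (nat (a + b)) 3"
    if "a \<ge> 0" "b \<ge> 0" for a b
    using that by (simp add: replicate_add[symmetric] nat_add_distrib)
  show "unary_int (i + k) = unary_int i @ replicate (nat \<bar>k\<bar>) 3" if "i < 0 \<longleftrightarrow> k < 0"
    using assms that r[of "\<bar>i\<bar>" "\<bar>k\<bar>"] by (auto simp: unary_int_def abs_if split: if_splits)
  show "unary_int i = unary_int (i + k) @ replicate (nat \<bar>k\<bar>) 3" if "i < 0 \<longleftrightarrow> k \<ge> 0"
    using assms that r[of "\<bar>i + k\<bar>" "\<bar>k\<bar>"] by (auto simp: unary_int_def abs_if split: if_splits)
qed

text \<open>The finitely many values of \<open>tout\<close> between \<open>-\<bar>k\<bar>\<close>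
  and \<open>\<bar>k\<bar>\<close> are treated as constants. For the others, moving away from 0
  means a copy of \<open>tout\<close> followed by \<open>\<bar>k\<bar>\<close> ticks, and moving
  towards 0 means a copy of the code of \<open>tout\<close> without its last
  \<open>\<bar>k\<bar>\<close> ticks.\<close>

lemma definable_seg_tout_plus: "definable (\<lambda>I e. seg (word I) (e x) (unary_int (tout I + k)) (e y))"
proof (rule definable_cong)
  let ?r = "replicate (nat \<bar>k\<bar>) (3::nat)"
  show "definable (\<lambda>I e. (\<exists>j\<in>{-\<bar>k\<bar>..\<bar>k\<bar>}. tout I = j \<and> seg (word I) (e x) (unary_int (j + k)) (e y)) \<or>
     (\<forall>j\<in>{-\<bar>k\<bar>..\<bar>k\<bar>}. tout I \<noteq> j) \<and>
     ((tout I < 0 \<longleftrightarrow> k < 0) \<and>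
       (\<exists>z\<le>length (word I). seg (word I) (e x) (unary_int (tout I)) z \<and> seg (word I) z ?r (e y)) \<or>
      \<not> (tout I < 0 \<longleftrightarrow> k < 0) \<and>
       (\<exists>z\<le>length (word I). \<exists>m\<le>length (word I). m = length (word I) \<and> seg (word I) z ?r m \<and>
         (\<exists>a. seg (word I) (e x) a (e y) \<and> seg (word I) (Suc (tpos I)) a z))))"
    by (intro definable_basic definable_bex definable_ball definable_tout_eq definable_tout_neg definable_seg_const definable_seg_tout definable_copy_tout
        finite_atLeastAtMost_int)
next
  fix I :: inst and e
  let ?w = "word I" and ?r = "replicate (nat \<bar>k\<bar>) (3::nat)"
  let ?A = "\<exists>j\<in>{-\<bar>k\<bar>..\<bar>k\<bar>}. tout I = j \<and> seg ?w (e x) (unary_int (j + k)) (e y)"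
  let ?B = "\<exists>z\<le>length ?w. seg ?w (e x) (unary_int (tout I)) z \<and> seg ?w z ?r (e y)"
  let ?C = "\<exists>z\<le>length ?w. \<exists>m\<le>length ?w. m = length ?w \<and> seg ?w z ?r m \<and>
         (\<exists>a. seg ?w (e x) a (e y) \<and> seg ?w (Suc (tpos I)) a z)"
  show "seg ?w (e x) (unary_int (tout I + k)) (e y) \<longleftrightarrow>
    ?A \<or> (\<forall>j\<in>{-\<bar>k\<bar>..\<bar>k\<bar>}. tout I \<noteq> j) \<and>
     ((tout I < 0 \<longleftrightarrow> k < 0) \<and> ?B \<or> \<not> (tout I < 0 \<longleftrightarrow> k < 0) \<and> ?C)"
  proof (cases "\<bar>tout I\<bar> > \<bar>k\<bar>")
    case False
    then have "tout I \<in> {-\<bar>k\<bar>..\<bar>k\<bar>}" by auto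
    then show ?thesis by auto
  next
    case True
    then have out: "tout I \<notin> {-\<bar>k\<bar>..\<bar>k\<bar>}" by auto
    show ?thesis
    proof (cases "tout I < 0 \<longleftrightarrow> k < 0")
      case sign: True
      have "seg ?w (e x) (unary_int (tout I + k)) (e y) \<longleftrightarrow> ?B"
        unfolding unary_int_shift(1)[OF True sign] seg_append ..
      then show ?thesis using out sign by auto
    next
      case sign: False
      then have u: "unary_int (tout I) = unary_int (tout I + k) @ ?r"
        by (intro unary_int_shift(2)[OF True]) auto
      obtain z where z: "z \<le> length ?w" "seg ?w (Suc (tpos I)) (unary_int (tout I + k)) z"
        "seg ?w z ?r (length ?w)"
        using seg_tout[of I] unfolding u seg_append by blast
      have "seg ?w (e x) (unary_int (tout I + k)) (e y) \<longleftrightarrow> ?C"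
      proof
        assume ?C
        then obtain z' a where z': "seg ?w z' ?r (length ?w)" "seg ?w (e x) a (e y)"
          "seg ?w (Suc (tpos I)) a z'" by blast
        \<comment> \<open>Both blocks of ticks have the same length and end at the end of the
          word.\<close>
        have "z' = z" using segD[OF z'(1)] segD[OF z(3)] by simp
        then show "seg ?w (e x) (unary_int (tout I + k)) (e y)"
          using z' z seg_unique by metis
      qed (use z in auto)
      then show ?thesis using out sign by auto
    qed
  qed
qed

lemma definable_tin_eq_tout_plus: "definable (\<lambda>I e. tin I = tout I + k)"
proof (rule definable_cong)
  show "definable (\<lambda>I e. \<exists>t\<le>length (word I). \<exists>s\<le>length (word I). \<exists>m\<le>length (word I).
      t = apos I \<and> s = Suc t \<and> m = tpos I \<and> seg (word I) s (unary_int (tout I + k)) m)"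
    by (intro definable_basic definable_tpos definable_apos definable_seg_tout_plus)
next
  fix I and e :: "nat \<Rightarrow> nat"
  show "(tin I = tout I + k) \<longleftrightarrow> (\<exists>t\<le>length (word I). \<exists>s\<le>length (word I). \<exists>m\<le>length (word I).
      t = apos I \<and> s = Suc t \<and> m = tpos I \<and> seg (word I) s (unary_int (tout I + k)) m)"
    using seg_tin[of I] seg_unique positions[of I] by (auto simp: Suc_le_eq) (metis unary_int_inject)
qed

text \<open>The time points met when unfolding a connected query: offsets of \<open>\<tau>out\<close> and constants.\<close>

datatype stime = TRel int | TAbs int

fun tval :: "inst \<Rightarrow> stime \<Rightarrow> int" where
  "tval I (TRel k) = tout I + k"
| "tval I (TAbs c) = c"

fun tshift :: "int \<Rightarrow> stime \<Rightarrow> stime" where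
  "tshift d (TRel k) = TRel (k + d)"
| "tshift d (TAbs c) = TAbs (c + d)"

lemma tval_tshift [simp]: "tval I (tshift d t) = tval I t + d"
  by (cases t) auto

lemma definable_seg_time: "definable (\<lambda>I e. seg (word I) (e x) (unary_int (tval I t)) (e y))"
  by (cases t) (simp_all add: definable_seg_tout_plus definable_seg_const)

lemma definable_time_eq: "definable (\<lambda>I e. tval I t = tval I t')"
proof (cases t; cases t')
  fix k c assume "t = TRel k" "t' = TAbs c"
  then show ?thesis by (intro definable_cong[OF definable_tout_eq[of "c - k"]]) auto
next
  fix c k assume "t = TAbs c" "t' = TRel k"
  then show ?thesis by (intro definable_cong[OF definable_tout_eq[of "c - k"]]) auto
next
  fix k k' assume "t = TRel k" "t' = TRel k'"
  then show ?thesis using definable_const[of "k = k'"] by simp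
next
  fix k k' assume "t = TAbs k" "t' = TAbs k'"
  then show ?thesis using definable_const[of "k = k'"] by simp
qed

text \<open>Since \<open>tout I \<le> tin I\<close>, only the gaps from 0 to \<open>k - 1\<close>
  between the two can put \<open>tout I + k\<close> after \<open>tin I\<close>. Comparison with a
  constant is a sign test combined with finitely many equalities.\<close>

lemma definable_future: "definable (\<lambda>I e. tin I < tval I t)"
proof (cases t)
  case (TRel k)
  have "definable (\<lambda>I e. \<exists>j\<in>{0..<k}. tin I = tout I + j)"
    by (intro definable_bex definable_tin_eq_tout_plus) simp
  then show ?thesis
  proof (rule definable_cong)
    fix I e assume "valid I"
    then show "tin I < tval I t \<longleftrightarrow> (\<exists>j\<in>{0..<k}. tin I = tout I + j)"
      by (auto simp: TRel valid_def intro!: bexI[of _ "tin I - tout I"])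
  qed
next
  case (TAbs c)
  show ?thesis
  proof (cases "c \<ge> 0")
    case True
    have "definable (\<lambda>I e. tin I < 0 \<or> (\<exists>j\<in>{0..<c}. tin I = j))"
      by (intro definable_logic definable_bex definable_tin_eq definable_tin_neg) simp
    then show ?thesis by (rule definable_cong) (use True TAbs in auto)
  next
    case False
    have "definable (\<lambda>I e. tin I < 0 \<and> \<not> (\<exists>j\<in>{c..<0}. tin I = j))"
      by (intro definable_logic definable_bex definable_tin_eq definable_tin_neg) simp
    then show ?thesis by (rule definable_cong) (use False TAbs in auto)
  qed
qed

section \<open>Derivations\<close>

text \<open>\<open>X\<close> restricts the object variables only; time variables range over all
  integers. \<open>X = UNIV\<close> gives entailment, while for \<open>X = dom I\<close> each value
  of an object variable is denoted by a position or a constant.\<close>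

inductive_set der :: "program \<Rightarrow> gatom set \<Rightarrow> nat set \<Rightarrow> gatom set"
  for \<Pi> :: program and B :: "gatom set" and X :: "nat set" where
  base: "g \<in> B \<Longrightarrow> g \<in> der \<Pi> B X"
| rule: "r \<in> \<Pi> \<Longrightarrow> (\<And>x. \<sigma> x \<in> X) \<Longrightarrow> (\<And>a. a \<in> set (rbody r) \<Longrightarrow> eval_atom \<sigma> \<theta> a \<in> der \<Pi> B X)
    \<Longrightarrow> eval_atom \<sigma> \<theta> (rhead r) \<in> der \<Pi> B X"

lemma entails_iff_der: "entails \<Pi> D \<alpha> \<longleftrightarrow> \<alpha> \<in> der \<Pi> D UNIV"
proof
  have "\<forall>r\<in>\<Pi>. sat_rule (der \<Pi> D UNIV) r"
    by (auto simp: sat_rule_def intro: der.rule)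
  then show "entails \<Pi> D \<alpha> \<Longrightarrow> \<alpha> \<in> der \<Pi> D UNIV"
    unfolding entails_def by (metis der.base subsetI)
next
  assume "\<alpha> \<in> der \<Pi> D UNIV"
  then show "entails \<Pi> D \<alpha>"
  proof induction
    case (rule r \<sigma> \<theta>)
    then show ?case unfolding entails_def sat_rule_def by blast
  qed (auto simp: entails_def)
qed

lemma der_mono: "g \<in> der \<Pi> B X \<Longrightarrow> B \<subseteq> B' \<Longrightarrow> X \<subseteq> X' \<Longrightarrow> g \<in> der \<Pi> B' X'"
proof (induction rule: der.induct)
  case (rule r \<sigma> \<theta>)
  then show ?case by (intro der.rule) auto
qed (auto intro: der.base)

text \<open>Bodies are finite lists, so the finite sets chosen for the body atoms have a finite
  union.\<close>

lemma der_compact: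
  "g \<in> der \<Pi> (B \<union> F) X \<Longrightarrow> \<exists>U\<subseteq>F. finite U \<and> g \<in> der \<Pi> (B \<union> U) X"
proof (induction rule: der.induct)
  case (base g)
  then show ?case by (intro exI[of _ "{g} \<inter> F"]) (auto intro: der.base)
next
  case (rule r \<sigma> \<theta>)
  then have "\<forall>a\<in>set (rbody r). \<exists>U\<subseteq>F. finite U \<and> eval_atom \<sigma> \<theta> a \<in> der \<Pi> (B \<union> U) X" by blast
  then obtain U where U: "\<And>a. a \<in> set (rbody r) \<Longrightarrow>
      U a \<subseteq> F \<and> finite (U a) \<and> eval_atom \<sigma> \<theta> a \<in> der \<Pi> (B \<union> U a) X"
    by metis
  have "eval_atom \<sigma> \<theta> a \<in> der \<Pi> (B \<union> \<Union> (U ` set (rbody r))) X" if "a \<in> set (rbody r)" for a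
    using U[OF that] that by (auto elim!: der_mono)
  then have "eval_atom \<sigma> \<theta> (rhead r) \<in> der \<Pi> (B \<union> \<Union> (U ` set (rbody r))) X"
    using rule by (intro der.rule) auto
  then show ?case using U by (intro exI[of _ "\<Union> (U ` set (rbody r))"]) auto
qed

definition objects :: "gatom \<Rightarrow> nat set" where
  "objects g = {c. GO c \<in> set (gargs g)}"

definition consts_of :: "program \<Rightarrow> nat set" where
  "consts_of \<Pi> = (\<Union>r\<in>\<Pi>. \<Union>a\<in>insert (rhead r) (set (rbody r)). {c. OConst c \<in> set (aargs a)})"

lemma finite_consts_of: "finite \<Pi> \<Longrightarrow> finite (consts_of \<Pi>)"
proof -
  have "finite {c. OConst c \<in> set (aargs a)}" for a
    by (rule finite_subset[of _ "(\<lambda>t. case t of OConst c \<Rightarrow> c | _ \<Rightarrow> 0) ` set (aargs a)"]) force+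
  then show "finite \<Pi> \<Longrightarrow> finite (consts_of \<Pi>)" by (simp add: consts_of_def)
qed

text \<open>Head variables occur in the body, so a rule introduces no objects besides its constants.
  Applied to the history, this keeps \<open>star\<close> out of derived facts.\<close>

lemma der_objects:
  assumes "wf_program \<Pi>" "g \<in> der \<Pi> B X" "c \<in> objects g"
  shows "c \<in> consts_of \<Pi> \<union> (\<Union>g\<in>B. objects g)"
  using assms(2,3)
proof (induction arbitrary: c rule: der.induct)
  case (rule r \<sigma> \<theta>)
  then obtain t where t: "t \<in> set (aargs (rhead r))" "eval_trm \<sigma> \<theta> t = GO c"
    by (auto simp: objects_def eval_atom_def)
  from t(2) consider "t = OConst c" | x where "t = OVar x" "\<sigma> x = c" by (cases t) auto
  then show ?case
  proof cases
    case 1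
    then show ?thesis using t rule(1) by (auto simp: consts_of_def)
  next
    case 2
    have "wf_rule r" using assms(1) rule(1) by (simp add: wf_program_def)
    moreover have "x \<in> atom_ovars (rhead r)" using t 2 by (force simp: atom_ovars_def)
    ultimately obtain a s where a: "a \<in> set (rbody r)" "s \<in> set (aargs a)" "x \<in> trm_ovars s"
      by (auto simp: wf_rule_def body_ovars_def atom_ovars_def)
    then have "s = OVar x" by (cases s) auto
    then have "c \<in> objects (eval_atom \<sigma> \<theta> a)"
      using a 2 by (force simp: objects_def eval_atom_def)
    then show ?thesis using rule.IH a(1) by blast
  qed
qed auto

text \<open>Fixes the length of answer tuples, which therefore can be quantified by a fixed number
  of variables.\<close>

lemma der_sorts:
  assumes "wf_program \<Pi>" "\<And>g. g \<in> B \<Longrightarrow> fact g" "g \<in> der \<Pi> B X"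
  shows "map gval_sort (gargs g) = psig (gpred g)"
  using assms(3)
proof induction
  case (base g)
  then show ?case using assms(2) by (auto simp: fact_def)
next
  case (rule r \<sigma> \<theta>)
  have "gval_sort (eval_trm \<sigma> \<theta> t) = trm_sort t" for t by (cases t) auto
  moreover have "wf_rule r" using assms(1) rule(1) by (simp add: wf_program_def)
  ultimately show ?case by (auto simp: wf_rule_def wf_atom_def eval_atom_def comp_def)
qed

fun vmap :: "(nat \<Rightarrow> nat) \<Rightarrow> gval \<Rightarrow> gval" where
  "vmap h (GO c) = GO (h c)" | "vmap h (GT t) = GT t"

definition gmap :: "(nat \<Rightarrow> nat) \<Rightarrow> gatom \<Rightarrow> gatom" where
  "gmap h g = GAtom (gpred g) (map (vmap h) (gargs g))"

lemma gval_sort_vmap [simp]: "gval_sort (vmap h v) = gval_sort v"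
  by (cases v) auto

lemma gmap_id: "(\<And>c. c \<in> objects g \<Longrightarrow> h c = c) \<Longrightarrow> gmap h g = g"
proof -
  assume h: "\<And>c. c \<in> objects g \<Longrightarrow> h c = c"
  have "vmap h v = v" if "v \<in> set (gargs g)" for v
    using h that by (cases v) (auto simp: objects_def)
  then show ?thesis by (cases g) (simp add: gmap_def map_idI)
qed

lemma eval_atom_gmap:
  assumes "\<And>c. OConst c \<in> set (aargs a) \<Longrightarrow> h c = c"
  shows "eval_atom (h \<circ> \<sigma>) \<theta> a = gmap h (eval_atom \<sigma> \<theta> a)"
proof -
  have "eval_trm (h \<circ> \<sigma>) \<theta> t = vmap h (eval_trm \<sigma> \<theta> t)" if "t \<in> set (aargs a)" for t
    using assms that by (cases t) auto
  then show ?thesis by (simp add: eval_atom_def gmap_def)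
qed

text \<open>Composing assignments with \<open>h\<close> turns rule instances into rule instances and
  leaves time points alone. The new derivation uses only object values in the range of
  \<open>h\<close>, whatever the domain of the old one.\<close>

lemma der_homomorphism:
  assumes "\<And>c. c \<in> consts_of \<Pi> \<Longrightarrow> h c = c" "\<And>g. g \<in> B \<Longrightarrow> gmap h g \<in> B" "range h \<subseteq> X"
  shows "g \<in> der \<Pi> B Y \<Longrightarrow> gmap h g \<in> der \<Pi> B X"
proof (induction rule: der.induct)
  case (base g)
  then show ?case using assms(2) by (auto intro: der.base)
next
  case (rule r \<sigma> \<theta>)
  have e: "eval_atom (h \<circ> \<sigma>) \<theta> a = gmap h (eval_atom \<sigma> \<theta> a)"
    if "a \<in> insert (rhead r) (set (rbody r))" for a
    by (rule eval_atom_gmap) (use assms(1) rule(1) that in \<open>auto simp: consts_of_def\<close>)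
  have "eval_atom (h \<circ> \<sigma>) \<theta> (rhead r) \<in> der \<Pi> B X"
    using rule assms(3) by (intro der.rule) (auto simp: e)
  then show ?case by (simp add: e)
qed

definition future :: "int \<Rightarrow> gatom set" where
  "future \<tau> = {g. fact g \<and> \<not> pidb (gpred g) \<and> temporal (gpred g) \<and>
     (\<exists>t. last (gargs g) = GT t \<and> \<tau> < t)}"

lemma update_iff: "update \<tau> U \<longleftrightarrow> finite U \<and> U \<subseteq> future \<tau>"
  by (auto simp: update_def dataset_def future_def)

lemma future_gmap: "g \<in> future \<tau> \<Longrightarrow> gmap h g \<in> future \<tau>"
proof -
  assume g: "g \<in> future \<tau>"
  then have "gargs g \<noteq> []" by (auto simp: future_def fact_def temporal_def)
  then have "last (map (vmap h) (gargs g)) = vmap h (last (gargs g))" by (rule last_map)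
  then show ?thesis using g by (auto simp: future_def fact_def gmap_def comp_def)
qed

lemma DTP_iff:
  "DTP (P, \<Pi>) D \<tau>in \<tau>out \<longleftrightarrow>
    (\<forall>os. GAtom P (map GO os @ [GT \<tau>out]) \<in> der \<Pi> (D \<union> future \<tau>in) UNIV \<longrightarrow>
      GAtom P (map GO os @ [GT \<tau>out]) \<in> der \<Pi> D UNIV)" (is "_ \<longleftrightarrow> ?R")
proof
  assume dtp: "DTP (P, \<Pi>) D \<tau>in \<tau>out"
  show ?R
  proof (intro allI impI)
    fix os assume "GAtom P (map GO os @ [GT \<tau>out]) \<in> der \<Pi> (D \<union> future \<tau>in) UNIV"
    then obtain U where "U \<subseteq> future \<tau>in" "finite U"
      "GAtom P (map GO os @ [GT \<tau>out]) \<in> der \<Pi> (D \<union> U) UNIV"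
      using der_compact by metis
    then show "GAtom P (map GO os @ [GT \<tau>out]) \<in> der \<Pi> D UNIV"
      using dtp unfolding DTP_def answers_def update_iff entails_iff_der by auto
  qed
next
  assume r: ?R
  show "DTP (P, \<Pi>) D \<tau>in \<tau>out"
    unfolding DTP_def answers_def update_iff entails_iff_der
  proof (intro allI impI, elim conjE)
    fix U assume U: "U \<subseteq> future \<tau>in"
    have "g \<in> der \<Pi> D UNIV \<Longrightarrow> g \<in> der \<Pi> (D \<union> U) UNIV" for g by (rule der_mono) auto
    moreover have "g \<in> der \<Pi> (D \<union> U) UNIV \<Longrightarrow> g \<in> der \<Pi> (D \<union> future \<tau>in) UNIV" for g
      by (rule der_mono) (use U in auto)
    ultimately show "{os. GAtom (fst (P, \<Pi>)) (map GO os @ [GT \<tau>out]) \<in> der (snd (P, \<Pi>)) D UNIV} =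
       {os. GAtom (fst (P, \<Pi>)) (map GO os @ [GT \<tau>out]) \<in> der (snd (P, \<Pi>)) (D \<union> U) UNIV}"
      using r by auto
  qed
qed

section \<open>Objects as positions\<close>

definition adom :: "inst \<Rightarrow> nat set" where
  "adom I = (\<Union>g\<in>set (facts I). objects g)"

lemma finite_adom: "finite (adom I)"
proof -
  have "finite (objects g)" for g
    unfolding objects_def
    by (rule finite_subset[of _ "(\<lambda>v. case v of GO c \<Rightarrow> c | _ \<Rightarrow> 0) ` set (gargs g)"]) force+
  then show ?thesis by (simp add: adom_def)
qed

lemma token_object:
  assumes "cell (word I) p = 8"
  shows "\<exists>c\<in>adom I. token (word I) p = bin c"
proof -
  let ?r = "7 # unary_int (tin I) @ 7 # unary_int (tout I)"
  have p: "p < length (word I)" using assms by (auto simp: cell_def split: if_splits)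
  have w: "enc_facts (facts I) @ ?r = take p (word I) @ 8 # drop (Suc p) (word I)"
    using id_take_nth_drop[OF p] assms p by (simp add: cell_def word_eq[symmetric])
  have "8 \<notin> set ?r" using set_unary_int[of "tin I"] set_unary_int[of "tout I"] by auto
  from enc_facts_object[OF this w] obtain g c y v'
    where g: "g \<in> set (facts I)" "GO c \<in> set (gargs g)" and
      v: "drop (Suc p) (word I) = bin c @ y # v'" "y \<in> {5, 6}" by blast
  have "token (word I) p = token (take p (word I) @ 8 # bin c @ y # v') (length (take p (word I)))"
    using w v p by (simp add: word_eq[symmetric])
  also have "\<dots> = bin c" by (rule token_eq[OF v(2)])
  finally show ?thesis using g by (auto simp: adom_def objects_def)
qed

lemma object_token:
  assumes "c \<in> adom I"
  shows "\<exists>p\<le>length (word I). cell (word I) p = 8 \<and> token (word I) p = bin c"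
proof -
  obtain g where "g \<in> set (facts I)" "GO c \<in> set (gargs g)"
    using assms by (auto simp: adom_def objects_def)
  from object_in_enc_facts[OF this] obtain u y v
    where w: "word I = u @ 8 # bin c @ y # v" "y \<in> {5, 6}" unfolding word_eq by blast
  then show ?thesis
    using token_eq[OF w(2), of u c v] by (intro exI[of _ "length u"]) (auto simp: cell_def)
qed

text \<open>An object variable of a rule ranges over the constants of the program and over positions:
  a position with symbol 8 stands for the object written behind it, any other position for one
  object \<open>star\<close> occurring neither in the data nor in the program.\<close>

datatype oterm = OV nat | OC nat
datatype sval = SO oterm | ST stime

fun olift :: "oterm \<Rightarrow> oterm" where
  "olift (OV i) = OV (Suc i)" | "olift (OC c) = OC c"

fun slift :: "sval \<Rightarrow> sval" where
  "slift (SO t) = SO (olift t)" | "slift (ST t) = ST t"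

locale constants =
  fixes C :: "nat set"
  assumes finite_C: "finite C"
begin

definition star :: "inst \<Rightarrow> nat" where
  "star I = (SOME c. c \<notin> C \<union> adom I)"

lemma star: "star I \<notin> C" "star I \<notin> adom I"
proof -
  have "\<exists>c. c \<notin> C \<union> adom I"
    by (rule ex_new_if_finite) (auto simp: finite_C finite_adom)
  then have "star I \<notin> C \<union> adom I" unfolding star_def by (rule someI_ex)
  then show "star I \<notin> C" "star I \<notin> adom I" by auto
qed

definition object :: "inst \<Rightarrow> nat \<Rightarrow> nat" where
  "object I p = (if cell (word I) p = 8 then THE c. bin c = token (word I) p else star I)"

lemma object_eq: "cell (word I) p = 8 \<Longrightarrow> token (word I) p = bin c \<Longrightarrow> object I p = c"
  by (auto simp: object_def)

lemma bin_object: "cell (word I) p = 8 \<Longrightarrow> bin (object I p) = token (word I) p \<and> object I p \<in> adom I"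
  using token_object object_eq by metis

definition dom :: "inst \<Rightarrow> nat set" where
  "dom I = object I ` {..length (word I)} \<union> C"

lemma C_dom: "c \<in> C \<Longrightarrow> c \<in> dom I"
  by (simp add: dom_def)

lemma adom_dom: "c \<in> adom I \<Longrightarrow> c \<in> dom I"
  using object_token[of c I] object_eq unfolding dom_def by fastforce

lemma bex_dom: "(\<exists>d\<in>dom I. F d) \<longleftrightarrow> (\<exists>v\<le>length (word I). F (object I v)) \<or> (\<exists>c\<in>C. F c)"
  by (auto simp: dom_def)

text \<open>The position behind the word reads blank, so at least one position never carries an
  object marker.\<close>

lemma star_dom: "star I \<in> dom I"
proof -
  have "object I (length (word I)) = star I" by (simp add: object_def cell_def)
  then show ?thesis unfolding dom_def by force
qed

fun oval :: "inst \<Rightarrow> (nat \<Rightarrow> nat) \<Rightarrow> oterm \<Rightarrow> nat" where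
  "oval I e (OV i) = object I (e i)" | "oval I e (OC c) = c"

fun ook :: "oterm \<Rightarrow> bool" where
  "ook (OV i) = True" | "ook (OC c) = (c \<in> C)"

fun sval :: "inst \<Rightarrow> (nat \<Rightarrow> nat) \<Rightarrow> sval \<Rightarrow> gval" where
  "sval I e (SO t) = GO (oval I e t)" | "sval I e (ST t) = GT (tval I t)"

fun sok :: "sval \<Rightarrow> bool" where
  "sok (SO t) = ook t" | "sok (ST t) = True"

lemma oval_olift [simp]: "oval I e (olift t) = oval I (\<lambda>i. e (Suc i)) t"
  by (cases t) auto

lemma sval_slift [simp]: "sval I e (slift s) = sval I (\<lambda>i. e (Suc i)) s"
  by (cases s) auto

lemma ook_olift [simp]: "ook (olift t) = ook t"
  by (cases t) auto

lemma sok_slift [simp]: "sok (slift s) = sok s"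
  by (cases s) auto

text \<open>A position without marker denotes \<open>star\<close>, which is outside \<open>C\<close>
  and thus different from \<open>c\<close>; at a marker the token is compared with the fixed word
  \<open>bin c\<close>.\<close>

lemma definable_object_const: "c \<in> C \<Longrightarrow> definable (\<lambda>I e. object I (e i) = c)"
proof (rule definable_cong)
  show "definable (\<lambda>I e. \<exists>s\<le>length (word I). \<exists>q\<le>length (word I). s = Suc (e i) \<and>
      (cell (word I) (e i) = 8 \<and> seg (word I) s (token (word I) (e i)) q) \<and>
      seg (word I) s (bin c) q)"
    by (intro definable_basic definable_token definable_seg_const)
next
  fix I :: inst and e :: "nat \<Rightarrow> nat"
  assume c: "c \<in> C"
  show "object I (e i) = c \<longleftrightarrow> (\<exists>s\<le>length (word I). \<exists>q\<le>length (word I). s = Suc (e i) \<and>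
      (cell (word I) (e i) = 8 \<and> seg (word I) s (token (word I) (e i)) q) \<and>
      seg (word I) s (bin c) q)" (is "_ \<longleftrightarrow> ?R")
  proof (cases "cell (word I) (e i) = 8")
    case True
    then have lt: "e i < length (word I)" by (auto simp: cell_def split: if_splits)
    obtain q where q: "q \<le> length (word I)" "seg (word I) (Suc (e i)) (token (word I) (e i)) q"
      using seg_token_ex[OF lt] by blast
    show ?thesis
    proof
      assume "object I (e i) = c"
      then have "token (word I) (e i) = bin c" using bin_object[OF True] by simp
      then show ?R using q lt True by (intro exI[of _ "Suc (e i)"] exI[of _ q]) auto
    next
      assume ?R
      then have "token (word I) (e i) = bin c" using seg_unique by blast
      then show "object I (e i) = c" using object_eq True by simp
    qed
  next
    case False
    then show ?thesis using star(1) c by (auto simp: object_def)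
  qed
qed

text \<open>Two positions without marker both denote \<open>star\<close>; a position with and one
  without differ because \<open>star\<close> is not in the data; at two markers the tokens must
  agree, since \<open>bin\<close> is injective.\<close>

lemma definable_object_eq: "definable (\<lambda>I e. object I (e i) = object I (e j))"
proof (rule definable_cong)
  show "definable (\<lambda>I e. \<not> cell (word I) (e i) = 8 \<and> \<not> cell (word I) (e j) = 8 \<or>
     (\<exists>s\<le>length (word I). \<exists>q\<le>length (word I). s = Suc (e i) \<and>
      (cell (word I) (e i) = 8 \<and> seg (word I) s (token (word I) (e i)) q) \<and>
      (cell (word I) (e j) = 8 \<and> seg (word I) s (token (word I) (e j)) q)))"
    by (intro definable_basic definable_token)
next
  fix I :: inst and e :: "nat \<Rightarrow> nat"
  let ?P = "\<exists>s\<le>length (word I). \<exists>q\<le>length (word I). s = Suc (e i) \<and>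
      (cell (word I) (e i) = 8 \<and> seg (word I) s (token (word I) (e i)) q) \<and>
      (cell (word I) (e j) = 8 \<and> seg (word I) s (token (word I) (e j)) q)"
  have ne: "object I p \<noteq> object I p'" if "cell (word I) p = 8" "cell (word I) p' \<noteq> 8" for p p'
  proof -
    have "object I p \<in> adom I" "object I p' = star I"
      using bin_object[OF that(1)] that(2) by (auto simp: object_def)
    then show ?thesis using star(2)[of I] by metis
  qed
  show "object I (e i) = object I (e j) \<longleftrightarrow>
    \<not> cell (word I) (e i) = 8 \<and> \<not> cell (word I) (e j) = 8 \<or> ?P"
  proof (cases "cell (word I) (e i) = 8 \<and> cell (word I) (e j) = 8")
    case True
    then have lt: "e i < length (word I)" by (auto simp: cell_def split: if_splits)
    obtain q where q: "q \<le> length (word I)" "seg (word I) (Suc (e i)) (token (word I) (e i)) q"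
      using seg_token_ex[OF lt] by blast
    have "object I (e i) = object I (e j) \<longleftrightarrow> token (word I) (e i) = token (word I) (e j)"
      using True bin_object by (metis bin_inject)
    also have "\<dots> \<longleftrightarrow> ?P"
    proof
      assume "token (word I) (e i) = token (word I) (e j)"
      then show ?P using q lt True by (intro exI[of _ "Suc (e i)"] exI[of _ q]) auto
    qed (use seg_unique in blast)
    finally show ?thesis using True by simp
  next
    case False
    then show ?thesis using ne[of "e i" "e j"] ne[of "e j" "e i"] by (auto simp: object_def)
  qed
qed

lemma definable_sval_eq: "sok s \<Longrightarrow> sok s' \<Longrightarrow> definable (\<lambda>I e. sval I e s = sval I e s')"
proof (cases s; cases s')
  fix t t' assume s: "s = SO t" "s' = SO t'" "sok s" "sok s'"
  have "definable (\<lambda>I e. oval I e t = oval I e t')"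
  proof (cases t; cases t')
    fix i c assume "t = OC c" "t' = OV i"
    then show ?thesis using definable_object_const[of c i] s by (simp add: eq_commute)
  qed (use s definable_object_const definable_object_eq definable_const in simp_all)
  then show ?thesis using s by simp
next
  fix t t' assume "s = ST t" "s' = ST t'"
  then show ?thesis using definable_time_eq[of t t'] by simp
qed (use definable_const[of False] in simp_all)

lemma definable_svals_eq:
  "list_all sok ss \<Longrightarrow> list_all sok ss' \<Longrightarrow> definable (\<lambda>I e. map (sval I e) ss = map (sval I e) ss')"
proof (induction ss arbitrary: ss')
  case Nil
  then show ?case using definable_const[of "ss' = []"] by simp
next
  case (Cons s ss)
  show ?case
  proof (cases ss')
    case Nil
    then show ?thesis using definable_const[of False] by simp
  next
    case (Cons s' ss'')
    then show ?thesis using Cons.IH[of ss''] Cons.prems by (auto intro: definable_conj definable_sval_eq)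
  qed
qed

text \<open>Rules out variables that stand for \<open>star\<close>, whose name cannot be copied from
  the word. For the remaining symbolic values \<open>senc\<close> is the code to search for.\<close>

fun real :: "inst \<Rightarrow> (nat \<Rightarrow> nat) \<Rightarrow> sval \<Rightarrow> bool" where
  "real I e (SO (OV i)) = (cell (word I) (e i) = 8)" | "real I e _ = True"

fun senc :: "inst \<Rightarrow> (nat \<Rightarrow> nat) \<Rightarrow> sval \<Rightarrow> nat list" where
  "senc I e (SO (OV i)) = 8 # token (word I) (e i)"
| "senc I e (SO (OC c)) = 8 # bin c"
| "senc I e (ST t) = 9 # unary_int (tval I t)"

lemma senc_eq: "real I e s \<Longrightarrow> senc I e s = enc_gval (sval I e s)"
proof (induction I e s rule: real.induct)
  case (1 I e i)
  then show ?case using bin_object[of I "e i"] by simp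
qed auto

text \<open>Stated with an arbitrary renaming \<open>f\<close> so that the lemma applies under quantifiers.\<close>

lemma definable_senc: "definable (\<lambda>I e. real I (\<lambda>i. e (f i)) s \<and> seg (word I) (e x) (senc I (\<lambda>i. e (f i)) s) (e y))"
proof (cases s)
  case (SO t)
  show ?thesis
  proof (cases t)
    case (OV i)
    have "definable (\<lambda>I e. \<exists>k\<le>length (word I). k = Suc (e x) \<and> cell (word I) (e x) = 8 \<and>
        (cell (word I) (e (f i)) = 8 \<and> seg (word I) k (token (word I) (e (f i))) (e y)))"
      by (intro definable_basic definable_token)
    then show ?thesis by (rule definable_cong) (auto simp: SO OV seg_Cons)
  next
    case (OC c)
    then show ?thesis using SO definable_seg_const[of x "8 # bin c" y] by simp
  qed
next
  case (ST t)
  have "definable (\<lambda>I e. \<exists>k\<le>length (word I). k = Suc (e x) \<and> cell (word I) (e x) = 9 \<and>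
      seg (word I) k (unary_int (tval I t)) (e y))"
    by (intro definable_basic definable_seg_time)
  then show ?thesis by (rule definable_cong) (auto simp: ST seg_Cons)
qed

lemma definable_sencs:
  "definable (\<lambda>I e. (\<forall>s\<in>set ss. real I (\<lambda>i. e (f i)) s) \<and>
     seg (word I) (e x) (concat (map (\<lambda>s. 5 # senc I (\<lambda>i. e (f i)) s) ss)) (e y))"
proof (induction ss arbitrary: x f y)
  case Nil
  show ?case using definable_seg_const[of x "[]" y] by simp
next
  case (Cons s ss)
  have "definable (\<lambda>I e. \<exists>k\<le>length (word I). \<exists>l\<le>length (word I). k = Suc (e x) \<and>
      cell (word I) (e x) = 5 \<and>
      (real I (\<lambda>i. e (f i)) s \<and> seg (word I) k (senc I (\<lambda>i. e (f i)) s) l) \<and>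
      ((\<forall>s\<in>set ss. real I (\<lambda>i. e (f i)) s) \<and>
       seg (word I) l (concat (map (\<lambda>s. 5 # senc I (\<lambda>i. e (f i)) s) ss)) (e y)))"
    by (intro definable_basic definable_senc Cons)
  then show ?case by (rule definable_cong) (auto simp: seg_Cons seg_append)
qed

text \<open>\<open>fact_lookup\<close> turns membership into a search for the code behind a 6 or at
  the start, the code being assembled from constant words, copied tokens and time codes.\<close>

lemma definable_fact: "definable (\<lambda>I e. GAtom P (map (sval I e) ss) \<in> set (facts I))"
proof (rule definable_cong)
  show "definable (\<lambda>I e. \<exists>s\<le>length (word I). \<exists>a\<le>length (word I). \<exists>b\<le>length (word I). \<exists>m\<le>length (word I).
      (s = 0 \<or> (\<exists>p\<le>length (word I). s = Suc p \<and> cell (word I) p = 6)) \<and>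
      seg (word I) s (enc_pred P) a \<and>
      ((\<forall>s\<in>set ss. real I (\<lambda>i. e i) s) \<and>
       seg (word I) a (concat (map (\<lambda>s. 5 # senc I (\<lambda>i. e i) s) ss)) b) \<and>
      seg (word I) b [6] m)"
    by (intro definable_basic definable_seg_const definable_sencs)
next
  fix I :: inst and e :: "nat \<Rightarrow> nat"
  let ?g = "GAtom P (map (sval I e) ss)" and ?w = "word I"
  let ?R = "\<exists>s\<le>length (word I). \<exists>a\<le>length (word I). \<exists>b\<le>length (word I). \<exists>m\<le>length (word I).
      (s = 0 \<or> (\<exists>p\<le>length (word I). s = Suc p \<and> cell (word I) p = 6)) \<and>
      seg (word I) s (enc_pred P) a \<and>
      ((\<forall>s\<in>set ss. real I (\<lambda>i. e i) s) \<and>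
       seg (word I) a (concat (map (\<lambda>s. 5 # senc I (\<lambda>i. e i) s) ss)) b) \<and>
      seg (word I) b [6] m"
  show "?g \<in> set (facts I) \<longleftrightarrow> ?R"
  proof (cases "\<forall>s\<in>set ss. real I e s")
    case True
    have "concat (map (\<lambda>s. 5 # senc I e s) ss) = enc_args (map (sval I e) ss)"
      using True unfolding enc_args_def by (simp add: comp_def senc_eq cong: map_cong)
    then have enc: "enc_fact ?g = enc_pred P @ concat (map (\<lambda>s. 5 # senc I e s) ss) @ [6]"
      by (simp add: enc_fact_eq)
    have 6: "6 \<notin> set (7 # unary_int (tin I) @ 7 # unary_int (tout I))"
      using set_unary_int[of "tin I"] set_unary_int[of "tout I"] by auto
    have "?g \<in> set (facts I) \<longleftrightarrow> (\<exists>s m. (s = 0 \<or> cell ?w (s - 1) = 6) \<and> seg ?w s (enc_fact ?g) m)"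
      using fact_lookup[OF 6, of ?g "facts I"] by (simp add: word_eq)
    also have "\<dots> \<longleftrightarrow> (\<exists>s\<le>length ?w. \<exists>m\<le>length ?w.
        (s = 0 \<or> (\<exists>p\<le>length ?w. s = Suc p \<and> cell ?w p = 6)) \<and> seg ?w s (enc_fact ?g) m)"
    proof -
      have le: "s \<le> length ?w" "m \<le> length ?w" if "seg ?w s (enc_fact ?g) m" for s m
        using segD[OF that] by simp_all
      have start: "(s = 0 \<or> cell ?w (s - 1) = 6) \<longleftrightarrow>
          (s = 0 \<or> (\<exists>p\<le>length ?w. s = Suc p \<and> cell ?w p = 6))" if "s \<le> length ?w" for s
        using that by (cases s) auto
      show ?thesis
      proof
        assume "\<exists>s m. (s = 0 \<or> cell ?w (s - 1) = 6) \<and> seg ?w s (enc_fact ?g) m"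
        then obtain s m where "s = 0 \<or> cell ?w (s - 1) = 6" "seg ?w s (enc_fact ?g) m" by blast
        then show "\<exists>s\<le>length ?w. \<exists>m\<le>length ?w.
            (s = 0 \<or> (\<exists>p\<le>length ?w. s = Suc p \<and> cell ?w p = 6)) \<and> seg ?w s (enc_fact ?g) m"
          using le[of s m] start[of s] by (intro exI[of _ s] exI[of _ m] conjI) simp_all
      next
        assume "\<exists>s\<le>length ?w. \<exists>m\<le>length ?w.
            (s = 0 \<or> (\<exists>p\<le>length ?w. s = Suc p \<and> cell ?w p = 6)) \<and> seg ?w s (enc_fact ?g) m"
        then obtain s m where "s \<le> length ?w"
          "s = 0 \<or> (\<exists>p\<le>length ?w. s = Suc p \<and> cell ?w p = 6)" "seg ?w s (enc_fact ?g) m" by blast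
        then show "\<exists>s m. (s = 0 \<or> cell ?w (s - 1) = 6) \<and> seg ?w s (enc_fact ?g) m"
          using start[of s] by (intro exI[of _ s] exI[of _ m] conjI) simp_all
      qed
    qed
    also have "\<dots> \<longleftrightarrow> ?R"
      unfolding enc seg_append using True by blast
    finally show ?thesis .
  next
    case False
    \<comment> \<open>A position without marker denotes \<open>star\<close>, which occurs in no fact
      of the data, so both sides are false.\<close>
    then obtain i where i: "SO (OV i) \<in> set ss" "cell ?w (e i) \<noteq> 8"
      by (metis real.elims(3))
    then have "GO (star I) \<in> set (gargs ?g)" by (force simp: object_def)
    then have "?g \<notin> set (facts I)" using star(2)[of I] by (auto simp: adom_def objects_def)
    then show ?thesis using False by auto
  qed
qed

fun ssort :: "sval \<Rightarrow> sort" where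
  "ssort (SO t) = SObj" | "ssort (ST t) = STime"

lemma gval_sort_sval [simp]: "gval_sort (sval I e s) = ssort s"
  by (cases s) auto

text \<open>Predicate and sorts of the symbolic values do not vary with the instance; what varies is
  only the comparison of the last time point with \<open>tin I\<close>.\<close>

lemma definable_in_future: "definable (\<lambda>I e. GAtom P (map (sval I e) ss) \<in> future (tin I))"
proof (cases "map ssort ss = psig P \<and> \<not> pidb P \<and> temporal P")
  case True
  then have ne: "ss \<noteq> []" by (auto simp: temporal_def)
  have "ssort (last ss) = STime"
    using True ne by (metis last_map temporal_def)
  then obtain t where t: "last ss = ST t" by (cases "last ss") auto
  show ?thesis
    by (rule definable_cong[OF definable_future[of t]]) (use True ne t in \<open>auto simp: future_def fact_def comp_def last_map\<close>)
next
  case False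
  show ?thesis
    by (rule definable_cong[OF definable_const[of False]]) (use False in \<open>auto simp: future_def fact_def comp_def\<close>)
qed

definition base :: "bool \<Rightarrow> inst \<Rightarrow> gatom set" where
  "base b I = set (facts I) \<union> (if b then future (tin I) else {})"

lemma definable_in_base: "definable (\<lambda>I e. GAtom P (map (sval I e) ss) \<in> base b I)"
  using definable_disj[OF definable_fact definable_in_future, of P ss P ss] definable_fact[of P ss] by (cases b) (simp_all add: base_def)

text \<open>One variable after the other is replaced by a position (a new quantifier, under which
  all symbolic values are lifted) or by a constant (a finite disjunction). \<open>M\<close> sees the
  environment only through the values of \<open>ss\<close> and the assignment, so lifting these
  suffices.\<close>

lemma definable_exists_assignment:
  fixes M :: "inst \<Rightarrow> gval list \<Rightarrow> (nat \<Rightarrow> nat) \<Rightarrow> bool"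
  assumes M: "\<And>\<sigma>s ss. (\<And>x. ook (\<sigma>s x)) \<Longrightarrow> list_all sok ss \<Longrightarrow>
      definable (\<lambda>I e. M I (map (sval I e) ss) (\<lambda>x. oval I e (\<sigma>s x)))"
  shows "(\<And>x. ook (\<sigma>s x)) \<Longrightarrow> list_all sok ss \<Longrightarrow>
    definable (\<lambda>I e. \<exists>\<sigma>. (\<forall>x\<in>set xs. \<sigma> x \<in> dom I) \<and> (\<forall>x. x \<notin> set xs \<longrightarrow> \<sigma> x = oval I e (\<sigma>s x)) \<and>
      M I (map (sval I e) ss) \<sigma>)"
proof (induction xs arbitrary: \<sigma>s ss)
  case Nil
  have "(\<exists>\<sigma>. (\<forall>x. \<sigma> x = f x) \<and> M I gs \<sigma>) \<longleftrightarrow> M I gs f" for I gs and f :: "nat \<Rightarrow> nat"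
    by (metis ext)
  then show ?case using M[OF Nil] by simp
next
  case (Cons y xs)
  let ?R = "\<lambda>I gs f. \<exists>\<sigma>. (\<forall>x\<in>set xs. \<sigma> x \<in> dom I) \<and> (\<forall>x. x \<notin> set xs \<longrightarrow> \<sigma> x = f x) \<and> M I gs \<sigma>"
  have 1: "definable (\<lambda>I e. \<exists>v\<le>length (word I).
      ?R I (map (sval I e) ss) (\<lambda>x. if x = y then object I v else oval I e (\<sigma>s x)))"
  proof (rule definable_ex)
    have "definable (\<lambda>I e. ?R I (map (sval I e) (map slift ss))
        (\<lambda>x. oval I e (if x = y then OV 0 else olift (\<sigma>s x))))"
      by (rule Cons.IH) (use Cons.prems in \<open>auto simp: list_all_iff\<close>)
    moreover have "oval I e (if x = y then OV 0 else olift (\<sigma>s x)) =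
        (if x = y then object I (e 0) else oval I (\<lambda>i. e (Suc i)) (\<sigma>s x))" for I e x
      by simp
    ultimately show "definable (\<lambda>I e. ?R I (map (sval I (\<lambda>i. e (Suc i))) ss)
       (\<lambda>x. if x = y then object I (e 0) else oval I (\<lambda>i. e (Suc i)) (\<sigma>s x)))"
      by (simp only: map_map comp_def sval_slift)
  qed
  have 2: "definable (\<lambda>I e. \<exists>c\<in>C.
      ?R I (map (sval I e) ss) (\<lambda>x. if x = y then c else oval I e (\<sigma>s x)))"
  proof (rule definable_bex[OF finite_C])
    fix c assume "c \<in> C"
    then have "definable (\<lambda>I e. ?R I (map (sval I e) ss)
        (\<lambda>x. oval I e (if x = y then OC c else \<sigma>s x)))"
      by (intro Cons.IH) (use Cons.prems in auto)
    moreover have "oval I e (if x = y then OC c else \<sigma>s x) =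
        (if x = y then c else oval I e (\<sigma>s x))" for I e x
      by simp
    ultimately show "definable (\<lambda>I e. ?R I (map (sval I e) ss)
        (\<lambda>x. if x = y then c else oval I e (\<sigma>s x)))"
      by (simp only:)
  qed
  have split: "(\<exists>\<sigma>. (\<forall>x\<in>set (y # xs). \<sigma> x \<in> dom I) \<and> (\<forall>x. x \<notin> set (y # xs) \<longrightarrow> \<sigma> x = f x) \<and> M I gs \<sigma>)
      \<longleftrightarrow> (\<exists>d\<in>dom I. ?R I gs (\<lambda>x. if x = y then d else f x))" for I gs f
  proof
    assume "\<exists>\<sigma>. (\<forall>x\<in>set (y # xs). \<sigma> x \<in> dom I) \<and> (\<forall>x. x \<notin> set (y # xs) \<longrightarrow> \<sigma> x = f x) \<and> M I gs \<sigma>"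
    then obtain \<sigma> where "\<forall>x\<in>set (y # xs). \<sigma> x \<in> dom I" "\<forall>x. x \<notin> set (y # xs) \<longrightarrow> \<sigma> x = f x" "M I gs \<sigma>"
      by blast
    then show "\<exists>d\<in>dom I. ?R I gs (\<lambda>x. if x = y then d else f x)"
      by (intro bexI[of _ "\<sigma> y"] exI[of _ \<sigma>]) auto
  next
    assume "\<exists>d\<in>dom I. ?R I gs (\<lambda>x. if x = y then d else f x)"
    then obtain d \<sigma> where d: "d \<in> dom I" "\<forall>x\<in>set xs. \<sigma> x \<in> dom I"
      "\<And>x. x \<notin> set xs \<Longrightarrow> \<sigma> x = (if x = y then d else f x)" "M I gs \<sigma>" by blast
    then have "\<sigma> y \<in> dom I" by metis
    then show "\<exists>\<sigma>. (\<forall>x\<in>set (y # xs). \<sigma> x \<in> dom I) \<and> (\<forall>x. x \<notin> set (y # xs) \<longrightarrow> \<sigma> x = f x) \<and> M I gs \<sigma>"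
      using d by (intro exI[of _ \<sigma>]) auto
  qed
  show ?case
    by (rule definable_cong[OF definable_disj[OF 1 2]]) (simp only: split bex_dom)
qed

end

section \<open>Definability of intensional atoms\<close>

lemma finite_atom_tvars: "finite (atom_tvars a)"
proof -
  have "finite (trm_tvars t)" for t by (cases t) auto
  then show ?thesis by (simp add: atom_tvars_def)
qed

lemma finite_body_ovars: "finite (body_ovars r)"
proof -
  have "finite (trm_ovars t)" for t by (cases t) auto
  then show ?thesis by (simp add: body_ovars_def atom_ovars_def)
qed

lemma eval_atom_cong:
  assumes "\<And>x. x \<in> atom_ovars a \<Longrightarrow> \<sigma> x = \<sigma>' x" "\<And>x. x \<in> atom_tvars a \<Longrightarrow> \<theta> x = \<theta>' x"
  shows "eval_atom \<sigma> \<theta> a = eval_atom \<sigma>' \<theta>' a"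
proof -
  have "eval_trm \<sigma> \<theta> t = eval_trm \<sigma>' \<theta>' t" if "t \<in> set (aargs a)" for t
  proof -
    have "trm_ovars t \<subseteq> atom_ovars a" "trm_tvars t \<subseteq> atom_tvars a"
      using that by (auto simp: atom_ovars_def atom_tvars_def)
    then show ?thesis using assms by (cases t) auto
  qed
  then show ?thesis by (simp add: eval_atom_def)
qed

lemma finite_depends: "finite \<Pi> \<Longrightarrow> finite (depends \<Pi>)"
proof -
  have "depends \<Pi> = (\<Union>r\<in>\<Pi>. (\<lambda>b. (apred (rhead r), apred b)) ` set (rbody r))"
    by (auto simp: depends_def)
  then show "finite \<Pi> \<Longrightarrow> finite (depends \<Pi>)" by simp
qed

locale nonrecursive_connected =
  fixes \<Pi> :: program
  assumes wf: "wf_program \<Pi>" and nonrec: "nonrecursive \<Pi>"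
    and conn: "\<And>r. r \<in> \<Pi> \<Longrightarrow> connected_rule r"
begin

sublocale constants "consts_of \<Pi>"
  by unfold_locales (use wf finite_consts_of in \<open>auto simp: wf_program_def\<close>)

text \<open>Evaluates a rule term symbolically, with the same \<open>t\<close> for every time
  variable; a connected rule has at most one.\<close>

fun symb :: "(nat \<Rightarrow> oterm) \<Rightarrow> stime \<Rightarrow> trm \<Rightarrow> sval" where
  "symb \<sigma>s t (OConst c) = SO (OC c)"
| "symb \<sigma>s t (OVar x) = SO (\<sigma>s x)"
| "symb \<sigma>s t (TConst c) = ST (TAbs c)"
| "symb \<sigma>s t (TVar x) = ST t"
| "symb \<sigma>s t (TPlus x k) = ST (tshift k t)"

lemma eval_atom_symb:
  "eval_atom (\<lambda>x. oval I e (\<sigma>s x)) (\<lambda>_. tval I t) a =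
    GAtom (apred a) (map (sval I e) (map (symb \<sigma>s t) (aargs a)))"
proof -
  have "eval_trm (\<lambda>x. oval I e (\<sigma>s x)) (\<lambda>_. tval I t) u = sval I e (symb \<sigma>s t u)" for u
    by (cases u) auto
  then show ?thesis by (simp add: eval_atom_def)
qed

lemma symb_ok:
  assumes "r \<in> \<Pi>" "a \<in> insert (rhead r) (set (rbody r))" "\<And>x. ook (\<sigma>s x)"
  shows "list_all sok (map (symb \<sigma>s t) (aargs a))"
proof -
  have "sok (symb \<sigma>s t u)" if "u \<in> set (aargs a)" for u
  proof -
    have "c \<in> consts_of \<Pi>" if "u = OConst c" for c
      using that \<open>u \<in> set (aargs a)\<close> assms(1,2) unfolding consts_of_def by blast
    then show ?thesis using assms(3) by (cases u) auto
  qed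
  then show ?thesis by (simp add: list_all_iff)
qed

text \<open>The time variable of a connected rule occurs in its head if it occurs at all, so
  matching the head against the goal fixes its value. The symbolic time \<open>t\<close> depends on
  the rule, \<open>P\<close> and \<open>ss\<close>, but not on the instance, as a single formula
  requires.\<close>

lemma head_determines_time:
  assumes "r \<in> \<Pi>"
  shows "\<exists>t. \<forall>I e \<sigma> \<theta>. eval_atom \<sigma> \<theta> (rhead r) = GAtom P (map (sval I e) ss) \<longrightarrow>
    (\<forall>a\<in>insert (rhead r) (set (rbody r)). eval_atom \<sigma> \<theta> a = eval_atom \<sigma> (\<lambda>_. tval I t) a)"
proof (cases "atom_tvars (rhead r) = {}")
  case True
  then have "atom_tvars a = {}" if "a \<in> insert (rhead r) (set (rbody r))" for a
    using conn[OF assms] that by (auto simp: connected_rule_def body_tvars_def)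
  then have "eval_atom \<sigma> \<theta> a = eval_atom \<sigma> \<theta>' a" if "a \<in> insert (rhead r) (set (rbody r))" for a \<sigma> \<theta> \<theta>'
    using that by (intro eval_atom_cong) auto
  then show ?thesis by blast
next
  case False
  then obtain x where x: "x \<in> atom_tvars (rhead r)" by blast
  have "card (atom_tvars (rhead r) \<union> body_tvars r) \<le> 1"
    using conn[OF assms] by (simp add: connected_rule_def)
  moreover have "finite (atom_tvars (rhead r) \<union> body_tvars r)"
    using finite_atom_tvars by (simp add: body_tvars_def)
  ultimately have single: "y = x" if "y \<in> atom_tvars (rhead r) \<union> body_tvars r" for y
    using x that by (metis UnI1 card_le_Suc0_iff_eq One_nat_def)
  have eq: "eval_atom \<sigma> \<theta> a = eval_atom \<sigma> (\<lambda>_. \<theta> x) a"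
    if "a \<in> insert (rhead r) (set (rbody r))" for a \<sigma> \<theta>
    by (rule eval_atom_cong) (use single that in \<open>auto simp: body_tvars_def\<close>)
  obtain j k where j: "j < length (aargs (rhead r))"
    and jk: "\<And>\<sigma> \<theta>. eval_trm \<sigma> \<theta> (aargs (rhead r) ! j) = GT (\<theta> x + k)"
  proof -
    obtain u where u: "u \<in> set (aargs (rhead r))" "x \<in> trm_tvars u"
      using x by (auto simp: atom_tvars_def)
    then obtain j where "j < length (aargs (rhead r))" "u = aargs (rhead r) ! j"
      by (metis in_set_conv_nth)
    moreover have "\<exists>k. \<forall>\<sigma> \<theta>. eval_trm \<sigma> \<theta> u = GT (\<theta> x + k)"
      using u(2) by (cases u) (auto intro: exI[of _ 0])
    ultimately show ?thesis using that by metis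
  qed
  have head: "length ss = length (aargs (rhead r)) \<and> sval I e (ss ! j) = GT (\<theta> x + k)"
    if h: "eval_atom \<sigma> \<theta> (rhead r) = GAtom P (map (sval I e) ss)" for I e \<sigma> \<theta>
  proof -
    have m: "map (eval_trm \<sigma> \<theta>) (aargs (rhead r)) = map (sval I e) ss"
      using h by (simp add: eval_atom_def)
    have l: "length ss = length (aargs (rhead r))" using arg_cong[OF m, of length] by simp
    show ?thesis using arg_cong[OF m, of "\<lambda>xs. xs ! j"] j jk l by simp
  qed
  show ?thesis
  proof (cases "\<exists>t. ss ! j = ST t")
    case True
    then obtain t where t: "ss ! j = ST t" by blast
    \<comment> \<open>The head term at position \<open>j\<close> adds \<open>k\<close> to the
      variable; shifting the goal's time back by \<open>k\<close> recovers it.\<close>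
    have "tval I (tshift (- k) t) = \<theta> x"
      if "eval_atom \<sigma> \<theta> (rhead r) = GAtom P (map (sval I e) ss)" for I e \<sigma> \<theta>
      using head[OF that] t by simp
    then show ?thesis using eq by (intro exI[of _ "tshift (- k) t"]) metis
  next
    \<comment> \<open>An object in the goal never matches a time term of the head, so the claim is
      vacuous.\<close>
    case False
    then have "sval I e (ss ! j) \<noteq> GT i" for I e i by (cases "ss ! j") auto
    then show ?thesis using head by metis
  qed
qed

text \<open>The time quantifier disappears because the head determines the time; the object
  quantifiers reduce to the finitely many variables of the body, which include those of the
  head.\<close>

lemma definable_rule:
  assumes r: "r \<in> \<Pi>" and ss: "list_all sok ss"
    and IH: "\<And>a ss'. a \<in> set (rbody r) \<Longrightarrow> list_all sok ss' \<Longrightarrow>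
      definable (\<lambda>I e. GAtom (apred a) (map (sval I e) ss') \<in> der \<Pi> (base b I) (dom I))"
  shows "definable (\<lambda>I e. \<exists>\<sigma> \<theta>. (\<forall>x. \<sigma> x \<in> dom I) \<and>
      eval_atom \<sigma> \<theta> (rhead r) = GAtom P (map (sval I e) ss) \<and>
      (\<forall>a\<in>set (rbody r). eval_atom \<sigma> \<theta> a \<in> der \<Pi> (base b I) (dom I)))"
proof -
  obtain t where t: "\<And>I e \<sigma> \<theta> a. eval_atom \<sigma> \<theta> (rhead r) = GAtom P (map (sval I e) ss) \<Longrightarrow>
      a \<in> insert (rhead r) (set (rbody r)) \<Longrightarrow> eval_atom \<sigma> \<theta> a = eval_atom \<sigma> (\<lambda>_. tval I t) a"
    using head_determines_time[OF r, of P ss] by blast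
  define M where "M I gs \<sigma> \<longleftrightarrow> eval_atom \<sigma> (\<lambda>_. tval I t) (rhead r) = GAtom P gs \<and>
      (\<forall>a\<in>set (rbody r). eval_atom \<sigma> (\<lambda>_. tval I t) a \<in> der \<Pi> (base b I) (dom I))" for I gs \<sigma>
  have M: "definable (\<lambda>I e. M I (map (sval I e) ss) (\<lambda>x. oval I e (\<sigma>s x)))"
    if \<sigma>s: "\<And>x. ook (\<sigma>s x)" and ss: "list_all sok ss" for \<sigma>s ss
  proof -
    have "definable (\<lambda>I e. GAtom (apred (rhead r)) (map (sval I e) (map (symb \<sigma>s t) (aargs (rhead r))))
        = GAtom P (map (sval I e) ss))"
      unfolding gatom.inject by (intro definable_logic definable_svals_eq symb_ok[OF r] \<sigma>s ss) simp
    moreover have "definable (\<lambda>I e. \<forall>a\<in>set (rbody r).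
        GAtom (apred a) (map (sval I e) (map (symb \<sigma>s t) (aargs a))) \<in> der \<Pi> (base b I) (dom I))"
      by (intro definable_ball IH symb_ok[OF r] \<sigma>s) auto
    ultimately show ?thesis unfolding M_def eval_atom_symb by (rule definable_conj)
  qed
  obtain xs where xs: "set xs = body_ovars r"
    using finite_list[OF finite_body_ovars] by blast
  have wfr: "wf_rule r" using wf r by (simp add: wf_program_def)
  have ov: "atom_ovars a \<subseteq> set xs" if "a \<in> insert (rhead r) (set (rbody r))" for a
    using that wfr by (auto simp: xs wf_rule_def body_ovars_def)
  have "definable (\<lambda>I e. \<exists>\<sigma>. (\<forall>x\<in>set xs. \<sigma> x \<in> dom I) \<and>
      (\<forall>x. x \<notin> set xs \<longrightarrow> \<sigma> x = oval I e (OV 0)) \<and> M I (map (sval I e) ss) \<sigma>)"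
    using definable_exists_assignment[of M, OF M, of "\<lambda>_. OV 0" ss xs] ss by simp
  then show ?thesis
  proof (rule definable_cong)
    fix I e assume b: "bounded I e"
    show "(\<exists>\<sigma> \<theta>. (\<forall>x. \<sigma> x \<in> dom I) \<and>
        eval_atom \<sigma> \<theta> (rhead r) = GAtom P (map (sval I e) ss) \<and>
        (\<forall>a\<in>set (rbody r). eval_atom \<sigma> \<theta> a \<in> der \<Pi> (base b I) (dom I))) \<longleftrightarrow>
      (\<exists>\<sigma>. (\<forall>x\<in>set xs. \<sigma> x \<in> dom I) \<and>
        (\<forall>x. x \<notin> set xs \<longrightarrow> \<sigma> x = oval I e (OV 0)) \<and> M I (map (sval I e) ss) \<sigma>)" (is "?L \<longleftrightarrow> ?R")
    proof
      assume ?L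
      then obtain \<sigma> \<theta> where \<sigma>: "\<forall>x. \<sigma> x \<in> dom I"
        and h: "eval_atom \<sigma> \<theta> (rhead r) = GAtom P (map (sval I e) ss)"
        and body: "\<And>a. a \<in> set (rbody r) \<Longrightarrow> eval_atom \<sigma> \<theta> a \<in> der \<Pi> (base b I) (dom I)" by blast
      define \<sigma>' where "\<sigma>' x = (if x \<in> set xs then \<sigma> x else oval I e (OV 0))" for x
      have "eval_atom \<sigma>' (\<lambda>_. tval I t) a = eval_atom \<sigma> \<theta> a"
        if "a \<in> insert (rhead r) (set (rbody r))" for a
        unfolding t[OF h that] by (rule eval_atom_cong) (use ov[OF that] in \<open>auto simp: \<sigma>'_def\<close>)
      then have "M I (map (sval I e) ss) \<sigma>'" using h body by (simp add: M_def)
      then show ?R using \<sigma> by (intro exI[of _ \<sigma>']) (auto simp: \<sigma>'_def)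
    next
      assume ?R
      then obtain \<sigma> where \<sigma>: "\<forall>x\<in>set xs. \<sigma> x \<in> dom I" "\<forall>x. x \<notin> set xs \<longrightarrow> \<sigma> x = oval I e (OV 0)"
        "M I (map (sval I e) ss) \<sigma>" by blast
      \<comment> \<open>The default for variables outside the rule must also lie in
        \<open>dom I\<close>, as \<open>der\<close> restricts every value of an assignment.\<close>
      have "oval I e (OV 0) \<in> dom I" using b by (simp add: dom_def)
      then have "\<forall>x. \<sigma> x \<in> dom I" using \<sigma>(1,2) by metis
      then show ?L using \<sigma>(3) unfolding M_def by blast
    qed
  qed
qed

text \<open>Well-founded induction along the dependency relation, which is finite and acyclic: one
  unfolding of \<open>der\<close> leads to body predicates, for which formulas already
  exist.\<close>

lemma definable_der:
  "list_all sok ss \<Longrightarrow> definable (\<lambda>I e. GAtom P (map (sval I e) ss) \<in> der \<Pi> (base b I) (dom I))"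
proof (induction P arbitrary: ss rule: wf_induct_rule[OF finite_acyclic_wf_converse])
  show "finite (depends \<Pi>)" using wf finite_depends by (simp add: wf_program_def)
  show "acyclic (depends \<Pi>)" using nonrec by (simp add: nonrecursive_def)
next
  fix P ss
  assume IH: "\<And>P' ss. (P', P) \<in> (depends \<Pi>)\<inverse> \<Longrightarrow> list_all sok ss \<Longrightarrow>
      definable (\<lambda>I e. GAtom P' (map (sval I e) ss) \<in> der \<Pi> (base b I) (dom I))"
    and ss: "list_all sok ss"
  have "definable (\<lambda>I e. \<exists>\<sigma> \<theta>. (\<forall>x. \<sigma> x \<in> dom I) \<and>
      eval_atom \<sigma> \<theta> (rhead r) = GAtom P (map (sval I e) ss) \<and>
      (\<forall>a\<in>set (rbody r). eval_atom \<sigma> \<theta> a \<in> der \<Pi> (base b I) (dom I)))" if r: "r \<in> \<Pi>" for r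
  proof (cases "apred (rhead r) = P")
    case True
    show ?thesis
      by (rule definable_rule[OF r ss], rule IH) (use True r in \<open>auto simp: depends_def\<close>)
  next
    case False
    then show ?thesis using definable_const[of False] by (simp add: eval_atom_def)
  qed
  then have "definable (\<lambda>I e. GAtom P (map (sval I e) ss) \<in> base b I \<or>
      (\<exists>r\<in>\<Pi>. \<exists>\<sigma> \<theta>. (\<forall>x. \<sigma> x \<in> dom I) \<and>
      eval_atom \<sigma> \<theta> (rhead r) = GAtom P (map (sval I e) ss) \<and>
      (\<forall>a\<in>set (rbody r). eval_atom \<sigma> \<theta> a \<in> der \<Pi> (base b I) (dom I))))"
    using wf by (intro definable_disj definable_in_base definable_bex) (auto simp: wf_program_def)
  moreover have unfold_der: "g \<in> der \<Pi> B X \<longleftrightarrow> g \<in> B \<or> (\<exists>r\<in>\<Pi>. \<exists>\<sigma> \<theta>. (\<forall>x. \<sigma> x \<in> X) \<and>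
      eval_atom \<sigma> \<theta> (rhead r) = g \<and> (\<forall>a\<in>set (rbody r). eval_atom \<sigma> \<theta> a \<in> der \<Pi> B X))" for g B X
    by (subst der.simps) blast
  ultimately show "definable (\<lambda>I e. GAtom P (map (sval I e) ss) \<in> der \<Pi> (base b I) (dom I))"
    by (elim definable_cong) (rule unfold_der)
qed

section \<open>Collapsing foreign objects and definability of DTP\<close>

definition collapse :: "inst \<Rightarrow> nat \<Rightarrow> nat" where
  "collapse I c = (if c \<in> dom I then c else star I)"

text \<open>The collapse fixes the constants and all objects of the data, and maps future facts to
  future facts, so it is a homomorphism into \<open>dom I\<close>.\<close>

lemma der_collapse:
  "g \<in> der \<Pi> (base b I) UNIV \<Longrightarrow> gmap (collapse I) g \<in> der \<Pi> (base b I) (dom I)"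
proof (erule der_homomorphism[rotated 3])
  show "range (collapse I) \<subseteq> dom I" using star_dom by (auto simp: collapse_def)
next
  fix g assume "g \<in> base b I"
  then consider "g \<in> set (facts I)" | "b" "g \<in> future (tin I)"
    by (auto simp: base_def split: if_splits)
  then show "gmap (collapse I) g \<in> base b I"
  proof cases
    case 1
    have "c \<in> dom I" if "c \<in> objects g" for c
      by (rule adom_dom) (use 1 that in \<open>auto simp: adom_def\<close>)
    then have "gmap (collapse I) g = g"
      by (intro gmap_id) (simp add: collapse_def)
    then show ?thesis using 1 by (simp add: base_def)
  next
    case 2
    then show ?thesis using future_gmap by (simp add: base_def)
  qed
qed (simp add: collapse_def C_dom)

text \<open>Confines both the witness of a failure and the derivations to \<open>dom I\<close> and
  fixes the length of the tuple, which makes the failure expressible.\<close>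

lemma not_DTP_iff:
  fixes P :: pred
  defines "A \<equiv> \<lambda>I os. GAtom P (map GO os @ [GT (tout I)])"
  assumes I: "valid I"
  shows "\<not> DTP (P, \<Pi>) (set (facts I)) (tin I) (tout I) \<longleftrightarrow>
    (\<exists>os. length os = length (psig P) - 1 \<and> set os \<subseteq> dom I \<and>
      A I os \<in> der \<Pi> (base True I) (dom I) \<and> A I os \<notin> der \<Pi> (base False I) (dom I))"
    (is "?L \<longleftrightarrow> ?R")
proof
  have base: "base True I = set (facts I) \<union> future (tin I)" "base False I = set (facts I)"
    by (simp_all add: base_def)
  have gmap_A: "gmap h (A I os) = A I (map h os)" for h os by (simp add: A_def gmap_def)
  have objects_A: "objects (A I os) = set os" for os by (auto simp: A_def objects_def)
  {
    assume ?L
    then obtain os where os: "A I os \<in> der \<Pi> (base True I) UNIV" "A I os \<notin> der \<Pi> (base False I) UNIV"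
      unfolding DTP_iff A_def base by blast
    have "fact g" if "g \<in> base True I" for g
      using that I by (auto simp: base valid_def future_def)
    from der_sorts[OF wf this os(1)] have "length os = length (psig P) - 1"
      by (auto simp: A_def dest: arg_cong[where f = length])
    moreover have "A I (map (collapse I) os) \<in> der \<Pi> (base True I) (dom I)"
      using der_collapse[OF os(1)] by (simp add: gmap_A)
    \<comment> \<open>If no object is moved, this is the assumption on \<open>os\<close>. Otherwise
      the collapsed tuple contains \<open>star\<close>, which no fact derived from the history
      does.\<close>
    moreover have "A I (map (collapse I) os) \<notin> der \<Pi> (base False I) (dom I)"
    proof
      assume d: "A I (map (collapse I) os) \<in> der \<Pi> (base False I) (dom I)"
      show False
      proof (cases "set os \<subseteq> dom I")
        case True
        then have "map (collapse I) os = os" by (intro map_idI) (auto simp: collapse_def)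
        then show False using d os(2) der_mono[OF d] by auto
      next
        case False
        then have "star I \<in> objects (A I (map (collapse I) os))"
          by (force simp: objects_A collapse_def)
        then have "star I \<in> consts_of \<Pi> \<union> adom I"
          using der_objects[OF wf d] by (simp add: base adom_def)
        then show False using star by auto
      qed
    qed
    moreover have "set (map (collapse I) os) \<subseteq> dom I" using star_dom by (auto simp: collapse_def)
    ultimately show ?R by (metis length_map)
  next
    assume ?R
    then obtain os where os: "set os \<subseteq> dom I" "A I os \<in> der \<Pi> (base True I) (dom I)"
      "A I os \<notin> der \<Pi> (base False I) (dom I)" by blast
    have "map (collapse I) os = os" using os(1) by (intro map_idI) (auto simp: collapse_def)
    then have "A I os \<notin> der \<Pi> (base False I) UNIV"
      using os(3) der_collapse[of "A I os" False I] by (auto simp: gmap_A)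
    moreover have "A I os \<in> der \<Pi> (base True I) UNIV" using der_mono[OF os(2)] by auto
    ultimately show ?L unfolding DTP_iff A_def base by blast
  }
qed

lemma definable_DTP: "definable (\<lambda>I e. DTP (P, \<Pi>) (set (facts I)) (tin I) (tout I))"
proof -
  let ?k = "length (psig P) - 1"
  define A where "A I os = GAtom P (map GO os @ [GT (tout I)])" for I os
  \<comment> \<open>The tuple is read off an assignment at the variables below \<open>?k\<close>, so
    that quantifying over tuples becomes quantifying over assignments.\<close>
  define M where "M I (gs :: gval list) \<sigma> \<longleftrightarrow> A I (map \<sigma> [0..<?k]) \<in> der \<Pi> (base True I) (dom I) \<and>
    \<not> A I (map \<sigma> [0..<?k]) \<in> der \<Pi> (base False I) (dom I)" for I gs \<sigma>
  have M: "definable (\<lambda>I e. M I (map (sval I e) ss) (\<lambda>x. oval I e (\<sigma>s x)))"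
    if \<sigma>s: "\<And>x. ook (\<sigma>s x)" for \<sigma>s ss
  proof -
    let ?ss = "map (\<lambda>x. SO (\<sigma>s x)) [0..<?k] @ [ST (TRel 0)]"
    have "A I (map (\<lambda>x. oval I e (\<sigma>s x)) [0..<?k]) = GAtom P (map (sval I e) ?ss)" for I e
      by (simp add: A_def)
    moreover have "list_all sok ?ss" using \<sigma>s by (simp add: list_all_iff)
    ultimately show ?thesis unfolding M_def by (simp only:) (intro definable_logic definable_der)
  qed
  have "definable (\<lambda>I e. \<not> (\<exists>\<sigma>. (\<forall>x\<in>set [0..<?k]. \<sigma> x \<in> dom I) \<and>
      (\<forall>x. x \<notin> set [0..<?k] \<longrightarrow> \<sigma> x = oval I e (OV 0)) \<and> M I (map (sval I e) []) \<sigma>))"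
    using definable_not[OF definable_exists_assignment[of M, OF M, of "\<lambda>_. OV 0" "[]" "[0..<?k]"]] by simp
  then show ?thesis
  proof (rule definable_cong)
    fix I e assume I: "valid I"
    have "(\<exists>os. length os = ?k \<and> set os \<subseteq> dom I \<and>
        A I os \<in> der \<Pi> (base True I) (dom I) \<and> A I os \<notin> der \<Pi> (base False I) (dom I)) \<longleftrightarrow>
      (\<exists>\<sigma>. (\<forall>x\<in>set [0..<?k]. \<sigma> x \<in> dom I) \<and>
      (\<forall>x. x \<notin> set [0..<?k] \<longrightarrow> \<sigma> x = oval I e (OV 0)) \<and> M I (map (sval I e) []) \<sigma>)" (is "?L \<longleftrightarrow> ?R")
    proof
      assume ?L
      then obtain os where os: "length os = ?k" "set os \<subseteq> dom I"
        "A I os \<in> der \<Pi> (base True I) (dom I)" "A I os \<notin> der \<Pi> (base False I) (dom I)" by blast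
      define \<sigma> where "\<sigma> x = (if x < ?k then os ! x else oval I e (OV 0))" for x
      have "map \<sigma> [0..<?k] = os"
        by (rule nth_equalityI) (auto simp: \<sigma>_def os(1))
      then have "M I (map (sval I e) []) \<sigma>" using os unfolding M_def by metis
      moreover have "\<forall>x\<in>set [0..<?k]. \<sigma> x \<in> dom I" using os(1,2) by (auto simp: \<sigma>_def)
      ultimately show ?R by (intro exI[of _ \<sigma>]) (auto simp: \<sigma>_def)
    next
      assume ?R
      then obtain \<sigma> where "\<forall>x\<in>set [0..<?k]. \<sigma> x \<in> dom I" "M I (map (sval I e) []) \<sigma>" by blast
      then show ?L unfolding M_def by (intro exI[of _ "map \<sigma> [0..<?k]"]) auto
    qed
    then show "DTP (P, \<Pi>) (set (facts I)) (tin I) (tout I) \<longleftrightarrow>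
      \<not> (\<exists>\<sigma>. (\<forall>x\<in>set [0..<?k]. \<sigma> x \<in> dom I) \<and>
      (\<forall>x. x \<notin> set [0..<?k] \<longrightarrow> \<sigma> x = oval I e (OV 0)) \<and> M I (map (sval I e) []) \<sigma>)"
      using not_DTP_iff[OF I, of P, folded A_def] by argo
  qed
qed

end

theorem theorem6:
  assumes "temporal_query Q"
    and "nonrecursive (snd Q)"
    and "connected_query Q"
  shows "DTP_in_PTIME_data Q"
proof -
  obtain P \<Pi> where Q: "Q = (P, \<Pi>)" by (cases Q)
  interpret nonrecursive_connected \<Pi>
    using assms by unfold_locales (auto simp: Q temporal_query_def is_query_def connected_query_def)
  obtain \<phi> where \<phi>: "\<And>I e. valid I \<Longrightarrow> bounded I e \<Longrightarrow>
      sat (word I) e \<phi> \<longleftrightarrow> DTP Q (set (facts I)) (tin I) (tout I)"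
    using definable_DTP[of P] unfolding definable_def Q by blast
  obtain M c k where M: "wf_tm M" "\<And>w. set w \<subseteq> {0<..<input_alphabet} \<Longrightarrow>
     fst (tm_run M (c * length w ^ k + c) w) = (if sat w (\<lambda>_. 0) \<phi> then 1 else 2)"
    using sat_polynomial_time[of \<phi>] by blast
  show ?thesis
    unfolding DTP_in_PTIME_data_def
  proof (rule exI[of _ M], rule exI[of _ c], rule exI[of _ k], intro conjI allI impI, rule M(1), elim conjE)
    fix D \<tau>in \<tau>out xs
    assume h: "history \<tau>in D" "\<tau>out \<le> \<tau>in" "set xs = D"
    define I where "I = Inst xs \<tau>in \<tau>out"
    have "valid I" using h by (auto simp: I_def valid_def history_def dataset_def)
    \<comment> \<open>The relation defined by \<open>\<phi>\<close> does not depend on the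
      environment; the all-zero one corresponds to all heads starting at position 0.\<close>
    moreover have "bounded I (\<lambda>_. 0)" by (simp add: bounded_def)
    ultimately have "sat (word I) (\<lambda>_. 0) \<phi> \<longleftrightarrow> DTP Q D \<tau>in \<tau>out"
      using \<phi> h(3) by (simp add: I_def)
    moreover have "word I = enc_instance xs \<tau>in \<tau>out" by (simp add: I_def word_def)
    ultimately show "let w = enc_instance xs \<tau>in \<tau>out; q = fst (tm_run M (c * length w ^ k + c) w)
       in (q = 1 \<or> q = 2) \<and> (q = 1 \<longleftrightarrow> DTP Q D \<tau>in \<tau>out)"
      using M(2)[OF set_word[of I]] by (simp add: Let_def)
  qed
qed

end
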